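(* Let $G$ be a finite graph with $\operatorname{mad}(G) < 3$. Then $G$ is weighted $2^{-30}$-flexibly $3$-choosable.
   Context: All graphs are finite and simple. The maximum average degree $\operatorname{mad}(G)$ is the maximum of $\frac{2|E(H)|}{|V(H)|}$ over all nonempty subgraphs $H \subseteq G$. A $k$-assignment on $G$ is a map $L$ assigning to each vertex $v$ a set $L(v)$ of exactly $k$ colors (positive integers). An $L$-coloring is a proper coloring $\phi$ of $G$ with $\phi(v) \in L(v)$ for all $v$. A weighted request on $G$ with list assignment $L$ is a function $w$ assigning a nonnegative real number $w(v,c)$ to each pair $(v,c)$ with $v \in V(G)$, $c \in L(v)$. For $\varepsilon>0$, $G$ is weighted $\varepsilon$-flexibly $k$-choosable if for every $k$-assignment $L$ on $G$ and every weighted request $w$ there is an $L$-coloring $\phi$ of $G$ with $\sum_{v \in V(G)} w(v,\phi(v)) \ge \varepsilon \sum_{v\in V(G)}\sum_{c \in L(v)} w(v,c)$. *)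

theory Defs
  imports Complex_Main
begin

text \<open>A graph is given by its vertex set and its set of edges, each edge being the
  two-element set of its endpoints.\<close>

definition finite_simple_graph :: "'a set \<Rightarrow> 'a set set \<Rightarrow> bool" where
  "finite_simple_graph V E \<longleftrightarrow> finite V \<and> (\<forall>e\<in>E. e \<subseteq> V \<and> card e = 2)"

definition subgraph :: "'a set \<Rightarrow> 'a set set \<Rightarrow> 'a set \<Rightarrow> 'a set set \<Rightarrow> bool" where
  "subgraph W F V E \<longleftrightarrow> finite_simple_graph W F \<and> W \<subseteq> V \<and> F \<subseteq> E"

text \<open>The graph without vertices has no nonempty subgraph; its maximum average degree
  is 0 by convention. For every other finite graph the maximum below is over a finite nonempty set.\<close>

definition mad :: "'a set \<Rightarrow> 'a set set \<Rightarrow> real" where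
  "mad V E = (if V = {} then 0
     else Max {2 * real (card F) / real (card W) | W F. subgraph W F V E \<and> W \<noteq> {}})"

text \<open>Colors are positive integers. Values of \<open>L\<close>, \<open>w\<close> and \<open>\<phi>\<close> outside the vertex set
  (and of \<open>w\<close> at colors not in the list) are unconstrained and never used. Finiteness is
  stated separately because infinite sets have cardinality 0 in HOL.\<close>

definition k_assignment :: "nat \<Rightarrow> 'a set \<Rightarrow> ('a \<Rightarrow> nat set) \<Rightarrow> bool" where
  "k_assignment k V L \<longleftrightarrow> (\<forall>v\<in>V. L v \<subseteq> {0<..} \<and> finite (L v) \<and> card (L v) = k)"

definition proper_coloring :: "'a set \<Rightarrow> 'a set set \<Rightarrow> ('a \<Rightarrow> nat) \<Rightarrow> bool" where
  "proper_coloring V E \<phi> \<longleftrightarrow> (\<forall>u\<in>V. \<forall>v\<in>V. {u, v} \<in> E \<longrightarrow> \<phi> u \<noteq> \<phi> v)"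

definition L_coloring ::
    "'a set \<Rightarrow> 'a set set \<Rightarrow> ('a \<Rightarrow> nat set) \<Rightarrow> ('a \<Rightarrow> nat) \<Rightarrow> bool" where
  "L_coloring V E L \<phi> \<longleftrightarrow> proper_coloring V E \<phi> \<and> (\<forall>v\<in>V. \<phi> v \<in> L v)"

definition weighted_request ::
    "'a set \<Rightarrow> ('a \<Rightarrow> nat set) \<Rightarrow> ('a \<Rightarrow> nat \<Rightarrow> real) \<Rightarrow> bool" where
  "weighted_request V L w \<longleftrightarrow> (\<forall>v\<in>V. \<forall>c\<in>L v. 0 \<le> w v c)"

definition weighted_flexibly_choosable ::
    "real \<Rightarrow> nat \<Rightarrow> 'a set \<Rightarrow> 'a set set \<Rightarrow> bool" where
  "weighted_flexibly_choosable \<epsilon> k V E \<longleftrightarrow>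
     (\<forall>L w. k_assignment k V L \<longrightarrow> weighted_request V L w \<longrightarrow>
        (\<exists>\<phi>. L_coloring V E L \<phi> \<and>
           (\<Sum>v\<in>V. w v (\<phi> v)) \<ge> \<epsilon> * (\<Sum>v\<in>V. \<Sum>c\<in>L v. w v c)))"

end

theory Submission
  imports Defs
begin

text \<open>Flexibility is proved in functional form: for all nonnegative rewards \<open>a v c\<close> for giving \<open>v\<close> the
  colour \<open>c\<close> and \<open>b v c\<close> for avoiding \<open>c\<close> at \<open>v\<close>, some colouring collects a fixed proportion of both
  totals. This passes through the removal of an induced subgraph \<open>H\<close> if every colouring of the rest
  extends to \<open>H\<close> with a good payoff and every request \<open>(v, c)\<close> in \<open>H\<close> can be blocked by one outside
  vertex with one colour only: that request becomes an avoidance reward at the outside vertex.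

  Two kinds of parts have such extensions. In an induced forest whose vertices have at most one
  outside neighbour all lists keep two colours, and there are two colourings that differ everywhere.
  In a connected subcubic part with at most one outgoing edge and a vertex of degree at most two,
  one fixes colours on a set \<open>S\<close> of vertices at distance at least 11 from each other; the colouring
  extends because an uncolourable component of the remainder is a Gallai tree, hence has too
  many missing edges compared with its order.

  Discharging finds these parts: vertices of degree at least four must pay one unit for every
  vertex of degree two in the components of the vertices of degree at most three, and if a vertex
  \<open>y\<close> cannot pay, then \<open>y\<close> with shortest paths to those vertices of degree two, or with whole
  components attached only to \<open>y\<close>, splits into at most three parts as above.\<close>

section \<open>List colourings of vertex sets\<close>

text \<open>The outside is coloured before the removed part and without regard to it, so a request
  has to be insured in advance. This is why avoidance rewards belong to the statement itself, and
  why the blocking vertex and colour must not depend on the colouring. A request is discounted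
  twice, by \<open>\<kappa>\<close> when its value is deposited outside and by
  \<open>\<delta>\<close> when deposits are collected; hence the product
  \<open>\<kappa> * \<delta>\<close>.

  Here 1/\<open>\<kappa>\<close> is 27630 = 3 * 3 * 3070 and 1/\<open>\<delta>\<close> is 18420 = 3
  * 2 * 3070: at most three parts, averages 1/3 and 1/2 over two or three feasible colours, and
  balls of radius 10 with at most 3070 vertices. The product 508944600 is below 2^30. Radius 10
  makes the balls of radius 5 about the points of \<open>S\<close> disjoint, and five levels suffice
  to find, up to a loss of two near a forbidden colour, three vertices of an uncolourable component
  for each of its edges to \<open>S\<close>. The Gallai bound leaves room for fewer.\<close>

locale ugraph =
  fixes adj :: "'a \<Rightarrow> 'a \<Rightarrow> bool"
  assumes sym: "adj u v \<Longrightarrow> adj v u"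
    and irrefl: "\<not> adj v v"
begin

definition nbs :: "'a set \<Rightarrow> 'a \<Rightarrow> 'a set" where
  "nbs X v = {u \<in> X. adj v u}"

definition deg :: "'a set \<Rightarrow> 'a \<Rightarrow> nat" where
  "deg X v = card (nbs X v)"

text \<open>Connectivity by cuts instead of paths: each use asks for an edge leaving a proper
  nonempty subset. The empty set is connected in this sense.\<close>

definition conn :: "'a set \<Rightarrow> bool" where
  "conn X \<longleftrightarrow> (\<forall>P. P \<subseteq> X \<longrightarrow> P \<noteq> {} \<longrightarrow> P \<noteq> X \<longrightarrow> (\<exists>p\<in>P. \<exists>q\<in>X - P. adj p q))"

definition col :: "'a set \<Rightarrow> ('a \<Rightarrow> nat set) \<Rightarrow> ('a \<Rightarrow> nat) \<Rightarrow> bool" where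
  "col X M \<phi> \<longleftrightarrow> (\<forall>v\<in>X. \<phi> v \<in> M v) \<and> (\<forall>u\<in>X. \<forall>v\<in>X. adj u v \<longrightarrow> \<phi> u \<noteq> \<phi> v)"

definition colorable :: "'a set \<Rightarrow> ('a \<Rightarrow> nat set) \<Rightarrow> bool" where
  "colorable X M \<longleftrightarrow> (\<exists>\<phi>. col X M \<phi>)"

lemma connD:
  assumes "conn X" "P \<subseteq> X" "P \<noteq> {}" "P \<noteq> X"
  obtains p q where "p \<in> P" "q \<in> X - P" "adj p q"
  using assms unfolding conn_def by blast

lemma mem_nbs: "u \<in> nbs X v \<longleftrightarrow> u \<in> X \<and> adj v u"
  by (simp add: nbs_def)

lemma finite_nbs: "finite X \<Longrightarrow> finite (nbs X v)"
  by (simp add: nbs_def)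

lemma deg_mono: "finite Y \<Longrightarrow> X \<subseteq> Y \<Longrightarrow> deg X v \<le> deg Y v"
  unfolding deg_def nbs_def by (rule card_mono) auto

lemma deg_less:
  assumes "finite Y" "X \<subseteq> Y" "q \<in> Y - X" "adj v q"
  shows "deg X v < deg Y v"
  unfolding deg_def
proof (rule psubset_card_mono)
  show "finite (nbs Y v)" using assms by (simp add: finite_nbs)
  show "nbs X v \<subset> nbs Y v" using assms unfolding nbs_def by blast
qed

lemma deg_Un:
  assumes "finite X" "finite Y" "X \<inter> Y = {}"
  shows "deg (X \<union> Y) v = deg X v + deg Y v"
proof -
  have "nbs (X \<union> Y) v = nbs X v \<union> nbs Y v" by (auto simp: nbs_def)
  moreover have "nbs X v \<inter> nbs Y v = {}" using assms(3) by (auto simp: nbs_def)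
  ultimately show ?thesis
    unfolding deg_def using assms by (simp add: card_Un_disjoint finite_nbs)
qed

lemma deg_diff:
  assumes "finite X" "Y \<subseteq> X"
  shows "deg X v = deg Y v + deg (X - Y) v"
proof -
  have "finite Y" using assms finite_subset by blast
  then show ?thesis
    using deg_Un[of Y "X - Y" v] assms by (simp add: Un_absorb1)
qed

lemma deg_singleton: "deg {u} v = (if adj v u then 1 else 0)"
proof -
  have "nbs {u} v = (if adj v u then {u} else {})" by (auto simp: nbs_def)
  then show ?thesis by (simp add: deg_def)
qed

lemma col_combine:
  assumes "col Y M \<phi>" "col Z (\<lambda>v. M v - \<phi> ` nbs Y v) \<psi>" "Y \<inter> Z = {}"
  shows "col (Y \<union> Z) M (\<lambda>v. if v \<in> Z then \<psi> v else \<phi> v)"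
proof -
  have cross: "\<psi> z \<noteq> \<phi> y" if "z \<in> Z" "y \<in> Y" "adj z y" for z y
    using assms(2) that unfolding col_def nbs_def by blast
  show ?thesis
    unfolding col_def
  proof (intro conjI ballI impI)
    fix v assume "v \<in> Y \<union> Z"
    then show "(if v \<in> Z then \<psi> v else \<phi> v) \<in> M v"
      using assms unfolding col_def by auto
  next
    fix u v assume uv: "u \<in> Y \<union> Z" "v \<in> Y \<union> Z" "adj u v"
    show "(if u \<in> Z then \<psi> u else \<phi> u) \<noteq> (if v \<in> Z then \<psi> v else \<phi> v)"
    proof (cases "u \<in> Z"; cases "v \<in> Z")
      assume "u \<in> Z" "v \<in> Z"
      then show ?thesis using assms(2) uv unfolding col_def by auto
    next
      assume "u \<in> Z" "v \<notin> Z"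
      then show ?thesis using cross[of u v] uv by auto
    next
      assume "u \<notin> Z" "v \<in> Z"
      then show ?thesis using cross[of v u] uv sym[OF uv(3)] by auto
    next
      assume "u \<notin> Z" "v \<notin> Z"
      then show ?thesis using assms(1) uv unfolding col_def by auto
    qed
  qed
qed

lemma colorable_combine:
  assumes "col Y M \<phi>" "colorable Z (\<lambda>v. M v - \<phi> ` nbs Y v)" "Y \<inter> Z = {}"
  shows "\<exists>\<psi>. col (Y \<union> Z) M \<psi> \<and> (\<forall>v\<in>Y. \<psi> v = \<phi> v)"
proof -
  obtain \<psi> where "col Z (\<lambda>v. M v - \<phi> ` nbs Y v) \<psi>"
    using assms(2) unfolding colorable_def by blast
  from col_combine[OF assms(1) this assms(3)] show ?thesis
    using assms(3) by (intro exI[of _ "\<lambda>v. if v \<in> Z then \<psi> v else \<phi> v"]) auto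
qed

lemma card_diff_image_nbs:
  assumes "finite Y"
  shows "card (M v - \<phi> ` nbs Y v) + deg Y v \<ge> card (M v)"
proof -
  have "card (M v) - card (\<phi> ` nbs Y v) \<le> card (M v - \<phi> ` nbs Y v)"
    using assms by (intro diff_card_le_card_Diff) (simp add: finite_nbs)
  moreover have "card (\<phi> ` nbs Y v) \<le> deg Y v"
    unfolding deg_def using assms by (simp add: card_image_le finite_nbs)
  ultimately show ?thesis by linarith
qed

text \<open>Greedy colouring in reverse order of removal: the vertex given for \<open>U = X\<close>
  is coloured last, and the hypothesis is inherited by \<open>X - {v}\<close>.\<close>

lemma colorable_degenerate:
  assumes "finite X" "\<And>U. U \<subseteq> X \<Longrightarrow> U \<noteq> {} \<Longrightarrow> \<exists>v\<in>U. deg U v < card (M v)"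
  shows "colorable X M"
  using assms
proof (induction X rule: finite_remove_induct)
  case empty
  then show ?case by (simp add: colorable_def col_def)
next
  case (remove X)
  obtain v where v: "v \<in> X" "deg X v < card (M v)"
    using remove.prems[of X] remove.hyps by auto
  have "colorable (X - {v}) M"
    using remove.IH[OF v(1)] remove.prems by blast
  then obtain \<phi> where \<phi>: "col (X - {v}) M \<phi>" unfolding colorable_def by blast
  have "deg (X - {v}) v < card (M v)"
    using v(2) deg_mono[OF remove.hyps(1) Diff_subset, of "{v}" v] by linarith
  then have "card (M v - \<phi> ` nbs (X - {v}) v) > 0"
    using card_diff_image_nbs[of "X - {v}" M v \<phi>] remove.hyps(1) by simp
  then obtain c where "c \<in> M v - \<phi> ` nbs (X - {v}) v"
    by (metis all_not_in_conv card.empty less_irrefl)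
  then have "col {v} (\<lambda>u. M u - \<phi> ` nbs (X - {v}) u) (\<lambda>_. c)"
    by (simp add: col_def irrefl)
  then have "colorable {v} (\<lambda>u. M u - \<phi> ` nbs (X - {v}) u)"
    unfolding colorable_def by blast
  moreover have "(X - {v}) \<union> {v} = X" "(X - {v}) \<inter> {v} = {}" using v(1) by auto
  ultimately show ?case
    using colorable_combine[OF \<phi>] unfolding colorable_def by metis
qed

text \<open>A proper nonempty subset has an edge leaving it, so one of its vertices has smaller
  degree there than in \<open>X\<close>; for the whole of \<open>X\<close> the vertex
  \<open>x\<close> serves. Greedy colouring then applies. This is the easy half of
  degree-choosability.\<close>

lemma colorable_surplus:
  assumes "finite X" "conn X" "\<And>v. v \<in> X \<Longrightarrow> deg X v \<le> card (M v)"
    and "x \<in> X" "deg X x < card (M x)"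
  shows "colorable X M"
proof (rule colorable_degenerate[OF assms(1)])
  fix U assume U: "U \<subseteq> X" "U \<noteq> {}"
  show "\<exists>v\<in>U. deg U v < card (M v)"
  proof (cases "U = X")
    case True
    then show ?thesis using assms by auto
  next
    case False
    obtain p q where pq: "p \<in> U" "q \<in> X - U" "adj p q"
      using connD[OF assms(2) U False] .
    have "deg U p < deg X p" using deg_less assms(1) U pq by blast
    then show ?thesis using assms(3)[of p] pq U by (meson less_le_trans subsetD)
  qed
qed

text \<open>As \<open>X\<close> is nonempty, every nonempty subset of \<open>A - X\<close> has an
  edge leaving it inside \<open>A\<close>, so \<open>A - X\<close> can be coloured greedily. A
  vertex of \<open>X\<close> then loses at most one colour for each neighbour it loses.\<close>

lemma uncolorable_subset:
  assumes "finite A" "conn A" "\<And>v. v \<in> A \<Longrightarrow> deg A v \<le> card (M v)"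
    and "\<not> colorable A M" "X \<subseteq> A" "X \<noteq> {}"
  obtains M' where "\<And>v. v \<in> X \<Longrightarrow> deg X v \<le> card (M' v)" "\<not> colorable X M'"
proof -
  have "colorable (A - X) M"
  proof (rule colorable_degenerate)
    show "finite (A - X)" using assms(1) by simp
    fix U assume U: "U \<subseteq> A - X" "U \<noteq> {}"
    obtain p q where pq: "p \<in> U" "q \<in> A - U" "adj p q"
    proof (rule connD[OF assms(2)])
      show "U \<subseteq> A" "U \<noteq> {}" "U \<noteq> A" using U assms(5,6) by auto
    qed
    have "deg U p < deg A p"
      using deg_less[of A U q p] assms(1) U pq by blast
    then show "\<exists>v\<in>U. deg U v < card (M v)"
      using assms(3)[of p] pq U by (meson DiffD1 less_le_trans subsetD)
  qed
  then obtain \<phi> where \<phi>: "col (A - X) M \<phi>" unfolding colorable_def by blast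
  let ?M = "\<lambda>v. M v - \<phi> ` nbs (A - X) v"
  have "deg X v \<le> card (?M v)" if "v \<in> X" for v
    using card_diff_image_nbs[of "A - X" M v \<phi>] assms(1) assms(3)[of v]
      deg_diff[of A X v] assms(5) that by auto
  moreover have "\<not> colorable X ?M"
  proof
    assume "colorable X ?M"
    from colorable_combine[OF \<phi> this] have "colorable ((A - X) \<union> X) M"
      unfolding colorable_def by blast
    then show False using assms(4,5) by (simp add: Un_absorb2)
  qed
  ultimately show ?thesis by (rule that)
qed

text \<open>Splitting along an edgeless cut leaves at least one side uncolourable; repeating this
  ends in a connected side.\<close>

lemma uncolorable_component:
  assumes "finite Y" "\<not> colorable Y M"
  shows "\<exists>A\<subseteq>Y. A \<noteq> {} \<and> conn A \<and> (\<forall>p\<in>A. nbs Y p \<subseteq> A) \<and> \<not> colorable A M"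
  using assms
proof (induction Y rule: finite_psubset_induct)
  case (psubset Y)
  have ne: "Y \<noteq> {}" using psubset.prems by (auto simp: colorable_def col_def)
  show ?case
  proof (cases "conn Y")
    case True
    then show ?thesis using psubset.prems ne by (intro exI[of _ Y]) (auto simp: nbs_def)
  next
    case False
    then obtain P where P: "P \<subseteq> Y" "P \<noteq> {}" "P \<noteq> Y" "\<And>p q. p \<in> P \<Longrightarrow> q \<in> Y - P \<Longrightarrow> \<not> adj p q"
      unfolding conn_def by blast
    have "\<not> colorable P M \<or> \<not> colorable (Y - P) M"
    proof (rule ccontr)
      assume "\<not> ?thesis"
      then obtain \<phi> \<psi> where c: "col P M \<phi>" "col (Y - P) M \<psi>" unfolding colorable_def by blast
      have "nbs P v = {}" if "v \<in> Y - P" for v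
        using P(4) that sym unfolding nbs_def by blast
      then have "col (Y - P) (\<lambda>v. M v - \<phi> ` nbs P v) \<psi>"
        using c(2) unfolding col_def by auto
      from col_combine[OF c(1) this] have "colorable (P \<union> (Y - P)) M" unfolding colorable_def by blast
      then show False using psubset.prems P(1) by (simp add: Un_absorb1)
    qed
    then obtain Z where Z: "Z = P \<or> Z = Y - P" "\<not> colorable Z M" by blast
    have "Z \<subset> Y" using Z(1) P by blast
    from psubset.IH[OF this Z(2)] obtain A where
      A: "A \<subseteq> Z" "A \<noteq> {}" "conn A" "\<forall>p\<in>A. nbs Z p \<subseteq> A" "\<not> colorable A M" by blast
    have "nbs Y p \<subseteq> A" if "p \<in> A" for p
    proof -
      have "nbs Y p \<subseteq> nbs Z p"
        using P(4) A(1) that Z(1) sym unfolding nbs_def by blast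
      then show ?thesis using A(4) that by blast
    qed
    then show ?thesis using A \<open>Z \<subset> Y\<close> by (intro exI[of _ A]) auto
  qed
qed

section \<open>Uncolourable subcubic sets\<close>

text \<open>The number of edge ends missing from 3-regularity, with degrees taken inside
  \<open>A\<close>; integers avoid truncated subtraction.\<close>

definition defect :: "'a set \<Rightarrow> int" where
  "defect A = (\<Sum>v\<in>A. 3 - int (deg A v))"

text \<open>The cut edge is stored together with its side \<open>P\<close>, so that the two sides
  can be exchanged by \<open>bridge_sym\<close>.\<close>

definition bridge :: "'a set \<Rightarrow> 'a set \<Rightarrow> 'a \<Rightarrow> 'a \<Rightarrow> bool" where
  "bridge A P p q \<longleftrightarrow> P \<subseteq> A \<and> p \<in> P \<and> q \<in> A - P \<and> adj p q \<and>
     (\<forall>p'\<in>P. \<forall>q'\<in>A - P. adj p' q' \<longrightarrow> p' = p \<and> q' = q)"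

lemma bridge_sym: "bridge A P p q \<Longrightarrow> bridge A (A - P) q p"
  unfolding bridge_def using sym by blast

text \<open>An edgeless cut of \<open>P\<close> has a side without \<open>p\<close>. Edges leave
  \<open>P\<close> only at \<open>p\<close>, so that side would be cut off from all of
  \<open>A\<close>.\<close>

lemma bridge_conn:
  assumes "conn A" "bridge A P p q"
  shows "conn P"
  unfolding conn_def
proof (intro allI impI)
  fix U assume U: "U \<subseteq> P" "U \<noteq> {}" "U \<noteq> P"
  show "\<exists>x\<in>U. \<exists>y\<in>P - U. adj x y"
  proof (rule ccontr)
    assume no: "\<not> ?thesis"
    have b: "P \<subseteq> A" "p \<in> P" "q \<in> A - P" and
      un: "\<And>p' q'. p' \<in> P \<Longrightarrow> q' \<in> A - P \<Longrightarrow> adj p' q' \<Longrightarrow> p' = p"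
      using assms(2) unfolding bridge_def by auto
    show False
    proof (cases "p \<in> U")
      case True
      have "P - U \<subseteq> A" "P - U \<noteq> {}" "P - U \<noteq> A" using U b by auto
      then obtain x y where "x \<in> P - U" "y \<in> A - (P - U)" "adj x y"
        using connD[OF assms(1)] by metis
      then show False using no un True sym by blast
    next
      case False
      have "U \<subseteq> A" "U \<noteq> {}" "U \<noteq> A" using U b by auto
      then obtain x y where "x \<in> U" "y \<in> A - U" "adj x y"
        using connD[OF assms(1)] by metis
      then show False using no un False U by blast
    qed
  qed
qed

lemma bridge_deg:
  assumes "finite A" "bridge A P p q" "v \<in> P"
  shows "deg A v = deg P v + (if v = p then 1 else 0)"
proof -
  have "nbs (A - P) v = (if v = p then {q} else {})"
    using assms unfolding bridge_def nbs_def by auto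
  then have "deg (A - P) v = (if v = p then 1 else 0)" by (simp add: deg_def)
  moreover have "deg A v = deg P v + deg (A - P) v"
    using deg_diff assms unfolding bridge_def by blast
  ultimately show ?thesis by simp
qed

text \<open>Each end of the bridge has one degree less in its own side; this accounts for the
  2.\<close>

lemma bridge_defect:
  assumes "finite A" "bridge A P p q"
  shows "defect A = defect P + defect (A - P) - 2"
proof -
  have half: "(\<Sum>v\<in>P. 3 - int (deg A v)) = defect P - 1" if b: "bridge A P p q" for P p q
  proof -
    have fin: "finite P" using b assms(1) finite_subset unfolding bridge_def by blast
    have "(\<Sum>v\<in>P. 3 - int (deg A v)) = (\<Sum>v\<in>P. (3 - int (deg P v)) - (if v = p then 1 else 0))"
      by (rule sum.cong) (simp_all add: bridge_deg[OF assms(1) b])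
    also have "\<dots> = defect P - (\<Sum>v\<in>P. if v = p then 1 else 0)"
      by (simp add: sum_subtractf defect_def)
    also have "(\<Sum>v\<in>P. if v = p then 1 else 0) = (1::int)"
      using fin b unfolding bridge_def by simp
    finally show ?thesis .
  qed
  have "P \<subseteq> A" using assms(2) unfolding bridge_def by blast
  then have "defect A = (\<Sum>v\<in>A - P. 3 - int (deg A v)) + (\<Sum>v\<in>P. 3 - int (deg A v))"
    unfolding defect_def using assms(1) by (intro sum.subset_diff)
  then show ?thesis using half[OF assms(2)] half[OF bridge_sym[OF assms(2)]] by simp
qed

text \<open>Every colouring of either side of a bridge gives its end the same colour, so deleting this
  colour from the list of the end leaves an uncolourable side whose lists are still large enough.\<close>

lemma bridge_side_uncolorable:
  assumes "finite A" "conn A" "bridge A P p q" "\<And>v. v \<in> A \<Longrightarrow> deg A v \<le> card (M v)"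
    and "\<not> colorable A M"
  obtains M' where "\<And>v. v \<in> P \<Longrightarrow> deg P v \<le> card (M' v)" "\<not> colorable P M'"
proof -
  have sub: "P \<subseteq> A" "p \<in> P" "q \<in> A - P" using assms(3) unfolding bridge_def by auto
  have side: "colorable P M" if b: "bridge A P p q" for P p q
  proof (rule colorable_surplus)
    show "finite P" using b assms(1) finite_subset unfolding bridge_def by blast
    show "conn P" using bridge_conn[OF assms(2) b] .
    have PA: "P \<subseteq> A" and p: "p \<in> P" using b unfolding bridge_def by blast+
    show "deg P v \<le> card (M v)" if "v \<in> P" for v
    proof -
      have "deg A v \<le> card (M v)" using assms(4) PA that by blast
      then show ?thesis using bridge_deg[OF assms(1) b that] by linarith
    qed
    show "p \<in> P" by (rule p)
    have "deg A p \<le> card (M p)" using assms(4) PA p by blast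
    then show "deg P p < card (M p)" using bridge_deg[OF assms(1) b p] by simp
  qed
  obtain \<psi> where \<psi>: "col (A - P) M \<psi>"
    using side[OF bridge_sym[OF assms(3)]] unfolding colorable_def by blast
  let ?M = "\<lambda>v. if v = p then M v - {\<psi> q} else M v"
  have "deg P v \<le> card (?M v)" if "v \<in> P" for v
  proof (cases "v = p")
    case True
    have "card (M p) - card {\<psi> q} \<le> card (M p - {\<psi> q})" by (rule diff_card_le_card_Diff) simp
    moreover have "deg A p \<le> card (M p)" using assms(4) sub by blast
    ultimately show ?thesis
      using True bridge_deg[OF assms(1,3) sub(2)] by simp
  next
    case False
    have "deg A v \<le> card (M v)" using assms(4) sub(1) that by blast
    then show ?thesis using False bridge_deg[OF assms(1,3) that] by simp
  qed
  moreover have "\<not> colorable P ?M"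
  proof
    assume "colorable P ?M"
    then obtain \<phi> where \<phi>: "col P ?M \<phi>" unfolding colorable_def by blast
    have n: "nbs (A - P) v \<subseteq> (if v = p then {q} else {})" if "v \<in> P" for v
      using assms(3) that unfolding bridge_def nbs_def by auto
    have "?M v \<subseteq> M v - \<psi> ` nbs (A - P) v" if "v \<in> P" for v
      using n[OF that] by (cases "v = p") auto
    then have "col P (\<lambda>v. M v - \<psi> ` nbs (A - P) v) \<phi>"
      using \<phi> unfolding col_def by blast
    from col_combine[OF \<psi> this] have "colorable ((A - P) \<union> P) M"
      unfolding colorable_def by blast
    then show False using assms(5) sub by (simp add: Un_absorb2)
  qed
  ultimately show ?thesis by (rule that)
qed

text \<open>Removing a vertex of a bridgeless connected subcubic set leaves it connected, since one of
  the two sides would be attached to the vertex by a single edge.\<close>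

lemma bridgeless_remove_conn:
  assumes "finite A" "conn A" "\<And>P p q. \<not> bridge A P p q" "u \<in> A" "deg A u \<le> 3"
  shows "conn (A - {u})"
  unfolding conn_def
proof (intro allI impI)
  fix P assume P: "P \<subseteq> A - {u}" "P \<noteq> {}" "P \<noteq> A - {u}"
  let ?Q = "A - {u} - P"
  show "\<exists>p\<in>P. \<exists>q\<in>?Q. adj p q"
  proof (rule ccontr)
    assume no: "\<not> ?thesis"
    have two: "2 \<le> deg P u" if P: "P \<subseteq> A - {u}" "P \<noteq> {}" "\<not> (\<exists>p\<in>P. \<exists>q\<in>A - {u} - P. adj p q)" for P
    proof (rule ccontr)
      assume "\<not> 2 \<le> deg P u"
      then have le: "card (nbs P u) \<le> Suc 0" unfolding deg_def by simp
      have fin: "finite (nbs P u)" using P(1) assms(1) by (simp add: finite_nbs finite_subset)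
      have "P \<subseteq> A" "P \<noteq> A" using P(1) assms(4) by auto
      then obtain p q where pq: "p \<in> P" "q \<in> A - P" "adj p q"
        using connD[OF assms(2) _ P(2)] by metis
      have qu: "q' = u" if "p' \<in> P" "q' \<in> A - P" "adj p' q'" for p' q' using P(3) that by blast
      have "bridge A P p u"
        unfolding bridge_def
      proof (intro conjI ballI impI)
        show "P \<subseteq> A" "p \<in> P" "u \<in> A - P" "adj p u"
          using P(1) pq qu[OF pq] assms(4) by auto
        fix p' q' assume h: "p' \<in> P" "q' \<in> A - P" "adj p' q'"
        show "q' = u" using qu h by blast
        have "p \<in> nbs P u" "p' \<in> nbs P u"
          using pq qu h sym unfolding nbs_def by blast+
        then show "p' = p" using le fin by (meson card_le_Suc0_iff_eq)
      qed
      then show False using assms(3) by blast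
    qed
    have "2 \<le> deg P u" using two[OF P(1,2)] no by blast
    moreover have "2 \<le> deg ?Q u"
    proof (rule two)
      show "?Q \<subseteq> A - {u}" by blast
      show "?Q \<noteq> {}" using P by blast
      show "\<not> (\<exists>p\<in>?Q. \<exists>q\<in>A - {u} - ?Q. adj p q)" using no P(1) sym by blast
    qed
    moreover have "deg P u + deg ?Q u \<le> deg A u"
      using deg_diff[of "A - {u}" P u] deg_mono[OF assms(1) Diff_subset, of "{u}" u] assms(1) P(1)
      by simp
    ultimately show False using assms(5) by linarith
  qed
qed

text \<open>If \<open>u\<close> received a colour missing from \<open>M v\<close>, then
  \<open>v\<close> would keep its whole list but lose a neighbour. Since \<open>A - {u}\<close> is
  still connected, this surplus would make it colourable, and with it \<open>A\<close>.\<close>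

lemma bridgeless_tight:
  assumes "finite A" "conn A" "\<And>P p q. \<not> bridge A P p q" "\<And>v. v \<in> A \<Longrightarrow> deg A v \<le> 3"
    and "\<And>v. v \<in> A \<Longrightarrow> deg A v \<le> card (M v)" "\<not> colorable A M"
    and "u \<in> A" "v \<in> A" "adj u v"
  shows "M u \<subseteq> M v"
proof
  fix c assume c: "c \<in> M u"
  let ?B = "A - {u}"
  let ?M = "\<lambda>x. M x - (\<lambda>_. c) ` nbs {u} x"
  have du: "deg A x = deg ?B x + deg {u} x" for x
    using deg_diff[of A ?B x] assms(1,7) by (simp add: double_diff)
  have cu: "col {u} M (\<lambda>_. c)" using c by (simp add: col_def irrefl)
  have nc: "\<not> colorable ?B ?M"
  proof
    assume "colorable ?B ?M"
    from colorable_combine[OF cu this] have "colorable ({u} \<union> ?B) M" unfolding colorable_def by blast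
    then show False using assms(6,7) by (simp add: insert_absorb)
  qed
  have ge: "deg ?B x \<le> card (?M x)" if "x \<in> ?B" for x
  proof -
    have "deg A x \<le> card (M x)" using assms(5) that by blast
    then show ?thesis
      using card_diff_image_nbs[of "{u}" M x "\<lambda>_. c"] du[of x] by simp
  qed
  have "v \<noteq> u" using assms(9) irrefl by auto
  show "c \<in> M v"
  proof (rule ccontr)
    assume "c \<notin> M v"
    then have "?M v = M v" by blast
    moreover have "deg {u} v = 1" using sym[OF assms(9)] by (simp add: deg_singleton)
    ultimately have "deg ?B v < card (?M v)" using assms(5)[OF assms(8)] du[of v] by simp
    moreover have "conn ?B"
      using bridgeless_remove_conn[OF assms(1-3,7) assms(4)[OF assms(7)]] .
    ultimately have "colorable ?B ?M"
      using assms(1,8) \<open>v \<noteq> u\<close> by (intro colorable_surplus[of ?B ?M v] ge) simp_all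
    then show False using nc by blast
  qed
qed

text \<open>The bound is attained by trees of triangles; only the cases of a bridge and of a regular
  bridgeless set are needed, not the full structure of Gallai trees.\<close>

lemma gallai_bound:
  assumes "finite A" "conn A" "\<And>v. v \<in> A \<Longrightarrow> deg A v \<le> 3"
    and "\<And>v. v \<in> A \<Longrightarrow> deg A v \<le> card (M v)" "\<not> colorable A M" "x \<in> A" "deg A x < 3"
  shows "int (card A) + 6 \<le> 3 * defect A"
  using assms
proof (induction A arbitrary: M x rule: finite_psubset_induct)
  case (psubset A)
  show ?case
  proof (cases "\<exists>P p q. bridge A P p q")
    case True
    then obtain P p q where b: "bridge A P p q" by blast
    have side: "int (card P) + 6 \<le> 3 * defect P" if b: "bridge A P p q" for P p q
    proof -
      have sub: "P \<subset> A" "p \<in> P" using b unfolding bridge_def by auto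
      have d: "deg P v \<le> deg A v" for v using deg_mono psubset.hyps sub by blast
      obtain M' where M': "\<And>v. v \<in> P \<Longrightarrow> deg P v \<le> card (M' v)" "\<not> colorable P M'"
        using bridge_side_uncolorable[OF psubset.hyps psubset.prems(1) b psubset.prems(3,4)] by blast
      show ?thesis
      proof (rule psubset.IH[OF sub(1) bridge_conn[OF psubset.prems(1) b] _ M' sub(2)])
        show "deg P v \<le> 3" if "v \<in> P" for v
          using order_trans[OF d psubset.prems(2)] sub that by blast
        have "deg A p \<le> 3" using psubset.prems(2) sub by blast
        then show "deg P p < 3"
          using bridge_deg[OF psubset.hyps b sub(2)] by simp
      qed
    qed
    have "card A = card P + card (A - P)"
      using b psubset.hyps unfolding bridge_def
      by (metis Diff_disjoint Diff_partition card_Un_disjoint finite_Diff finite_subset)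
    \<comment> \<open>The bound reproduces itself exactly: 6 + 6 - 3 * 2 = 6.\<close>
    then show ?thesis
      using side[OF b] side[OF bridge_sym[OF b]] bridge_defect[OF psubset.hyps b] by simp
  next
    case False
    then have nb: "\<And>P p q. \<not> bridge A P p q" by blast
    have tight: "card (M v) = deg A v" if "v \<in> A" for v
    proof (rule ccontr)
      assume "card (M v) \<noteq> deg A v"
      then have "deg A v < card (M v)" using psubset.prems(3)[OF that] by simp
      then show False
        using colorable_surplus[OF psubset.hyps psubset.prems(1,3) that] psubset.prems(4) by blast
    qed
    have step: "M u = M v" if "u \<in> A" "v \<in> A" "adj u v" for u v
      using bridgeless_tight[OF psubset.hyps psubset.prems(1) nb psubset.prems(2-4)] that sym by blast
    \<comment> \<open>The vertices with the list of \<open>x\<close> are closed under adjacency, so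
      all lists agree. As list sizes equal degrees, \<open>A\<close> is regular.\<close>
    have eq: "{v \<in> A. M v = M x} = A"
    proof (rule ccontr)
      assume ne: "{v \<in> A. M v = M x} \<noteq> A"
      have "{v \<in> A. M v = M x} \<subseteq> A" "{v \<in> A. M v = M x} \<noteq> {}" using psubset.prems(5) by auto
      then obtain p q where "p \<in> {v \<in> A. M v = M x}" "q \<in> A - {v \<in> A. M v = M x}" "adj p q"
        by (rule connD[OF psubset.prems(1) _ _ ne])
      then show False using step[of p q] by auto
    qed
    have reg: "deg A v = deg A x" if "v \<in> A" for v
      using tight[OF that] tight[OF psubset.prems(5)] eq that by (metis (mono_tags, lifting) mem_Collect_eq)
    have def: "defect A = int (card A) * (3 - int (deg A x))"
      unfolding defect_def using reg by simp
    \<comment> \<open>A single vertex has defect 3, and 1 + 6 \<le> 9. Otherwise there are n \<ge> 3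
      vertices, because two adjacent vertices alone would form a bridge, and each has defect at
      least one; then n + 6 \<le> 3 * n.\<close>
    show ?thesis
    proof (cases "A = {x}")
      case True
      then show ?thesis using def by (simp add: deg_singleton irrefl)
    next
      case ne: False
      obtain q where q: "q \<in> A - {x}" "adj x q"
        using connD[OF psubset.prems(1), of "{x}"] psubset.prems(5) ne
        by (metis empty_not_insert empty_subsetI insert_subset singletonD)
      have "\<not> bridge A {x} x q" using nb by blast
      then obtain q' where "q' \<in> A - {x}" "q' \<noteq> q"
        using q psubset.prems(5) unfolding bridge_def by blast
      then have "card {x, q, q'} \<le> card A" "card {x, q, q'} = 3"
        using q psubset.prems(5) psubset.hyps by (auto intro: card_mono)
      then have c: "3 \<le> int (card A)" by linarith
      have "int (card A) * 1 \<le> int (card A) * (3 - int (deg A x))"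
        using psubset.prems(6) by (intro mult_left_mono) auto
      then show ?thesis using c def by linarith
    qed
  qed
qed

text \<open>2-choosability of the 4-cycle: the colours \<open>s\<close> and \<open>t\<close> of
  \<open>a\<close> and \<open>c\<close> are chosen so that neither \<open>b\<close> nor
  \<open>d\<close> has exactly the list \<open>{s, t}\<close>; then both have a colour left.\<close>

lemma colorable_four_cycle:
  assumes X: "X = {a, b, c, d}" "distinct [a, b, c, d]"
    and e: "\<not> adj a c" "\<not> adj b d"
    and M: "\<And>v. v \<in> X \<Longrightarrow> 2 \<le> card (M v)"
  shows "colorable X M"
proof -
  have pick: "\<exists>z. z \<in> M v \<and> z \<noteq> s \<and> z \<noteq> t" if "v \<in> X" "M v \<noteq> {s, t}" for v s t
  proof (rule ccontr)
    assume "\<not> ?thesis"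
    then have sub: "M v \<subseteq> {s, t}" by blast
    moreover have "card {s, t} \<le> card (M v)"
      using M[OF that(1)] card_insert_le_m1[of 2 "{t}" s] by simp
    ultimately have "M v = {s, t}" by (intro card_seteq) auto
    then show False using that by blast
  qed
  have mem: "a \<in> X" "b \<in> X" "c \<in> X" "d \<in> X" using X by auto
  have two: "\<exists>s t. s \<in> M v \<and> t \<in> M v \<and> s \<noteq> t" if "v \<in> X" for v
    using M[OF that] by (metis card_2_iff' obtain_subset_with_card_n subsetD)
  obtain s t where st: "s \<in> M a" "t \<in> M c" "M b \<noteq> {s, t}" "M d \<noteq> {s, t}"
  proof -
    obtain s1 s2 t1 t2 where h: "s1 \<in> M a" "s2 \<in> M a" "s1 \<noteq> s2" "t1 \<in> M c" "t2 \<in> M c" "t1 \<noteq> t2"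
      using two[OF mem(1)] two[OF mem(3)] by blast
    show ?thesis
    proof (cases "M a \<inter> M c = {}")
      case True
      \<comment> \<open>Of three different pairs at most two are the lists of \<open>b\<close> and
        \<open>d\<close>.\<close>
      have "{s1, t1} \<noteq> {s1, t2}" "{s1, t1} \<noteq> {s2, t1}" "{s1, t2} \<noteq> {s2, t1}"
        using h True by (auto simp: doubleton_eq_iff)
      then show ?thesis using that h by metis
    next
      case False
      then obtain r where r: "r \<in> M a" "r \<in> M c" by blast
      have "M b \<noteq> {r, r}" "M d \<noteq> {r, r}" using M mem by force+
      then show ?thesis using that r by blast
    qed
  qed
  obtain zb zd where z: "zb \<in> M b" "zb \<noteq> s" "zb \<noteq> t" "zd \<in> M d" "zd \<noteq> s" "zd \<noteq> t"
    using pick[OF mem(2) st(3)] pick[OF mem(4) st(4)] by blast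
  have e': "\<not> adj c a" "\<not> adj d b" using e sym by blast+
  have "col X M (\<lambda>v. if v = a then s else if v = b then zb else if v = c then t else zd)"
    using X z st e e' irrefl unfolding col_def by auto
  then show ?thesis unfolding colorable_def by blast
qed

section \<open>Balls and sparse sets\<close>

text \<open>For \<open>s\<close> in \<open>B\<close>, the ball of radius \<open>n\<close> about
  \<open>s\<close> in the graph induced on \<open>B\<close>.\<close>

primrec reach :: "'a set \<Rightarrow> 'a \<Rightarrow> nat \<Rightarrow> 'a set" where
  "reach B s 0 = {s}"
| "reach B s (Suc n) = reach B s n \<union> {u \<in> B. \<exists>p\<in>reach B s n. adj p u}"

lemma reach_mono: "m \<le> n \<Longrightarrow> reach B s m \<subseteq> reach B s n"
  by (rule lift_Suc_mono_le[of "reach B s"]) auto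

lemma reach_subset: "s \<in> B \<Longrightarrow> reach B s n \<subseteq> B"
  by (induction n) auto

lemma reach_step: "p \<in> reach B s n \<Longrightarrow> u \<in> B \<Longrightarrow> adj p u \<Longrightarrow> u \<in> reach B s (Suc n)"
  by auto

lemma reach_trans: "x \<in> reach B s m \<Longrightarrow> z \<in> reach B x n \<Longrightarrow> z \<in> reach B s (m + n)"
  by (induction n arbitrary: z) auto

lemma reach_sym: "s \<in> B \<Longrightarrow> x \<in> reach B s n \<Longrightarrow> s \<in> reach B x n"
proof (induction n arbitrary: x)
  case 0
  then show ?case by simp
next
  case (Suc n)
  show ?case
  proof (cases "x \<in> reach B s n")
    case True
    then show ?thesis using Suc.IH[OF Suc.prems(1)] reach_mono[of n "Suc n"] by auto
  next
    case False
    then obtain p where p: "p \<in> reach B s n" "adj p x" "x \<in> B" using Suc.prems(2) by auto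
    then have "p \<in> B" using reach_subset[OF Suc.prems(1)] by blast
    then have "p \<in> reach B x 1" using p(2) sym by auto
    from reach_trans[OF this Suc.IH[OF Suc.prems(1) p(1)]] show ?thesis by simp
  qed
qed

text \<open>The first sphere has at most 3 vertices, and each later one at most doubles, because
  every vertex of a sphere has one of its at most three neighbours in the ball before. Summing up
  gives 1 + 3 * (2 ^ n - 1).\<close>

lemma card_reach:
  assumes "finite B" "s \<in> B" "\<And>v. v \<in> B \<Longrightarrow> deg B v \<le> 3"
  shows "card (reach B s n) + 2 \<le> 3 * 2 ^ n"
proof -
  have fin: "finite (reach B s n)" for n
    using reach_subset[OF assms(2)] assms(1) finite_subset by blast
  have level: "card (reach B s (Suc n) - reach B s n) \<le> 3 * 2 ^ n" for n
  proof (induction n)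
    case 0
    have "reach B s (Suc 0) - reach B s 0 \<subseteq> nbs B s" by (auto simp: nbs_def)
    then have "card (reach B s (Suc 0) - reach B s 0) \<le> deg B s"
      unfolding deg_def by (intro card_mono finite_nbs assms(1))
    then show ?case using assms(3)[OF assms(2)] by simp
  next
    case (Suc n)
    let ?l = "reach B s (Suc n) - reach B s n"
    have "reach B s (Suc (Suc n)) - reach B s (Suc n) \<subseteq> (\<Union>p\<in>?l. nbs B p - reach B s (Suc n))"
    proof
      fix x assume x: "x \<in> reach B s (Suc (Suc n)) - reach B s (Suc n)"
      then obtain p where p: "p \<in> reach B s (Suc n)" "adj p x" "x \<in> B" by auto
      have "p \<notin> reach B s n" using reach_step[of p B s n x] p x by blast
      then show "x \<in> (\<Union>p\<in>?l. nbs B p - reach B s (Suc n))"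
        using p x unfolding nbs_def by blast
    qed
    then have "card (reach B s (Suc (Suc n)) - reach B s (Suc n))
        \<le> card (\<Union>p\<in>?l. nbs B p - reach B s (Suc n))"
      using fin assms(1) by (intro card_mono) (simp_all add: finite_nbs del: reach.simps)
    also have "\<dots> \<le> (\<Sum>p\<in>?l. card (nbs B p - reach B s (Suc n)))"
      using fin by (intro card_UN_le) blast
    also have "\<dots> \<le> (\<Sum>p\<in>?l. 2)"
    proof (rule sum_mono)
      fix p assume p: "p \<in> ?l"
      then have pB: "p \<in> B" using reach_subset[OF assms(2)] by blast
      obtain r where r: "r \<in> reach B s n" "adj r p" using p by auto
      have "r \<in> B" using r reach_subset[OF assms(2)] by blast
      then have rn: "r \<in> nbs B p" using r sym unfolding nbs_def by blast
      have "card (nbs B p - reach B s (Suc n)) \<le> card (nbs B p - {r})"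
        using r(1) assms(1) by (intro card_mono) (auto simp: finite_nbs)
      also have "\<dots> = deg B p - 1" using rn assms(1) by (simp add: deg_def finite_nbs)
      finally show "card (nbs B p - reach B s (Suc n)) \<le> 2" using assms(3)[OF pB] by linarith
    qed
    also have "\<dots> = card ?l * 2" by simp
    finally show ?case using Suc.IH by simp
  qed
  show ?thesis
  proof (induction n)
    case 0
    then show ?case by simp
  next
    case (Suc n)
    have "card (reach B s (Suc n)) = card (reach B s n) + card (reach B s (Suc n) - reach B s n)"
      using fin reach_mono[of n "Suc n" B s] by (metis card_Diff_subset card_mono le_add_diff_inverse le_SucI le_refl)
    then show ?case using Suc.IH level[of n] by simp
  qed
qed

end

text \<open>Greedy choice: a heaviest \<open>v\<close> outweighs each of the at most
  \<open>k\<close> elements related to it, itself included, and these are discarded. Symmetry is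
  asked only for \<open>u\<close> in \<open>X\<close> because \<open>reach_sym\<close> starts from
  points of \<open>B\<close>.\<close>

lemma weighted_independent_set:
  fixes W :: "'a \<Rightarrow> real"
  assumes "finite X" "\<And>v. v \<in> X \<Longrightarrow> 0 \<le> W v" "\<And>v. R v v" "\<And>u v. u \<in> X \<Longrightarrow> R u v \<Longrightarrow> R v u"
    and "\<And>v. v \<in> X \<Longrightarrow> card {u \<in> X. R v u} \<le> k"
  shows "\<exists>S\<subseteq>X. (\<forall>s\<in>S. \<forall>t\<in>S. s \<noteq> t \<longrightarrow> \<not> R s t) \<and> sum W X \<le> real k * sum W S"
  using assms
proof (induction X rule: finite_psubset_induct)
  case (psubset X)
  show ?case
  proof (cases "X = {}")
    case False
    have "Max (W ` X) \<in> W ` X" using psubset.hyps False by simp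
    then obtain v where v: "v \<in> X" "W v = Max (W ` X)" by auto
    have mx: "W u \<le> W v" if "u \<in> X" for u using v(2) psubset.hyps that by simp
    let ?N = "{u \<in> X. R v u}"
    have sub: "X - ?N \<subset> X" using v(1) psubset.prems(2) by blast
    have "\<exists>S\<subseteq>X - ?N. (\<forall>s\<in>S. \<forall>t\<in>S. s \<noteq> t \<longrightarrow> \<not> R s t) \<and> sum W (X - ?N) \<le> real k * sum W S"
    proof (rule psubset.IH[OF sub _ psubset.prems(2)])
      show "0 \<le> W u" if "u \<in> X - ?N" for u using psubset.prems(1) that by blast
      show "R t u" if "u \<in> X - ?N" "R u t" for u t using psubset.prems(3) that by blast
      show "card {t \<in> X - ?N. R u t} \<le> k" if "u \<in> X - ?N" for u
      proof -
        have "card {t \<in> X - ?N. R u t} \<le> card {t \<in> X. R u t}"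
          using psubset.hyps by (intro card_mono) auto
        then show ?thesis using psubset.prems(4)[of u] that by simp
      qed
    qed
    then obtain S where S: "S \<subseteq> X - ?N" "\<forall>s\<in>S. \<forall>t\<in>S. s \<noteq> t \<longrightarrow> \<not> R s t"
      "sum W (X - ?N) \<le> real k * sum W S" by blast
    have fS: "finite S" using S(1) psubset.hyps finite_subset by blast
    have "\<not> R v s" "\<not> R s v" if "s \<in> S" for s using S(1) that psubset.prems(3) by blast+
    then have ind: "\<forall>s\<in>insert v S. \<forall>t\<in>insert v S. s \<noteq> t \<longrightarrow> \<not> R s t" using S(2) by blast
    have "sum W X = sum W (X - ?N) + sum W ?N"
      using psubset.hyps by (intro sum.subset_diff) auto
    also have "sum W ?N \<le> (\<Sum>u\<in>?N. W v)" using mx by (intro sum_mono) blast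
    also have "\<dots> = real (card ?N) * W v" by simp
    also have "\<dots> \<le> real k * W v"
      using psubset.prems(1)[OF v(1)] psubset.prems(4)[OF v(1)] by (intro mult_right_mono) auto
    finally have "sum W X \<le> real k * (W v + sum W S)" using S(3) by (simp add: distrib_left)
    moreover have "v \<notin> S" using S(1) v(1) psubset.prems(2) by blast
    ultimately have "sum W X \<le> real k * sum W (insert v S)" using fS by simp
    then show ?thesis using ind S(1) v(1) by (intro exI[of _ "insert v S"]) blast
  qed simp
qed

text \<open>A connected subcubic set \<open>B\<close> attached to the rest of the graph by at most \<open>q\<close> edges, all at \<open>y\<close>,
  with a vertex \<open>w\<close> of total degree at most two. The colours outside forbid the set \<open>\<Gamma>\<close> at \<open>y\<close>.\<close>

locale body = ugraph adj for adj :: "'a \<Rightarrow> 'a \<Rightarrow> bool" +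
  fixes B :: "'a set" and y w :: 'a and q :: nat and L :: "'a \<Rightarrow> nat set"
  assumes finB: "finite B" and connB: "conn B" and yB: "y \<in> B" and q: "q \<le> 1"
    and degB: "v \<in> B \<Longrightarrow> deg B v + (if v = y then q else 0) \<le> 3"
    and wB: "w \<in> B" and degw: "deg B w + (if w = y then q else 0) \<le> 2"
    and cardL: "v \<in> B \<Longrightarrow> card (L v) = 3"
begin

section \<open>Uncolourable components left by precoloured vertices and forbidden colours\<close>

definition LG :: "nat set \<Rightarrow> 'a \<Rightarrow> nat set" where
  "LG \<Gamma> v = L v - (if v = y then \<Gamma> else {})"

definition feas :: "nat set \<Rightarrow> 'a \<Rightarrow> nat set" where
  "feas \<Gamma> v = {\<psi> v | \<psi>. col B (LG \<Gamma>) \<psi>}"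

text \<open>\<open>A\<close> is an uncolourable component of \<open>B - S\<close> after \<open>S\<close> has been coloured by \<open>\<sigma>\<close>.\<close>

definition blocked :: "nat set \<Rightarrow> 'a set \<Rightarrow> ('a \<Rightarrow> nat) \<Rightarrow> 'a set \<Rightarrow> bool" where
  "blocked \<Gamma> S \<sigma> A \<longleftrightarrow> S \<subseteq> B \<and> A \<subseteq> B - S \<and> A \<noteq> {} \<and> conn A \<and> (\<forall>p\<in>A. nbs (B - S) p \<subseteq> A) \<and>
     \<not> colorable A (\<lambda>v. LG \<Gamma> v - \<sigma> ` nbs S v)"

text \<open>In degree counts a colour forbidden at \<open>y\<close> acts like an edge to a
  precoloured vertex.\<close>

definition gam :: "nat set \<Rightarrow> 'a \<Rightarrow> nat" where
  "gam \<Gamma> v = (if v = y then card \<Gamma> else 0)"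

lemma deg_le_3: "v \<in> B \<Longrightarrow> deg B v \<le> 3"
  using degB[of v] by simp

lemma blocked_exists:
  assumes "S \<subseteq> B" "col S (LG \<Gamma>) \<sigma>" "\<not> (\<exists>\<psi>. col B (LG \<Gamma>) \<psi> \<and> (\<forall>s\<in>S. \<psi> s = \<sigma> s))"
  obtains A where "blocked \<Gamma> S \<sigma> A"
proof -
  let ?M = "\<lambda>v. LG \<Gamma> v - \<sigma> ` nbs S v"
  have "\<not> colorable (B - S) ?M"
  proof
    assume "colorable (B - S) ?M"
    from colorable_combine[OF assms(2) this]
    obtain \<psi> where "col (S \<union> (B - S)) (LG \<Gamma>) \<psi>" "\<forall>v\<in>S. \<psi> v = \<sigma> v" by blast
    moreover have "S \<union> (B - S) = B" using assms(1) by blast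
    ultimately show False using assms(3) by metis
  qed
  from uncolorable_component[OF _ this] show ?thesis
    using that finB assms(1) unfolding blocked_def by blast
qed

context
  fixes \<Gamma> S \<sigma> A
  assumes G: "finite \<Gamma>" "card \<Gamma> \<le> q" and bl: "blocked \<Gamma> S \<sigma> A"
begin

lemma blocked_subset: "S \<subseteq> B" "A \<subseteq> B" "A \<inter> S = {}" "A \<noteq> {}" "conn A" "finite A" "finite S"
  using bl finB finite_subset unfolding blocked_def by blast+

lemma blocked_nbr: "p \<in> A \<Longrightarrow> u \<in> B \<Longrightarrow> adj p u \<Longrightarrow> u \<in> A \<or> u \<in> S"
  using bl unfolding blocked_def nbs_def by blast

lemma blocked_uncolorable: "\<not> colorable A (\<lambda>v. LG \<Gamma> v - \<sigma> ` nbs S v)"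
  using bl unfolding blocked_def by blast

lemma blocked_degB:
  assumes "v \<in> A" shows "deg B v = deg A v + deg S v"
proof -
  have "nbs B v = nbs A v \<union> nbs S v"
    using blocked_nbr[OF assms] blocked_subset unfolding nbs_def by blast
  moreover have "nbs A v \<inter> nbs S v = {}" using blocked_subset(3) unfolding nbs_def by blast
  ultimately show ?thesis
    unfolding deg_def using blocked_subset by (simp add: card_Un_disjoint finite_nbs)
qed

lemma blocked_lists_ge:
  assumes "v \<in> A"
  shows "3 - gam \<Gamma> v \<le> card (LG \<Gamma> v - \<sigma> ` nbs S v) + deg S v" "deg B v + gam \<Gamma> v \<le> 3"
    "deg A v \<le> card (LG \<Gamma> v - \<sigma> ` nbs S v)"
proof -
  have vB: "v \<in> B" using assms blocked_subset by blast
  have "card (L v) - card (if v = y then \<Gamma> else {}) \<le> card (LG \<Gamma> v)"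
    unfolding LG_def using G(1) by (intro diff_card_le_card_Diff) auto
  then have "3 - gam \<Gamma> v \<le> card (LG \<Gamma> v)"
    using cardL[OF vB] unfolding gam_def by (simp split: if_splits)
  then show 1: "3 - gam \<Gamma> v \<le> card (LG \<Gamma> v - \<sigma> ` nbs S v) + deg S v"
    using card_diff_image_nbs[OF blocked_subset(7), of "LG \<Gamma>" v \<sigma>] by linarith
  show 2: "deg B v + gam \<Gamma> v \<le> 3"
    using degB[OF vB] G(2) unfolding gam_def by (simp split: if_splits)
  show "deg A v \<le> card (LG \<Gamma> v - \<sigma> ` nbs S v)"
    using 1 2 blocked_degB[OF assms] by linarith
qed

text \<open>A surplus at one vertex would make \<open>A\<close> colourable by
  \<open>colorable_surplus\<close>. Equality of list size and degree then forces \<open>v\<close> to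
  have all three possible edges, forbidden colours being counted as edges.\<close>

lemma blocked_tight:
  assumes "v \<in> A"
  shows "card (LG \<Gamma> v - \<sigma> ` nbs S v) = deg A v" "deg A v + deg S v + gam \<Gamma> v = 3"
proof -
  show 1: "card (LG \<Gamma> v - \<sigma> ` nbs S v) = deg A v"
  proof (rule ccontr)
    assume "\<not> ?thesis"
    then have "deg A v < card (LG \<Gamma> v - \<sigma> ` nbs S v)" using blocked_lists_ge(3)[OF assms] by linarith
    then show False
      using colorable_surplus[OF blocked_subset(6,5) blocked_lists_ge(3) assms] blocked_uncolorable by blast
  qed
  show "deg A v + deg S v + gam \<Gamma> v = 3"
    using 1 blocked_lists_ge(1,2)[OF assms] blocked_degB[OF assms] by linarith
qed

text \<open>The low total degree of \<open>w\<close> contradicts the equality of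
  \<open>blocked_tight\<close>. In particular a blocked \<open>A\<close> is never the whole of
  \<open>B\<close>.\<close>

lemma blocked_w: "w \<notin> A"
proof
  assume "w \<in> A"
  from blocked_tight(2)[OF this] blocked_degB[OF this] degw G(2) show False
    unfolding gam_def by (simp split: if_splits)
qed

lemma blocked_touches: "\<exists>v\<in>A. deg S v > 0"
proof -
  have "A \<noteq> B" using blocked_w wB by blast
  then obtain p u where pu: "p \<in> A" "u \<in> B - A" "adj p u"
    using connD[OF connB blocked_subset(2,4)] by metis
  then have "u \<in> nbs S p" using blocked_nbr[of p u] unfolding nbs_def by blast
  then have "deg S p > 0" unfolding deg_def using blocked_subset(7) finite_nbs card_gt_0_iff by blast
  then show ?thesis using pu(1) by blast
qed

text \<open>By \<open>blocked_tight\<close> every edge end missing in \<open>A\<close> is an edge to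
  \<open>S\<close> or a forbidden colour at \<open>y\<close>, so the right-hand side is three times
  the defect. The vertex of degree below three that \<open>gallai_bound\<close> asks for is one with
  a neighbour in \<open>S\<close>.\<close>

lemma blocked_bound: "card A + 6 \<le> 3 * ((\<Sum>v\<in>A. deg S v) + (if y \<in> A then card \<Gamma> else 0))"
proof -
  obtain x where x: "x \<in> A" "deg S x > 0" using blocked_touches by blast
  have b: "int (card A) + 6 \<le> 3 * defect A"
  proof (rule gallai_bound[OF blocked_subset(6,5) _ blocked_lists_ge(3) blocked_uncolorable x(1)])
    show "deg A v \<le> 3" if "v \<in> A" for v using blocked_tight(2)[OF that] by linarith
    show "deg A x < 3" using blocked_tight(2)[OF x(1)] x(2) by linarith
  qed
  have "defect A = (\<Sum>v\<in>A. int (deg S v + gam \<Gamma> v))"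
    unfolding defect_def
  proof (rule sum.cong[OF refl])
    fix v assume "v \<in> A"
    from blocked_tight(2)[OF this] show "3 - int (deg A v) = int (deg S v + gam \<Gamma> v)" by linarith
  qed
  also have "\<dots> = int ((\<Sum>v\<in>A. deg S v) + (\<Sum>v\<in>A. gam \<Gamma> v))"
    by (simp add: sum.distrib)
  also have "(\<Sum>v\<in>A. gam \<Gamma> v) = (if y \<in> A then card \<Gamma> else 0)"
    unfolding gam_def using blocked_subset(6) by simp
  finally have "int (card A + 6) \<le> int (3 * ((\<Sum>v\<in>A. deg S v) + (if y \<in> A then card \<Gamma> else 0)))"
    using b by simp
  then show ?thesis by (simp only: of_nat_le_iff)
qed

lemma blocked_double_count: "(\<Sum>v\<in>A. deg S v) = (\<Sum>s\<in>S. deg A s)"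
proof -
  have d: "deg X v = (\<Sum>u\<in>X. if adj v u then 1 else 0)" if "finite X" for X v
    using that by (simp add: deg_def nbs_def sum.If_cases Int_def)
  have "(\<Sum>v\<in>A. deg S v) = (\<Sum>v\<in>A. \<Sum>s\<in>S. if adj v s then 1 else 0)"
    using d[OF blocked_subset(7)] by simp
  also have "\<dots> = (\<Sum>s\<in>S. \<Sum>v\<in>A. if adj v s then 1 else 0)" by (rule sum.swap)
  also have "\<dots> = (\<Sum>s\<in>S. \<Sum>v\<in>A. if adj s v then 1 else 0)"
    using sym by (intro sum.cong refl) meson
  also have "\<dots> = (\<Sum>s\<in>S. deg A s)" using d[OF blocked_subset(6)] by simp
  finally show ?thesis .
qed

text \<open>Otherwise \<open>A\<close> together with \<open>s\<close> has no edge leaving it and is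
  all of \<open>B\<close>. Then \<open>w\<close> can only be \<open>s\<close>, but \<open>s\<close>
  has degree three.\<close>

lemma blocked_not_all_nbrs:
  assumes "s \<in> S" "\<And>v. v \<in> A \<Longrightarrow> nbs S v \<subseteq> {s}"
  shows "deg A s < 3"
proof (rule ccontr)
  assume "\<not> deg A s < 3"
  then have d: "deg A s \<ge> 3" by simp
  have sB: "s \<in> B" using assms(1) blocked_subset by blast
  have n: "nbs A s = nbs B s"
  proof (rule card_seteq)
    show "finite (nbs B s)" by (simp add: finB finite_nbs)
    show "nbs A s \<subseteq> nbs B s" using blocked_subset(2) unfolding nbs_def by blast
    show "card (nbs B s) \<le> card (nbs A s)" using d deg_le_3[OF sB] unfolding deg_def by linarith
  qed
  have "insert s A = B"
  proof (rule ccontr)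
    assume ne: "insert s A \<noteq> B"
    have "insert s A \<subseteq> B" using sB blocked_subset(2) by blast
    then obtain p u where pu: "p \<in> insert s A" "u \<in> B - insert s A" "adj p u"
      using connD[OF connB _ _ ne] by (metis insert_not_empty)
    show False
    proof (cases "p = s")
      case True
      then show False using pu n unfolding nbs_def by blast
    next
      case False
      then show False using blocked_nbr[of p u] pu assms(2)[of p] unfolding nbs_def by blast
    qed
  qed
  then have "w = s" using blocked_w wB by blast
  then show False using degw d n unfolding deg_def by simp
qed

end

text \<open>At most two edges go from \<open>A\<close> to \<open>v\<close> and at most one colour is
  forbidden, while \<open>blocked_bound\<close> with a nonempty \<open>A\<close> requires these to
  number at least three. So both are attained, and the bound leaves at most three vertices.\<close>

lemma blocked_singleton_deg:
  assumes G: "finite \<Gamma>" "card \<Gamma> \<le> q" and bl: "blocked \<Gamma> {v} \<sigma> A"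
  shows "y \<in> A" "card \<Gamma> = 1" "deg A v = 2" "card A \<le> 3"
proof -
  have f: "finite A" "A \<noteq> {}" using blocked_subset[OF G bl] by auto
  have pos: "card A > 0" using f by (simp add: card_gt_0_iff)
  have "deg A v < 3"
    by (rule blocked_not_all_nbrs[OF G bl]) (auto simp: nbs_def)
  moreover have b: "card A + 6 \<le> 3 * (deg A v + (if y \<in> A then card \<Gamma> else 0))"
    using blocked_bound[OF G bl] blocked_double_count[OF G bl] by simp
  moreover have "card \<Gamma> \<le> 1" using G(2) q by linarith
  moreover from calculation pos show "y \<in> A" by (auto split: if_splits)
  ultimately show "card \<Gamma> = 1" "deg A v = 2" "card A \<le> 3" using pos by (simp_all split: if_splits)
qed

lemma infeasible_blocked:
  assumes "v \<in> B" "c \<in> LG \<Gamma> v" "c \<notin> feas \<Gamma> v"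
  obtains A where "blocked \<Gamma> {v} (\<lambda>_. c) A"
proof (rule blocked_exists)
  show "{v} \<subseteq> B" using assms(1) by blast
  show "col {v} (LG \<Gamma>) (\<lambda>_. c)" using assms(2) by (simp add: col_def irrefl)
  show "\<not> (\<exists>\<psi>. col B (LG \<Gamma>) \<psi> \<and> (\<forall>s\<in>{v}. \<psi> s = c))"
    using assms(3) unfolding feas_def by auto
qed

lemma feas_empty:
  assumes "v \<in> B" "c \<in> L v"
  shows "c \<in> feas {} v"
proof (rule ccontr)
  assume n: "c \<notin> feas {} v"
  have "c \<in> LG {} v" using assms(2) unfolding LG_def by simp
  from infeasible_blocked[OF assms(1) this n] obtain A where A: "blocked {} {v} (\<lambda>_. c) A" .
  have "card ({} :: nat set) \<le> q" by simp
  from blocked_singleton_deg(2)[OF _ this A] show False by simp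
qed

text \<open>The obstruction would contain \<open>y\<close>, which is itself the precoloured
  vertex.\<close>

lemma feas_y:
  assumes "finite \<Gamma>" "card \<Gamma> \<le> q" "c \<in> L y - \<Gamma>"
  shows "c \<in> feas \<Gamma> y"
proof (rule ccontr)
  assume n: "c \<notin> feas \<Gamma> y"
  have "c \<in> LG \<Gamma> y" using assms(3) unfolding LG_def by simp
  from infeasible_blocked[OF yB this n] obtain A where A: "blocked \<Gamma> {y} (\<lambda>_. c) A" .
  then show False using blocked_singleton_deg(1)[OF assms(1,2) A] unfolding blocked_def by blast
qed

text \<open>The obstruction is a triangle formed by \<open>y\<close> and two neighbours of \<open>v\<close>; its remaining lists are
  equal, so they determine the infeasible colour.\<close>

lemma infeasible_triangle:
  assumes G: "finite \<Gamma>" "card \<Gamma> \<le> q" and v: "v \<in> B" "v \<noteq> y" and c: "c \<in> L v" "c \<notin> feas \<Gamma> v"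
  shows "\<exists>b. b \<in> nbs B y" "\<And>b. b \<in> nbs B y \<Longrightarrow> c \<in> L b \<and> L b - {c} = L y - \<Gamma>"
proof -
  have "c \<in> LG \<Gamma> v" using c(1) v(2) unfolding LG_def by simp
  from infeasible_blocked[OF v(1) this c(2)] obtain A where A: "blocked \<Gamma> {v} (\<lambda>_. c) A" .
  note d = blocked_singleton_deg[OF G A]
  note sub = blocked_subset[OF G A]
  note tight = blocked_tight[OF G A]
  have degA: "deg A x \<le> card A - 1" if "x \<in> A" for x
  proof -
    have "nbs A x \<subseteq> A - {x}" using irrefl unfolding nbs_def by blast
    then have "card (nbs A x) \<le> card (A - {x})" using sub(6) by (intro card_mono) auto
    then show ?thesis using that sub(6) unfolding deg_def by simp
  qed
  have g: "gam \<Gamma> x = (if x = y then 1 else 0)" for x using d(2) unfolding gam_def by simp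
  \<comment> \<open>If \<open>y\<close> saw \<open>v\<close>, then so would every vertex of
    \<open>A\<close>: the others have at most two neighbours in \<open>A\<close> and need three in
    all. So \<open>A\<close> would have two vertices, and the one other than \<open>y\<close> would
    have only two edges.\<close>
  have ynv: "\<not> adj y v"
  proof
    assume yv: "adj y v"
    have all: "x \<in> nbs A v" if "x \<in> A" for x
    proof (cases "x = y")
      case True
      then show ?thesis using that yv sym unfolding nbs_def by blast
    next
      case False
      then have "gam \<Gamma> x = 0" using g[of x] by simp
      then have "deg {v} x > 0" using tight(2)[OF that] degA[OF that] d(4) by linarith
      then show ?thesis using that sym unfolding nbs_def by (auto simp: deg_singleton split: if_splits)
    qed
    then have "A = nbs A v" unfolding nbs_def by blast
    then have c2: "card A = 2" using d(3) unfolding deg_def by simp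
    then obtain x where x: "x \<in> A" "x \<noteq> y"
      using d(1) by (metis card_2_iff')
    have "deg A x \<le> 1" using degA[OF x(1)] c2 by simp
    moreover have "deg {v} x \<le> 1" by (simp add: deg_singleton)
    ultimately show False using tight(2)[OF x(1)] g[of x] x(2) by simp
  qed
  then have degy: "deg A y = 2" using tight(2)[OF d(1)] g[of y] by (simp add: deg_singleton)
  then have c3: "card A = 3" using degA[OF d(1)] d(4) by linarith
  have "nbs A v \<subseteq> A - {y}" using ynv sym unfolding nbs_def by blast
  moreover have "card (A - {y}) = 2" using c3 d(1) sub(6) by simp
  ultimately have nv: "nbs A v = A - {y}"
    using d(3) sub(6) unfolding deg_def by (intro card_seteq) auto
  have adjA: "deg A x = 2" if "x \<in> A" for x
  proof (cases "x = y")
    case False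
    then have "x \<in> nbs A v" using nv that by blast
    then have "adj x v" using sym unfolding nbs_def by blast
    then have "deg {v} x = 1" by (simp add: deg_singleton)
    then show ?thesis using tight(2)[OF that] g[of x] False by simp
  qed (simp add: degy)
  have complete: "adj x z" if "x \<in> A" "z \<in> A" "x \<noteq> z" for x z
  proof -
    have "nbs A x \<subseteq> A - {x}" using irrefl unfolding nbs_def by blast
    moreover have "card (A - {x}) = 2" using c3 that(1) sub(6) by simp
    ultimately have "nbs A x = A - {x}"
      using adjA[OF that(1)] sub(6) unfolding deg_def by (intro card_seteq) auto
    then show ?thesis using that unfolding nbs_def by blast
  qed
  have nb: "\<not> bridge A P p r" for P p r
  proof
    assume b: "bridge A P p r"
    then have pr: "p \<in> P" "r \<in> A - P" "P \<subseteq> A" unfolding bridge_def by auto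
    then have "p \<noteq> r" "{p, r} \<subseteq> A" by blast+
    then have "card (A - {p, r}) = 1" using c3 by (simp add: card_Diff_subset)
    then obtain z where z: "z \<in> A - {p, r}" by (metis card_eq_0_iff ex_in_conv zero_neq_one)
    show False
    proof (cases "z \<in> P")
      case True
      then show False using b z pr complete[of z r] unfolding bridge_def by blast
    next
      case False
      then show False using b z pr complete[of p z] unfolding bridge_def by blast
    qed
  qed
  have le3: "deg A x \<le> 3" if "x \<in> A" for x using adjA[OF that] by simp
  let ?M = "\<lambda>x. LG \<Gamma> x - (\<lambda>_. c) ` nbs {v} x"
  have eq: "?M b = ?M y" if "b \<in> A" "b \<noteq> y" for b
    using bridgeless_tight[OF sub(6,5) nb le3 blocked_lists_ge(3)[OF G A] blocked_uncolorable[OF G A] that(1) d(1) complete[OF that(1) d(1) that(2)]]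
      bridgeless_tight[OF sub(6,5) nb le3 blocked_lists_ge(3)[OF G A] blocked_uncolorable[OF G A] d(1) that(1) complete[OF d(1) that(1)]] that(2)
    by blast
  have "nbs {v} y = {}" using ynv unfolding nbs_def by blast
  then have My: "?M y = L y - \<Gamma>" unfolding LG_def by simp
  have fin: "finite (nbs B y)" by (simp add: finB finite_nbs)
  \<comment> \<open>The forbidden colour takes one of the three places at \<open>y\<close>, so the
    two triangle edges are all edges of \<open>y\<close> in \<open>B\<close>. Thus the conclusion
    speaks of the neighbours of \<open>y\<close> in \<open>B\<close>, which are the same for every
    infeasible colour, and not of \<open>A\<close>.\<close>
  have "deg B y \<le> 2" using degB[OF yB] d(2) G(2) by simp
  moreover have "nbs A y \<subseteq> nbs B y" using sub(2) unfolding nbs_def by blast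
  ultimately have nby: "nbs A y = nbs B y"
    using degy fin unfolding deg_def by (intro card_seteq) auto
  then show "\<exists>b. b \<in> nbs B y" using degy unfolding deg_def by (metis card.empty ex_in_conv zero_neq_numeral)
  fix b assume "b \<in> nbs B y"
  then have b: "b \<in> A" "b \<noteq> y" using nby irrefl unfolding nbs_def by blast+
  have "b \<in> nbs A v" using b nv by blast
  then have "nbs {v} b = {v}" using sym unfolding nbs_def by blast
  then have Mb: "?M b = L b - {c}" using b(2) unfolding LG_def by simp
  have "card (L b - {c}) = 2" using blocked_tight(1)[OF G A b(1)] adjA[OF b(1)] Mb by simp
  then have "c \<in> L b" using cardL[of b] b(1) sub(2) by (cases "c \<in> L b") auto
  then show "c \<in> L b \<and> L b - {c} = L y - \<Gamma>" using eq[OF b] Mb My by simp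
qed

lemma feas_subset: "v \<in> B \<Longrightarrow> feas \<Gamma> v \<subseteq> LG \<Gamma> v"
  unfolding feas_def col_def by blast

text \<open>At \<open>y\<close> at most one colour is forbidden and all others are feasible.
  Elsewhere an infeasible colour is the only element of \<open>L b - (L y - \<Gamma>)\<close> for a
  fixed neighbour \<open>b\<close> of \<open>y\<close>, so there is at most one.\<close>

lemma card_feas:
  assumes G: "finite \<Gamma>" "card \<Gamma> \<le> q" and v: "v \<in> B"
  shows "2 \<le> card (feas \<Gamma> v)" "card (feas \<Gamma> v) \<le> 3" "finite (feas \<Gamma> v)"
proof -
  have fL: "finite (L v)" using cardL[OF v] card_ge_0_finite[of "L v"] by simp
  have sub: "feas \<Gamma> v \<subseteq> L v" using feas_subset[OF v] unfolding LG_def by blast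
  show fin: "finite (feas \<Gamma> v)" using fL sub finite_subset by blast
  show "card (feas \<Gamma> v) \<le> 3" using card_mono[OF fL sub] cardL[OF v] by simp
  show "2 \<le> card (feas \<Gamma> v)"
  proof (cases "v = y")
    case True
    have "card (L y) - card \<Gamma> \<le> card (L y - \<Gamma>)" using G(1) by (rule diff_card_le_card_Diff)
    moreover have "card (L y - \<Gamma>) \<le> card (feas \<Gamma> y)"
      using feas_y[OF G] fin True by (intro card_mono) auto
    ultimately show ?thesis using cardL[OF v] G(2) q True by simp
  next
    case False
    have "card (L v - feas \<Gamma> v) \<le> Suc 0"
    proof (subst card_le_Suc0_iff_eq)
      show "finite (L v - feas \<Gamma> v)" using fL by simp
      show "\<forall>c\<in>L v - feas \<Gamma> v. \<forall>c'\<in>L v - feas \<Gamma> v. c = c'"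
      proof (intro ballI)
        fix c c' assume c: "c \<in> L v - feas \<Gamma> v" "c' \<in> L v - feas \<Gamma> v"
        obtain b where b: "b \<in> nbs B y" using infeasible_triangle(1)[OF G v False] c by blast
        have "c \<in> L b \<and> L b - {c} = L y - \<Gamma>" "c' \<in> L b \<and> L b - {c'} = L y - \<Gamma>"
          using infeasible_triangle(2)[OF G v False _ _ b] c by blast+
        then show "c = c'" by blast
      qed
    qed
    moreover have "card (L v) = card (feas \<Gamma> v) + card (L v - feas \<Gamma> v)"
      using sub fL fin by (metis card_Diff_subset card_mono le_add_diff_inverse)
    ultimately show ?thesis using cardL[OF v] by simp
  qed
qed

text \<open>Radius 10 is twice 5: balls of radius 5 around different points of a sparse set are
  disjoint.\<close>

definition sparse :: "'a set \<Rightarrow> bool" where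
  "sparse S \<longleftrightarrow> S \<subseteq> B \<and> (\<forall>s\<in>S. \<forall>t\<in>S. s \<noteq> t \<longrightarrow> t \<notin> reach B s 10)"

lemma sparseD:
  assumes "sparse S" "s \<in> S" "t \<in> S" "t \<in> reach B s n" "n \<le> 10"
  shows "t = s"
proof -
  have "t \<in> reach B s 10" using assms(4) reach_mono[OF assms(5)] by (rule rev_subsetD)
  then show ?thesis using assms(1-3) unfolding sparse_def by metis
qed

section \<open>Components touching two points of a sparse set\<close>

context
  fixes \<Gamma> S \<sigma> A
  assumes G: "finite \<Gamma>" "card \<Gamma> \<le> q" and bl: "blocked \<Gamma> S \<sigma> A" and sp: "sparse S"
begin

lemma nbr_reach:
  assumes "x \<in> A" "x \<in> reach B s n" "adj x z" "z \<in> B"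
  shows "z \<in> reach B s (Suc n)"
  using assms by auto

lemma nbr_reach_back:
  assumes "x \<in> A" "z \<in> reach B s n" "adj x z"
  shows "x \<in> reach B s (Suc n)"
  using reach_step[OF assms(2) _ sym[OF assms(3)]] assms(1) blocked_subset(2)[OF G bl] by blast

text \<open>\<open>A\<close> is connected and contains neighbours of both \<open>s\<close> and
  \<open>t\<close>. The neighbour of \<open>t\<close> lies outside the ball of radius 9 about
  \<open>s\<close>, so \<open>A\<close> has to cross all the levels in question.\<close>

lemma levels:
  assumes s: "s \<in> S" and t: "t \<in> S" "t \<noteq> s" "deg A s > 0" "deg A t > 0" and n: "n \<le> 5"
  shows "\<exists>x\<in>A. x \<in> reach B s (Suc n) - reach B s n"
    "\<exists>x\<in>A \<inter> reach B s (Suc n). \<exists>z\<in>A - reach B s (Suc n). adj x z"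
proof -
  note sub = blocked_subset[OF G bl]
  obtain a where a: "a \<in> A" "adj s a" using t(3) unfolding deg_def nbs_def by (metis (no_types, lifting) card.empty ex_in_conv less_irrefl mem_Collect_eq)
  obtain a' where a': "a' \<in> A" "adj t a'" using t(4) unfolding deg_def nbs_def by (metis (no_types, lifting) card.empty ex_in_conv less_irrefl mem_Collect_eq)
  have a1: "a \<in> reach B s 1" using a sub by auto
  have a'n: "a' \<notin> reach B s m" if "m \<le> 9" for m
  proof
    assume "a' \<in> reach B s m"
    then have "t \<in> reach B s (Suc m)" using nbr_reach[OF a'(1) _ sym[OF a'(2)]] t(1) sub(1) by blast
    from sparseD[OF sp s t(1) this] t(2) that show False by linarith
  qed
  have edge: "\<exists>x\<in>A \<inter> reach B s (Suc n). \<exists>z\<in>A - reach B s (Suc n). adj x z" if "n \<le> 5" for n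
  proof -
    have P: "A \<inter> reach B s (Suc n) \<subseteq> A" by blast
    have "reach B s 1 \<subseteq> reach B s (Suc n)" by (rule reach_mono) simp
    then have "a \<in> A \<inter> reach B s (Suc n)" using a(1) a1 by blast
    then have ne: "A \<inter> reach B s (Suc n) \<noteq> {}" by blast
    have "Suc n \<le> 9" using that by simp
    then have "A \<inter> reach B s (Suc n) \<noteq> A" using a'n a'(1) by blast
    from connD[OF sub(5) P ne this] show ?thesis by blast
  qed
  show "\<exists>x\<in>A \<inter> reach B s (Suc n). \<exists>z\<in>A - reach B s (Suc n). adj x z" using edge[OF n] .
  show "\<exists>x\<in>A. x \<in> reach B s (Suc n) - reach B s n"
  proof (cases n)
    case 0
    have "a \<noteq> s" using a(2) irrefl by blast
    then show ?thesis using 0 a(1) a1 by auto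
  next
    case (Suc m)
    obtain x z where xz: "x \<in> A \<inter> reach B s (Suc m)" "z \<in> A - reach B s (Suc m)" "adj x z"
      using edge[of m] n Suc by auto
    have "z \<in> reach B s (Suc (Suc m))" using nbr_reach xz sub(2) by blast
    then show ?thesis using xz(2) Suc by blast
  qed
qed

lemma S_nbrs:
  assumes "s \<in> S" "x \<in> A" "x \<in> reach B s n" "n \<le> 9"
  shows "nbs S x \<subseteq> {s}"
proof
  fix t assume "t \<in> nbs S x"
  then have t: "t \<in> S" "adj x t" unfolding nbs_def by auto
  have "t \<in> reach B s (Suc n)" using nbr_reach[OF assms(2,3) t(2)] t(1) blocked_subset(1)[OF G bl] by blast
  from sparseD[OF sp assms(1) t(1) this] assms(4) show "t \<in> {s}" by simp
qed

text \<open>The neighbours of \<open>s\<close> in \<open>A\<close>, together with one vertex on each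
  of the levels 2 to 5.\<close>

lemma ball_card_small:
  assumes s: "s \<in> S" and t: "t \<in> S" "t \<noteq> s" "deg A s > 0" "deg A t > 0"
  shows "deg A s + 4 \<le> card (A \<inter> reach B s 5)"
proof -
  note sub = blocked_subset[OF G bl]
  have r: "reach B s 1 \<subseteq> reach B s 2" "reach B s 2 \<subseteq> reach B s 3" "reach B s 3 \<subseteq> reach B s 4"
    "reach B s 4 \<subseteq> reach B s 5" by (rule reach_mono; simp)+
  obtain x2 x3 x4 x5 where x: "x2 \<in> A" "x2 \<in> reach B s 2 - reach B s 1"
    "x3 \<in> A" "x3 \<in> reach B s 3 - reach B s 2" "x4 \<in> A" "x4 \<in> reach B s 4 - reach B s 3"
    "x5 \<in> A" "x5 \<in> reach B s 5 - reach B s 4"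
    using levels(1)[OF s t, of 1] levels(1)[OF s t, of 2] levels(1)[OF s t, of 3] levels(1)[OF s t, of 4]
    by (auto simp: eval_nat_numeral simp del: reach.simps)
  have N: "nbs A s \<subseteq> A \<inter> reach B s 1" using sub(2) unfolding nbs_def by auto
  have f: "finite (nbs A s)" by (simp add: sub(6) finite_nbs)
  have n: "x2 \<notin> nbs A s" "x3 \<notin> insert x2 (nbs A s)" "x4 \<notin> insert x3 (insert x2 (nbs A s))"
    "x5 \<notin> insert x4 (insert x3 (insert x2 (nbs A s)))"
    using x N r by blast+
  have "card (insert x5 (insert x4 (insert x3 (insert x2 (nbs A s))))) = deg A s + 4"
    using f n by (simp add: deg_def)
  moreover have "insert x5 (insert x4 (insert x3 (insert x2 (nbs A s)))) \<subseteq> A \<inter> reach B s 5"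
    using x N r by blast
  ultimately show ?thesis using sub(6) by (metis card_mono finite_Int)
qed

text \<open>Suppose \<open>x\<close> were the only vertex of \<open>A\<close> on the second level.
  The three neighbours of \<open>s\<close> have degree two in \<open>?X\<close>, and
  \<open>x\<close>, the only way further out, is adjacent to at most two of them. Then
  \<open>?X\<close> is a chordless 4-cycle \<open>m p x r\<close>, hence colourable, against
  \<open>uncolorable_subset\<close>. The assumption \<open>free\<close> makes the edges to
  \<open>A\<close> and \<open>S\<close> number exactly three at each of these vertices.\<close>

lemma second_level:
  assumes s: "s \<in> S" and t: "t \<in> S" "t \<noteq> s" "deg A s > 0" "deg A t > 0"
    and three: "deg A s = 3" and free: "y \<in> A \<inter> reach B s 5 \<Longrightarrow> card \<Gamma> = 0"
  shows "2 \<le> card (A \<inter> (reach B s 2 - reach B s 1))"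
proof (rule ccontr)
  assume "\<not> ?thesis"
  note sub = blocked_subset[OF G bl]
  let ?N = "nbs A s" and ?Z = "A \<inter> (reach B s 2 - reach B s 1)"
  have r: "reach B s 1 \<subseteq> reach B s 2" "reach B s 2 \<subseteq> reach B s 5" by (rule reach_mono; simp)+
  obtain x where x: "x \<in> ?Z" using levels(1)[OF s t, of 1] by (auto simp: eval_nat_numeral simp del: reach.simps)
  have "card ?Z \<le> Suc 0" using \<open>\<not> 2 \<le> card ?Z\<close> by simp
  moreover have "finite ?Z" using sub(6) by simp
  ultimately have Z: "?Z = {x}" using x card_le_Suc0_iff_eq[of ?Z] by blast
  have "s \<notin> A" using s sub(3) by blast
  then have N1: "A \<inter> reach B s 1 = ?N" using sub(2) unfolding nbs_def by auto
  have X: "A \<inter> reach B s 2 = insert x ?N" using Z N1 r(1) by blast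
  let ?X = "insert x ?N"
  have XA: "?X \<subseteq> A" using X by blast
  have finX: "finite ?X" by (rule finite_subset[OF XA sub(6)])
  have xN: "x \<notin> ?N" using x N1 by blast
  have gz: "gam \<Gamma> v = 0" if "v \<in> ?X" for v
  proof -
    have "v \<in> A \<inter> reach B s 5" using that X r(2) by blast
    then show ?thesis using free unfolding gam_def by (cases "v = y") simp_all
  qed
  have nbsX: "nbs A a = nbs ?X a" if "a \<in> ?N" for a
  proof -
    have a: "a \<in> A" "a \<in> reach B s 1" using that N1 by blast+
    have "nbs A a \<subseteq> A \<inter> reach B s 2"
      using nbr_reach[OF a] sub(2) unfolding nbs_def by (auto simp: eval_nat_numeral simp del: reach.simps)
    then show ?thesis using X XA unfolding nbs_def by blast
  qed
  have degN: "deg ?X a = 2" if "a \<in> ?N" for a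
  proof -
    have a: "a \<in> A" "a \<in> reach B s 1" using that N1 by blast+
    have "nbs S a \<subseteq> {s}" using S_nbrs[OF s a] by simp
    moreover have "adj a s" using that sym unfolding nbs_def by blast
    ultimately have "nbs S a = {s}" using s unfolding nbs_def by blast
    then have "deg S a = 1" by (simp add: deg_def)
    then have "deg A a = 2" using blocked_tight(2)[OF G bl a(1)] gz[of a] that by simp
    then show ?thesis using nbsX[OF that] unfolding deg_def by simp
  qed
  have xA: "x \<in> A" using x by blast
  have xout: "\<exists>z\<in>A - ?X. adj x z"
  proof -
    obtain p z where pz: "p \<in> A \<inter> reach B s 2" "z \<in> A - reach B s 2" "adj p z"
      using levels(2)[OF s t, of 1] by (auto simp: eval_nat_numeral simp del: reach.simps)
    have "p \<notin> ?N"
    proof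
      assume "p \<in> ?N"
      then have "nbs A p \<subseteq> ?X" using nbsX unfolding nbs_def by blast
      then show False using pz X unfolding nbs_def by blast
    qed
    moreover have "p \<in> ?X" using pz(1) unfolding X .
    ultimately have "p = x" by blast
    moreover have "z \<notin> ?X" using pz(2) unfolding X[symmetric] by blast
    ultimately show ?thesis using pz(2,3) by blast
  qed
  have xin: "\<exists>a\<in>?N. adj x a"
  proof -
    have "x \<in> reach B s (Suc 1) - reach B s 1" using x by (simp add: eval_nat_numeral del: reach.simps)
    then obtain p where p: "p \<in> reach B s 1" "adj p x" by auto
    have ps: "p \<noteq> s"
    proof
      assume "p = s"
      then have "x \<in> nbs A s" using p(2) xA unfolding nbs_def by blast
      then show False using xN by blast
    qed
    have pB: "p \<in> B" using p(1) reach_subset[of s B 1] s sub(1) by blast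
    then have "p \<in> A \<or> p \<in> S" using blocked_nbr[OF G bl xA _ sym[OF p(2)]] by blast
    moreover have "p \<notin> S" using sparseD[OF sp s _ p(1)] ps by auto
    ultimately have "p \<in> ?N" using p(1) N1 by blast
    then show ?thesis using p(2) sym by blast
  qed
  have degx: "deg ?X x \<le> 2"
  proof -
    obtain z where "z \<in> A - ?X" "adj x z" using xout by blast
    then have "deg ?X x < deg A x" using deg_less[OF sub(6) XA] by blast
    then show ?thesis using blocked_tight(2)[OF G bl xA] by linarith
  qed
  have "\<exists>m\<in>?N. \<not> adj x m"
  proof (rule ccontr)
    assume "\<not> ?thesis"
    then have "?N \<subseteq> nbs ?X x" unfolding nbs_def by blast
    then have "card ?N \<le> deg ?X x" unfolding deg_def using finX by (intro card_mono finite_nbs)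
    then show False using three degx unfolding deg_def by simp
  qed
  then obtain m where m: "m \<in> ?N" "\<not> adj x m" by blast
  have "card (?N - {m}) = 2" using three m(1) finX unfolding deg_def by simp
  then obtain p r where pr: "?N - {m} = {p, r}" "p \<noteq> r" by (meson card_2_iff)
  then have N: "?N = {m, p, r}" "m \<noteq> p" "m \<noteq> r" using m(1) by blast+
  have two: "nbs ?X a = {i, j}" if "a \<in> ?N" "nbs ?X a \<subseteq> {i, j}" for a i j
  proof (rule card_seteq)
    show "card {i, j} \<le> card (nbs ?X a)"
      using degN[OF that(1)] card_insert_le_m1[of 2 "{j}" i] unfolding deg_def by simp
  qed (use that in auto)
  have pN: "p \<in> ?N" and rN: "r \<in> ?N" using N(1) by blast+
  have four: "z \<in> {m, p, r, x} \<and> adj v z" if "z \<in> nbs ?X v" for z v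
  proof -
    have "z \<in> ?X" "adj v z" using that by (simp_all add: mem_nbs)
    then show ?thesis using N(1) by blast
  qed
  have "nbs ?X m \<subseteq> {p, r}" using four[of _ m] m(2) sym irrefl by blast
  from two[OF m(1) this] have "p \<in> nbs ?X m" "r \<in> nbs ?X m" by simp_all
  then have mp: "adj m p" "adj m r" using four by blast+
  \<comment> \<open>Otherwise \<open>m\<close>, \<open>p\<close>, \<open>r\<close> form a triangle
    that uses up their degrees in \<open>?X\<close>, and \<open>x\<close> has no neighbour on the
    first level.\<close>
  have npr: "\<not> adj p r"
  proof
    assume a: "adj p r"
    have dd: "\<not> adj v x" if v: "v \<in> ?N" "adj v i" "adj v j" "i \<in> ?X" "j \<in> ?X" "i \<noteq> j" "x \<noteq> i" "x \<noteq> j" for v i j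
    proof
      assume "adj v x"
      then have "{i, j, x} \<subseteq> nbs ?X v" using v(2-5) by (simp add: mem_nbs)
      then have "card {i, j, x} \<le> deg ?X v" unfolding deg_def using finX by (intro card_mono finite_nbs)
      then show False using degN[OF v(1)] v(6-8) by simp
    qed
    have "x \<noteq> m" "x \<noteq> p" "x \<noteq> r" using xN m(1) pN rN by blast+
    then have "\<not> adj p x" "\<not> adj r x"
      using dd[OF pN sym[OF mp(1)] a] dd[OF rN sym[OF mp(2)] sym[OF a]] m(1) pN rN N(2,3) by blast+
    moreover obtain a where "a \<in> {m, p, r}" "adj x a" using xin unfolding N(1) by blast
    ultimately show False using m(2) sym by blast
  qed
  have nrp: "\<not> adj r p" using npr sym by blast
  have "nbs ?X p \<subseteq> {m, x}" using four[of _ p] npr irrefl by blast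
  from two[OF pN this] have "x \<in> nbs ?X p" by simp
  then have px: "adj p x" using four by blast
  have "nbs ?X r \<subseteq> {m, x}" using four[of _ r] nrp irrefl by blast
  from two[OF rN this] have "x \<in> nbs ?X r" by simp
  then have rx: "adj r x" using four by blast
  obtain M' where M': "\<And>v. v \<in> ?X \<Longrightarrow> deg ?X v \<le> card (M' v)" "\<not> colorable ?X M'"
    using uncolorable_subset[OF sub(6,5) blocked_lists_ge(3)[OF G bl] blocked_uncolorable[OF G bl] XA] by blast
  have "{p, r} \<subseteq> nbs ?X x" using sym[OF px] sym[OF rx] pN rN by (simp add: mem_nbs[of _ ?X])
  then have "card {p, r} \<le> deg ?X x" unfolding deg_def using finX by (intro card_mono finite_nbs)
  then have "2 \<le> deg ?X x" using pr(2) by simp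
  then have ge: "2 \<le> card (M' v)" if "v \<in> ?X" for v
    using M'(1)[OF that] degN[of v] that by fastforce
  have "colorable ?X M'"
  proof (rule colorable_four_cycle[of _ m p x r])
    show "?X = {m, p, x, r}" using N by blast
    show "distinct [m, p, x, r]" using N xN pr(2) by auto
    show "\<not> adj m x" using m(2) sym by blast
    show "\<not> adj p r" by (rule npr)
  qed (rule ge)
  then show False using M'(2) by blast
qed

text \<open>Three vertices on level 1, two on level 2 by \<open>second_level\<close>, and four on
  levels 3 to 5: a vertex \<open>u\<close> on level 4 is adjacent to no vertex of \<open>S\<close>
  and is not short of a colour, so it has three neighbours in \<open>A\<close>, all on levels 3 to
  5.\<close>

lemma ball_card_large:
  assumes s: "s \<in> S" and t: "t \<in> S" "t \<noteq> s" "deg A s > 0" "deg A t > 0"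
    and three: "deg A s = 3" and free: "y \<in> A \<inter> reach B s 5 \<Longrightarrow> card \<Gamma> = 0"
  shows "9 \<le> card (A \<inter> reach B s 5)"
proof -
  note sub = blocked_subset[OF G bl]
  have r: "reach B s 1 \<subseteq> reach B s 2" "reach B s 2 \<subseteq> reach B s 3" "reach B s 3 \<subseteq> reach B s 4"
    "reach B s 4 \<subseteq> reach B s 5" by (rule reach_mono; simp)+
  obtain u where u: "u \<in> A" "u \<in> reach B s 4 - reach B s 3"
    using levels(1)[OF s t, of 3] by (auto simp: eval_nat_numeral simp del: reach.simps)
  have u4: "u \<in> reach B s 4" using u by blast
  have "nbs S u = {}"
  proof -
    have "nbs S u \<subseteq> {s}" using S_nbrs[OF s u(1) u4] by simp
    moreover have "\<not> adj u s"
    proof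
      assume "adj u s"
      then have "u \<in> reach B s (Suc 0)" using nbr_reach_back[OF u(1), of s s 0] by simp
      then show False using u(2) reach_mono[of "Suc 0" 3 B s] by auto
    qed
    ultimately show ?thesis unfolding nbs_def by blast
  qed
  moreover have "gam \<Gamma> u = 0" using free u u4 r unfolding gam_def by auto
  ultimately have d: "card (nbs A u) = 3" using blocked_tight(2)[OF G bl u(1)] by (simp add: deg_def)
  have bwd: "u \<in> reach B s 3" if "z \<in> reach B s 2" "adj u z" for z
    using nbr_reach_back[OF u(1) that] by (simp add: eval_nat_numeral del: reach.simps)
  have fwd: "z \<in> reach B s 5" if "z \<in> A" "adj u z" for z
    using nbr_reach[OF u(1) u4 that(2)] that(1) sub(2) by (auto simp: eval_nat_numeral simp del: reach.simps)
  have "insert u (nbs A u) \<subseteq> A \<inter> (reach B s 5 - reach B s 2)"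
    using u r bwd fwd unfolding nbs_def by blast
  moreover have "card (insert u (nbs A u)) = 4"
    using d sub(6) irrefl by (subst card_insert_disjoint) (auto simp: finite_nbs nbs_def)
  ultimately have c3: "4 \<le> card (A \<inter> (reach B s 5 - reach B s 2))"
    using sub(6) by (metis card_mono finite_Int)
  have c2: "2 \<le> card (A \<inter> (reach B s 2 - reach B s 1))"
    using second_level[OF assms] .
  have c1: "3 \<le> card (A \<inter> reach B s 1)"
  proof -
    have "nbs A s \<subseteq> A \<inter> reach B s 1" using sub(2) unfolding nbs_def by auto
    then have "card (nbs A s) \<le> card (A \<inter> reach B s 1)" using sub(6) by (intro card_mono) auto
    then show ?thesis using three unfolding deg_def by simp
  qed
  have "A \<inter> reach B s 5 = (A \<inter> reach B s 1) \<union> (A \<inter> (reach B s 2 - reach B s 1)) \<union> (A \<inter> (reach B s 5 - reach B s 2))"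
    using r by blast
  moreover have "card \<dots> = card (A \<inter> reach B s 1) + card (A \<inter> (reach B s 2 - reach B s 1)) + card (A \<inter> (reach B s 5 - reach B s 2))"
    using sub(6) r(1) by (subst card_Un_disjoint, simp, simp, blast)+ simp
  ultimately show ?thesis using c1 c2 c3 by simp
qed

text \<open>Around each vertex of \<open>S\<close> with \<open>e\<close> neighbours in \<open>A\<close> there are at least \<open>3 e\<close> private vertices
  of \<open>A\<close> (two fewer near \<open>y\<close>), which is more than the bound on the order of \<open>A\<close> permits.\<close>

lemma sparse_not_blocked:
  assumes "s \<in> S" "t \<in> S" "t \<noteq> s" "deg A s > 0" "deg A t > 0"
  shows False
proof -
  note sub = blocked_subset[OF G bl]
  let ?I = "{s \<in> S. deg A s > 0}"
  let ?Y = "\<lambda>s. A \<inter> reach B s 5"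
  let ?g = "\<lambda>s. if y \<in> ?Y s then card \<Gamma> else 0"
  have finI: "finite ?I" using sub(7) by simp
  have G1: "card \<Gamma> \<le> 1" using G(2) q by linarith
  \<comment> \<open>For degree e \<le> 2 the small bound e + 4 suffices, and for e = 3 the large
    bound 9. If \<open>y\<close> with its forbidden colour is near, only e + 4 is at hand, which may
    fall short by 2; this is the term \<open>2 * ?g s\<close>.\<close>
  have each: "3 * deg A s \<le> card (?Y s) + 2 * ?g s" if "s \<in> ?I" for s
  proof -
    have sS: "s \<in> S" "deg A s > 0" using that by auto
    obtain t' where t': "t' \<in> S" "t' \<noteq> s" "deg A t' > 0" using assms by metis
    have small: "deg A s + 4 \<le> card (?Y s)" using ball_card_small[OF sS(1) t'(1,2) sS(2) t'(3)] .
    have d3: "deg A s \<le> 3"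
      using deg_le_3[of s] deg_mono[OF finB sub(2), of s] sS(1) sub(1) by (meson le_trans subsetD)
    show ?thesis
    proof (cases "deg A s = 3 \<and> ?g s = 0")
      case True
      then have "9 \<le> card (?Y s)"
        using ball_card_large[OF sS(1) t'(1,2) sS(2) t'(3)] by presburger
      then show ?thesis using True by simp
    next
      case False
      then have "deg A s \<le> 2 \<or> ?g s \<ge> 1" using d3 by linarith
      then show ?thesis using small d3 by linarith
    qed
  qed
  have disj: "?Y s \<inter> ?Y t = {}" if "s \<in> ?I" "t \<in> ?I" "s \<noteq> t" for s t
  proof (rule ccontr)
    assume "?Y s \<inter> ?Y t \<noteq> {}"
    then obtain x where x: "x \<in> reach B s 5" "x \<in> reach B t 5" by blast
    have "t \<in> reach B x 5" using reach_sym[OF _ x(2)] that sub(1) by blast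
    from reach_trans[OF x(1) this] have "t \<in> reach B s 10" by simp
    then show False using sparseD[OF sp, of s t 10] that by auto
  qed
  have "(\<Sum>s\<in>?I. card (?Y s)) = card (\<Union>s\<in>?I. ?Y s)"
    using finI sub(6) disj by (subst card_UN_disjoint) auto
  also have "\<dots> \<le> card A" using sub(6) by (intro card_mono) auto
  finally have balls: "(\<Sum>s\<in>?I. card (?Y s)) \<le> card A" .
  have gs: "(\<Sum>s\<in>?I. ?g s) \<le> (if y \<in> A then card \<Gamma> else 0)"
  proof (cases "\<exists>s\<in>?I. y \<in> ?Y s")
    case True
    then obtain s0 where s0: "s0 \<in> ?I" "y \<in> ?Y s0" by blast
    have "?g s = (if s = s0 then card \<Gamma> else 0)" if "s \<in> ?I" for s
      using disj[OF that s0(1)] s0(2) by auto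
    then have "(\<Sum>s\<in>?I. ?g s) = (\<Sum>s\<in>?I. if s = s0 then card \<Gamma> else 0)" by (rule sum.cong[OF refl])
    also have "\<dots> = card \<Gamma>" using finI s0(1) by simp
    finally show ?thesis using s0(2) by simp
  next
    case False
    then have "(\<Sum>s\<in>?I. ?g s) = 0" by (intro sum.neutral) auto
    then show ?thesis by simp
  qed
  define e where "e = (\<Sum>s\<in>?I. deg A s)"
  define Q where "Q = (if y \<in> A then card \<Gamma> else 0)"
  define g where "g = (\<Sum>s\<in>?I. ?g s)"
  have "(\<Sum>v\<in>A. deg S v) = e"
    unfolding e_def blocked_double_count[OF G bl] using sub(7) by (intro sum.mono_neutral_right) auto
  then have 1: "card A + 6 \<le> 3 * (e + Q)" using blocked_bound[OF G bl] unfolding Q_def by simp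
  have "(\<Sum>s\<in>?I. 3 * deg A s) \<le> (\<Sum>s\<in>?I. card (?Y s) + 2 * ?g s)"
    by (intro sum_mono each)
  then have "3 * e \<le> (\<Sum>s\<in>?I. card (?Y s)) + 2 * g"
    unfolding sum.distrib sum_distrib_left e_def g_def .
  moreover have "g \<le> Q" using gs unfolding g_def Q_def .
  moreover have "Q \<le> 1" using G1 unfolding Q_def by simp
  \<comment> \<open>The counts clash with a margin of one: the other inequality amounts to
    \<open>card A + 3 \<le> 3 * e\<close>.\<close>
  ultimately have "3 * e \<le> card A + 2" using balls by simp
  moreover have "card A + 6 \<le> 3 * e + 3" using 1 \<open>Q \<le> 1\<close> by simp
  ultimately show False by simp
qed

end

text \<open>A blocked component cannot touch two points of \<open>S\<close> by
  \<open>sparse_not_blocked\<close>. If it touches only \<open>s\<close>, the colouring of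
  \<open>B\<close> that witnesses feasibility of \<open>\<sigma> s\<close> restricts to it.\<close>

lemma sparse_extends:
  assumes G: "finite \<Gamma>" "card \<Gamma> \<le> q" and sp: "sparse S" and f: "\<And>s. s \<in> S \<Longrightarrow> \<sigma> s \<in> feas \<Gamma> s"
  shows "\<exists>\<psi>. col B (LG \<Gamma>) \<psi> \<and> (\<forall>s\<in>S. \<psi> s = \<sigma> s)"
proof (rule ccontr)
  assume n: "\<not> ?thesis"
  have SB: "S \<subseteq> B" using sp unfolding sparse_def by blast
  have ind: "\<not> adj s t" if "s \<in> S" "t \<in> S" for s t
  proof
    assume a: "adj s t"
    have "t \<in> reach B s 1" using a that SB by auto
    from sparseD[OF sp that this] have "t = s" by simp
    then show False using a irrefl by blast
  qed
  have "col S (LG \<Gamma>) \<sigma>"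
    using ind f feas_subset SB unfolding col_def by blast
  from blocked_exists[OF SB this n] obtain A where bl: "blocked \<Gamma> S \<sigma> A" .
  note sub = blocked_subset[OF G bl]
  obtain v where v: "v \<in> A" "deg S v > 0" using blocked_touches[OF G bl] by blast
  then obtain s where s: "s \<in> S" "adj v s"
    unfolding deg_def nbs_def by (metis (no_types, lifting) card.empty ex_in_conv less_irrefl mem_Collect_eq)
  have pos: "deg A z > 0" if "x \<in> A" "adj x z" for x z
  proof -
    have "x \<in> nbs A z" using that sym unfolding nbs_def by blast
    then show ?thesis unfolding deg_def using sub(6) finite_nbs card_gt_0_iff by blast
  qed
  have "nbs S x \<subseteq> {s}" if "x \<in> A" for x
  proof
    fix t assume "t \<in> nbs S x"
    then have t: "t \<in> S" "adj x t" unfolding nbs_def by auto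
    show "t \<in> {s}"
      using sparse_not_blocked[OF G bl sp s(1) t(1) _ pos[OF v(1) s(2)] pos[OF that t(2)]] by blast
  qed
  then have n: "nbs S x \<subseteq> {s}" if "x \<in> A" for x using that by blast
  obtain \<psi> where \<psi>: "col B (LG \<Gamma>) \<psi>" "\<psi> s = \<sigma> s" using f[OF s(1)] unfolding feas_def by auto
  have "col A (\<lambda>v. LG \<Gamma> v - \<sigma> ` nbs S v) \<psi>"
    unfolding col_def
  proof (intro conjI ballI impI)
    fix x assume x: "x \<in> A"
    have "\<psi> x \<noteq> \<sigma> t" if "t \<in> nbs S x" for t
    proof -
      have "t = s" "adj x t" using n[OF x] that unfolding nbs_def by blast+
      then show ?thesis using \<psi> x s(1) sub(1,2) unfolding col_def by (metis subsetD)
    qed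
    moreover have "\<psi> x \<in> LG \<Gamma> x" using \<psi>(1) x sub(2) unfolding col_def by blast
    ultimately show "\<psi> x \<in> LG \<Gamma> x - \<sigma> ` nbs S x" by blast
  next
    fix u x assume "u \<in> A" "x \<in> A" "adj u x"
    then show "\<psi> u \<noteq> \<psi> x" using \<psi>(1) sub(2) unfolding col_def by blast
  qed
  then show False using blocked_uncolorable[OF G bl] unfolding colorable_def by blast
qed

end

section \<open>Payoffs\<close>

lemma exists_ge_average:
  fixes h :: "'b \<Rightarrow> real"
  assumes "finite F" "F \<noteq> {}" "real (card F) * t \<le> sum h F"
  shows "\<exists>c\<in>F. t \<le> h c"
proof (rule ccontr)
  assume "\<not> ?thesis"
  then have "sum h F < (\<Sum>c\<in>F. t)" using assms by (intro sum_strict_mono) auto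
  then show False using assms(3) by simp
qed

text \<open>Avoidance is rewarded for the whole palette \<open>C\<close>, not just the list of
  \<open>v\<close>, because the colour to be avoided may come from a request at another
  vertex.\<close>

definition payoff :: "('a \<Rightarrow> nat \<Rightarrow> real) \<Rightarrow> ('a \<Rightarrow> nat \<Rightarrow> real) \<Rightarrow> nat set \<Rightarrow> 'a \<Rightarrow> nat \<Rightarrow> real" where
  "payoff a b C v c = a v c + (\<Sum>d\<in>C - {c}. b v d)"

definition nonneg :: "('a \<Rightarrow> nat \<Rightarrow> real) \<Rightarrow> bool" where
  "nonneg a \<longleftrightarrow> (\<forall>v c. 0 \<le> a v c)"

lemma payoff_nonneg: "nonneg a \<Longrightarrow> nonneg b \<Longrightarrow> 0 \<le> payoff a b C v c"
  unfolding payoff_def by (intro add_nonneg_nonneg sum_nonneg) (auto simp: nonneg_def)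

text \<open>In the average over \<open>F\<close> each colour of \<open>F\<close> has weight at least
  1/3, and each colour of \<open>C\<close> is avoided by all but at most one of the at least two
  members of \<open>F\<close>.\<close>

lemma payoff_average:
  assumes C: "finite C" and nn: "nonneg a" "nonneg b"
    and F: "finite F" "2 \<le> card F" "card F \<le> 3"
  shows "\<exists>c\<in>F. (\<Sum>c\<in>F. a v c) / 3 + (\<Sum>d\<in>C. b v d) / 2 \<le> payoff a b C v c"
proof (rule exists_ge_average[OF F(1)])
  show "F \<noteq> {}" using F(2) by auto
  let ?a = "\<Sum>c\<in>F. a v c" and ?b = "\<Sum>d\<in>C. b v d"
  have pos: "0 \<le> ?a" "0 \<le> ?b" using nn by (auto intro!: sum_nonneg simp: nonneg_def)
  have "(\<Sum>d\<in>C - {c}. b v d) = ?b - (if c \<in> C then b v c else 0)" for c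
    using C by (simp add: sum_diff1)
  then have "(\<Sum>c\<in>F. payoff a b C v c) = ?a + (real (card F) * ?b - (\<Sum>c\<in>F. if c \<in> C then b v c else 0))"
    unfolding payoff_def by (simp add: sum.distrib sum_subtractf)
  moreover have "(\<Sum>c\<in>F. if c \<in> C then b v c else 0) = (\<Sum>c\<in>F \<inter> C. b v c)"
    using F(1) by (simp add: sum.inter_restrict)
  moreover have "(\<Sum>c\<in>F \<inter> C. b v c) \<le> ?b"
    using C nn(2) by (intro sum_mono2) (auto simp: nonneg_def)
  ultimately have ge: "?a + (real (card F) - 1) * ?b \<le> (\<Sum>c\<in>F. payoff a b C v c)"
    by (simp add: algebra_simps)
  have "real (card F) * (?a / 3) \<le> ?a"
    using mult_right_mono[of "real (card F)" 3 "?a / 3"] F(3) pos(1) by simp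
  moreover have "real (card F) * (?b / 2) \<le> (real (card F) - 1) * ?b"
    using mult_right_mono[of "real (card F) / 2" "real (card F) - 1" ?b] F(2) pos(2) by simp
  ultimately show "real (card F) * (?a / 3 + ?b / 2) \<le> (\<Sum>c\<in>F. payoff a b C v c)"
    using ge by (simp only: distrib_left)
qed

context body begin

text \<open>A colouring of \<open>B\<close> with no colour forbidden at \<open>y\<close> is spoiled only by forbidding its own colour
  of \<open>y\<close>.\<close>

lemma feas_threshold:
  "\<exists>f. \<forall>v\<in>B. \<forall>c\<in>L v. \<forall>\<Gamma>. finite \<Gamma> \<longrightarrow> card \<Gamma> \<le> q \<longrightarrow> f v c \<notin> \<Gamma> \<longrightarrow> c \<in> feas \<Gamma> v"
proof -
  have "\<exists>x. \<forall>\<Gamma>. finite \<Gamma> \<longrightarrow> card \<Gamma> \<le> q \<longrightarrow> x \<notin> \<Gamma> \<longrightarrow> c \<in> feas \<Gamma> v" if v: "v \<in> B" "c \<in> L v" for v c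
  proof (cases "v = y")
    case True
    then show ?thesis using feas_y v(2) by blast
  next
    case False
    obtain \<psi> where \<psi>: "col B (LG {}) \<psi>" "\<psi> v = c"
      using feas_empty[OF v] unfolding feas_def by auto
    have "col B (LG \<Gamma>) \<psi>" if "\<psi> y \<notin> \<Gamma>" for \<Gamma>
      using \<psi>(1) that unfolding col_def LG_def by auto
    then show ?thesis using \<psi>(2) unfolding feas_def by blast
  qed
  then show ?thesis by metis
qed

text \<open>A ball of radius 10 in a subcubic graph has at most \<open>3 * 2 ^ 10 - 2 = 3070\<close> vertices, so some
  sparse set carries a fraction of \<open>1/3070\<close> of the averages \<open>1/3\<close> and \<open>1/2\<close>.\<close>

lemma body_payoff:
  assumes C: "finite C" and nn: "nonneg a" "nonneg b" and G: "finite \<Gamma>" "card \<Gamma> \<le> q"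
  shows "\<exists>\<psi>. col B (LG \<Gamma>) \<psi> \<and>
    (\<Sum>v\<in>B. \<Sum>c\<in>feas \<Gamma> v. a v c) / 9210 + (\<Sum>v\<in>B. \<Sum>d\<in>C. b v d) / 6140 \<le> (\<Sum>v\<in>B. payoff a b C v (\<psi> v))"
proof -
  let ?W = "\<lambda>v. (\<Sum>c\<in>feas \<Gamma> v. a v c) / 3 + (\<Sum>d\<in>C. b v d) / 2"
  have Wpos: "0 \<le> ?W v" for v
    using nn by (intro add_nonneg_nonneg divide_nonneg_nonneg sum_nonneg) (auto simp: nonneg_def)
  have "\<exists>c\<in>feas \<Gamma> v. ?W v \<le> payoff a b C v c" if "v \<in> B" for v
    using payoff_average[OF C nn card_feas(3,1,2)[OF G that]] .
  then obtain \<sigma> where \<sigma>: "\<And>v. v \<in> B \<Longrightarrow> \<sigma> v \<in> feas \<Gamma> v \<and> ?W v \<le> payoff a b C v (\<sigma> v)"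
    by metis
  have "\<exists>S\<subseteq>B. (\<forall>s\<in>S. \<forall>t\<in>S. s \<noteq> t \<longrightarrow> \<not> t \<in> reach B s 10) \<and> sum ?W B \<le> real 3070 * sum ?W S"
  proof (rule weighted_independent_set[OF finB Wpos])
    show "v \<in> reach B v 10" for v using reach_mono[of 0 10 B v] by auto
    show "u \<in> reach B v 10" if "u \<in> B" "v \<in> reach B u 10" for u v using reach_sym[OF that] .
    show "card {u \<in> B. u \<in> reach B v 10} \<le> 3070" if "v \<in> B" for v
    proof -
      have "{u \<in> B. u \<in> reach B v 10} = reach B v 10" using reach_subset[OF that] by blast
      then show ?thesis using card_reach[OF finB that deg_le_3, of 10] by simp
    qed
  qed
  then obtain S where S: "S \<subseteq> B" "\<forall>s\<in>S. \<forall>t\<in>S. s \<noteq> t \<longrightarrow> t \<notin> reach B s 10" "sum ?W B \<le> real 3070 * sum ?W S"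
    by blast
  have "sparse S" using S unfolding sparse_def by blast
  then obtain \<psi> where \<psi>: "col B (LG \<Gamma>) \<psi>" "\<forall>s\<in>S. \<psi> s = \<sigma> s"
    using sparse_extends[OF G, of S \<sigma>] \<sigma> S(1) by blast
  have "sum ?W S \<le> (\<Sum>v\<in>S. payoff a b C v (\<psi> v))"
    using \<sigma> \<psi>(2) S(1) by (intro sum_mono) (metis subsetD)
  also have "\<dots> \<le> (\<Sum>v\<in>B. payoff a b C v (\<psi> v))"
    using finB S(1) payoff_nonneg[OF nn] by (intro sum_mono2) auto
  finally have "sum ?W B \<le> 3070 * (\<Sum>v\<in>B. payoff a b C v (\<psi> v))" using S(3) by simp
  then have "(\<Sum>v\<in>B. \<Sum>c\<in>feas \<Gamma> v. a v c) / 3 + (\<Sum>v\<in>B. \<Sum>d\<in>C. b v d) / 2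
      \<le> 3070 * (\<Sum>v\<in>B. payoff a b C v (\<psi> v))"
    by (simp only: sum.distrib sum_divide_distrib)
  then show ?thesis using \<psi>(1) by (intro exI[of _ \<psi>]) simp
qed

end

section \<open>Payoffs in forests\<close>

context ugraph begin

text \<open>Acyclicity stated as 1-degeneracy, the form in which leaves are removed.\<close>

definition forest :: "'a set \<Rightarrow> bool" where
  "forest F \<longleftrightarrow> (\<forall>U\<subseteq>F. U \<noteq> {} \<longrightarrow> (\<exists>v\<in>U. deg U v \<le> 1))"

text \<open>List packing: with lists of size two one of the two assignments of the colours of a leaf is
  compatible with both colourings of the rest.\<close>

lemma forest_packing:
  assumes "finite F" "forest F" "\<And>v. v \<in> F \<Longrightarrow> card (M v) = 2"
  shows "\<exists>\<phi> \<psi>. col F M \<phi> \<and> col F M \<psi> \<and> (\<forall>v\<in>F. \<phi> v \<noteq> \<psi> v)"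
  using assms
proof (induction F rule: finite_remove_induct)
  case empty
  then show ?case by (simp add: col_def)
next
  case (remove F)
  obtain v where v: "v \<in> F" "deg F v \<le> 1"
    using remove.prems(1) remove.hyps unfolding forest_def by blast
  have "forest (F - {v})" using remove.prems(1) unfolding forest_def by blast
  then obtain \<phi> \<psi> where h: "col (F - {v}) M \<phi>" "col (F - {v}) M \<psi>" "\<forall>u\<in>F - {v}. \<phi> u \<noteq> \<psi> u"
    using remove.IH[OF v(1)] remove.prems(2) by blast
  obtain s t where st: "M v = {s, t}" "s \<noteq> t" using remove.prems(2)[OF v(1)] by (meson card_2_iff)
  let ?N = "nbs (F - {v}) v"
  have "?N \<subseteq> nbs F v" unfolding nbs_def by blast
  then have "card ?N \<le> deg F v"
    unfolding deg_def by (intro card_mono finite_nbs remove.hyps(1))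
  then have "card ?N \<le> Suc 0" using v(2) by simp
  then have one: "u = u'" if "u \<in> ?N" "u' \<in> ?N" for u u'
    using that remove.hyps(1) by (metis card_le_Suc0_iff_eq finite_Diff finite_nbs)
  have "\<exists>x y. {x, y} = {s, t} \<and> x \<notin> \<phi> ` ?N \<and> y \<notin> \<psi> ` ?N"
  proof (cases "?N = {}")
    case True
    then show ?thesis by blast
  next
    case False
    then obtain u where u: "?N = {u}" using one by blast
    then have "u \<in> F - {v}" unfolding nbs_def by blast
    then have ne: "\<phi> u \<noteq> \<psi> u" using h(3) by blast
    show ?thesis
    proof (cases "s = \<phi> u \<or> t = \<psi> u")
      case True
      then have "t \<notin> \<phi> ` ?N \<and> s \<notin> \<psi> ` ?N" using u ne st(2) by auto
      then show ?thesis by (intro exI[of _ t] exI[of _ s]) (simp add: insert_commute)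
    next
      case False
      then have "s \<notin> \<phi> ` ?N \<and> t \<notin> \<psi> ` ?N" using u by auto
      then show ?thesis by blast
    qed
  qed
  then obtain x y where xy: "{x, y} = {s, t}" "x \<notin> \<phi> ` ?N" "y \<notin> \<psi> ` ?N" by blast
  have mem: "x \<in> M v" "y \<in> M v" "x \<noteq> y" using xy(1) st by (auto simp: doubleton_eq_iff)
  have ext: "col F M (\<lambda>u. if u \<in> {v} then z else \<theta> u)" if "col (F - {v}) M \<theta>" "z \<in> M v" "z \<notin> \<theta> ` ?N" for \<theta> z
  proof -
    have "col {v} (\<lambda>u. M u - \<theta> ` nbs (F - {v}) u) (\<lambda>_. z)"
      using that by (simp add: col_def irrefl)
    from col_combine[OF that(1) this] have "col (F - {v} \<union> {v}) M (\<lambda>u. if u \<in> {v} then z else \<theta> u)" by blast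
    moreover have "F - {v} \<union> {v} = F" using v(1) by blast
    ultimately show ?thesis by simp
  qed
  show ?case
    using ext[OF h(1) mem(1) xy(2)] ext[OF h(2) mem(2) xy(3)] h(3) mem(3)
    by (intro exI[of _ "\<lambda>u. if u \<in> {v} then x else \<phi> u"] exI[of _ "\<lambda>u. if u \<in> {v} then y else \<psi> u"]) simp
qed

text \<open>Lists of size three drop their cheapest colour and keep 2/3 of the rewards. The two
  packed colourings together use both remaining colours everywhere and avoid every colour at least
  once; the better one collects half.\<close>

lemma forest_payoff:
  assumes F: "finite F" "forest F" and C: "finite C" and nn: "nonneg a" "nonneg b"
    and M: "\<And>v. v \<in> F \<Longrightarrow> 2 \<le> card (M v) \<and> card (M v) \<le> 3"
  shows "\<exists>\<psi>. col F M \<psi> \<and>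
    (\<Sum>v\<in>F. \<Sum>c\<in>M v. a v c) / 3 + (\<Sum>v\<in>F. \<Sum>d\<in>C. b v d) / 2 \<le> (\<Sum>v\<in>F. payoff a b C v (\<psi> v))"
proof -
  have "\<exists>T\<subseteq>M v. card T = 2 \<and> 2 / 3 * (\<Sum>c\<in>M v. a v c) \<le> (\<Sum>c\<in>T. a v c)" if v: "v \<in> F" for v
  proof -
    have pos: "0 \<le> (\<Sum>c\<in>M v. a v c)" using nn by (auto intro!: sum_nonneg simp: nonneg_def)
    have fin: "finite (M v)" using M[OF v] by (intro card_ge_0_finite) linarith
    consider "card (M v) = 2" | "card (M v) = 3" using M[OF v] by linarith
    then show ?thesis
    proof cases
      case 1
      then show ?thesis using pos by (intro exI[of _ "M v"]) simp
    next
      case 2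
      then have "M v \<noteq> {}" by auto
      from exists_ge_average[OF fin this, of "- (\<Sum>c\<in>M v. a v c) / 3" "\<lambda>c. - a v c"] 2
      obtain c where c: "c \<in> M v" "a v c \<le> (\<Sum>c\<in>M v. a v c) / 3" by (auto simp: sum_negf)
      have "(\<Sum>d\<in>M v - {c}. a v d) = (\<Sum>c\<in>M v. a v c) - a v c" using fin c(1) by (simp add: sum_diff1)
      then have "2 / 3 * (\<Sum>c\<in>M v. a v c) \<le> (\<Sum>d\<in>M v - {c}. a v d)" using c(2) by simp
      moreover have "card (M v - {c}) = 2" using 2 c(1) fin by simp
      ultimately show ?thesis by (intro exI[of _ "M v - {c}"]) auto
    qed
  qed
  then obtain T where T: "\<And>v. v \<in> F \<Longrightarrow> T v \<subseteq> M v \<and> card (T v) = 2 \<and> 2 / 3 * (\<Sum>c\<in>M v. a v c) \<le> (\<Sum>c\<in>T v. a v c)"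
    by metis
  obtain \<phi> \<psi> where p: "col F T \<phi>" "col F T \<psi>" "\<forall>v\<in>F. \<phi> v \<noteq> \<psi> v"
    using forest_packing[OF F, of T] T by blast
  have cols: "col F M \<phi>" "col F M \<psi>" using p T unfolding col_def by blast+
  have each: "2 * ((\<Sum>c\<in>M v. a v c) / 3 + (\<Sum>d\<in>C. b v d) / 2) \<le> payoff a b C v (\<phi> v) + payoff a b C v (\<psi> v)"
    if v: "v \<in> F" for v
  proof -
    have "{\<phi> v, \<psi> v} = T v"
    proof (rule card_seteq)
      show "finite (T v)" using T[OF v] by (metis card.infinite zero_neq_numeral)
      show "{\<phi> v, \<psi> v} \<subseteq> T v" using p(1,2) v unfolding col_def by blast
      show "card (T v) \<le> card {\<phi> v, \<psi> v}" using T[OF v] p(3) v by simp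
    qed
    then have "(\<Sum>c\<in>T v. a v c) = (\<Sum>c\<in>{\<phi> v, \<psi> v}. a v c)" by simp
    also have "\<dots> = a v (\<phi> v) + a v (\<psi> v)" using p(3) v by simp
    finally have "2 / 3 * (\<Sum>c\<in>M v. a v c) \<le> a v (\<phi> v) + a v (\<psi> v)" using T[OF v] by simp
    moreover have "(\<Sum>d\<in>C. b v d) \<le> (\<Sum>d\<in>(C - {\<phi> v}) \<union> (C - {\<psi> v}). b v d)"
      using C p(3) v nn(2) by (intro sum_mono2) (auto simp: nonneg_def)
    moreover have "(\<Sum>d\<in>(C - {\<phi> v}) \<union> (C - {\<psi> v}). b v d) \<le> (\<Sum>d\<in>C - {\<phi> v}. b v d) + (\<Sum>d\<in>C - {\<psi> v}. b v d)"
    proof -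
      have "0 \<le> (\<Sum>d\<in>(C - {\<phi> v}) \<inter> (C - {\<psi> v}). b v d)"
        using nn(2) by (intro sum_nonneg) (simp add: nonneg_def)
      then show ?thesis
        using sum.union_inter[of "C - {\<phi> v}" "C - {\<psi> v}" "b v"] C by simp
    qed
    ultimately show ?thesis unfolding payoff_def by simp
  qed
  let ?t = "(\<Sum>v\<in>F. \<Sum>c\<in>M v. a v c) / 3 + (\<Sum>v\<in>F. \<Sum>d\<in>C. b v d) / 2"
  have "2 * ?t = (\<Sum>v\<in>F. 2 * ((\<Sum>c\<in>M v. a v c) / 3 + (\<Sum>d\<in>C. b v d) / 2))"
    by (simp add: sum.distrib sum_divide_distrib sum_distrib_left)
  also have "\<dots> \<le> (\<Sum>v\<in>F. payoff a b C v (\<phi> v) + payoff a b C v (\<psi> v))" by (intro sum_mono each)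
  also have "\<dots> = (\<Sum>v\<in>F. payoff a b C v (\<phi> v)) + (\<Sum>v\<in>F. payoff a b C v (\<psi> v))" by (rule sum.distrib)
  finally have "2 * ?t \<le> (\<Sum>v\<in>F. payoff a b C v (\<phi> v)) + (\<Sum>v\<in>F. payoff a b C v (\<psi> v))" .
  moreover have "t \<le> p \<or> t \<le> r" if "2 * t \<le> p + r" for t p r :: real using that by linarith
  ultimately have "?t \<le> (\<Sum>v\<in>F. payoff a b C v (\<phi> v)) \<or> ?t \<le> (\<Sum>v\<in>F. payoff a b C v (\<psi> v))" by blast
  then show ?thesis using cols by blast
qed

end

section \<open>Reducible parts\<close>

locale list_graph = ugraph adj for adj :: "'a \<Rightarrow> 'a \<Rightarrow> bool" +
  fixes L :: "'a \<Rightarrow> nat set" and C :: "nat set"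
  assumes card_L: "card (L v) = 3" and finC: "finite C" and L_sub: "L v \<subseteq> C"
begin

text \<open>The request for colour \<open>c\<close> at \<open>v\<close> can be blocked only by one fixed vertex \<open>\<zeta> v c\<close> outside \<open>H\<close>
  receiving one fixed colour \<open>f v c\<close>.\<close>

definition open_cols :: "'a set \<Rightarrow> ('a \<Rightarrow> nat \<Rightarrow> 'a) \<Rightarrow> ('a \<Rightarrow> nat \<Rightarrow> nat) \<Rightarrow> ('a \<Rightarrow> nat) \<Rightarrow> 'a \<Rightarrow> nat set" where
  "open_cols Y \<zeta> f \<phi> v = {c \<in> L v. \<zeta> v c \<in> Y \<longrightarrow> \<phi> (\<zeta> v c) \<noteq> f v c}"

text \<open>\<open>\<zeta>\<close> and \<open>f\<close> are chosen before \<open>\<phi>\<close>,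
  since avoidance rewards have to be placed on \<open>X - H\<close> before its colouring is known.
  All of \<open>H\<close> gets coloured but only the rewards in \<open>P\<close> are counted, so
  that several parts of one \<open>H\<close> can be served as alternatives.\<close>

definition serves :: "real \<Rightarrow> real \<Rightarrow> 'a set \<Rightarrow> 'a set \<Rightarrow> 'a set \<Rightarrow> bool" where
  "serves \<kappa> \<delta> X H P \<longleftrightarrow> (\<exists>\<zeta> f. \<forall>\<phi> a b. col (X - H) L \<phi> \<longrightarrow> nonneg a \<longrightarrow> nonneg b \<longrightarrow>
     (\<exists>\<psi>. col X L \<psi> \<and> (\<forall>v\<in>X - H. \<psi> v = \<phi> v) \<and>
       \<kappa> * (\<Sum>v\<in>P. \<Sum>c\<in>open_cols (X - H) \<zeta> f \<phi> v. a v c) + \<delta> * (\<Sum>v\<in>P. \<Sum>d\<in>C. b v d)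
         \<le> (\<Sum>v\<in>P. payoff a b C v (\<psi> v))))"

lemma finite_L: "finite (L v)"
  using card_L[of v] card_ge_0_finite[of "L v"] by simp

text \<open>Greedy colouring: the condition says that \<open>v\<close> has at most two neighbours in
  \<open>U\<close> and outside \<open>R\<close> together, fewer than its three colours.\<close>

lemma extend_rest:
  assumes "finite X" "R \<subseteq> X" "col (X - R) L \<theta>"
    and "\<And>U. U \<subseteq> R \<Longrightarrow> U \<noteq> {} \<Longrightarrow> \<exists>v\<in>U. deg X v \<le> deg (R - U) v + 2"
  shows "\<exists>\<psi>. col X L \<psi> \<and> (\<forall>v\<in>X - R. \<psi> v = \<theta> v)"
proof -
  have fR: "finite R" using assms(1,2) finite_subset by blast
  have "colorable R (\<lambda>v. L v - \<theta> ` nbs (X - R) v)"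
  proof (rule colorable_degenerate[OF fR])
    fix U assume U: "U \<subseteq> R" "U \<noteq> {}"
    obtain v where v: "v \<in> U" "deg X v \<le> deg (R - U) v + 2" using assms(4)[OF U] by blast
    have "deg X v = deg U v + deg (R - U) v + deg (X - R) v"
      using deg_diff[OF assms(1,2), of v] deg_diff[OF fR U(1), of v] by simp
    moreover have "3 \<le> card (L v - \<theta> ` nbs (X - R) v) + deg (X - R) v"
      using card_diff_image_nbs[of "X - R" L v \<theta>] assms(1) card_L[of v] by simp
    ultimately have "deg U v < card (L v - \<theta> ` nbs (X - R) v)" using v(2) by linarith
    then show "\<exists>v\<in>U. deg U v < card (L v - \<theta> ` nbs (X - R) v)" using v(1) by blast
  qed
  from colorable_combine[OF assms(3) this] have
    "\<exists>\<psi>. col (X - R \<union> R) L \<psi> \<and> (\<forall>v\<in>X - R. \<psi> v = \<theta> v)" by blast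
  moreover have "X - R \<union> R = X" using assms(2) by blast
  ultimately show ?thesis by simp
qed

lemma extend_through:
  assumes X: "finite X" "H \<subseteq> X" "F \<subseteq> H"
    and R: "\<And>U. U \<subseteq> H - F \<Longrightarrow> U \<noteq> {} \<Longrightarrow> \<exists>v\<in>U. deg X v \<le> deg (H - F - U) v + 2"
    and \<phi>: "col (X - H) L \<phi>" and \<theta>: "col F (\<lambda>v. L v - \<phi> ` nbs (X - H) v) \<theta>"
  shows "\<exists>\<psi>. col X L \<psi> \<and> (\<forall>v\<in>X - H. \<psi> v = \<phi> v) \<and> (\<forall>v\<in>F. \<psi> v = \<theta> v)"
proof -
  have disj: "(X - H) \<inter> F = {}" using X(3) by blast
  let ?\<theta> = "\<lambda>v. if v \<in> F then \<theta> v else \<phi> v"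
  have eq: "(X - H) \<union> F = X - (H - F)" using X by blast
  have "col (X - (H - F)) L ?\<theta>" using col_combine[OF \<phi> \<theta> disj] unfolding eq .
  then obtain \<psi> where "col X L \<psi>" "\<forall>v\<in>X - (H - F). \<psi> v = ?\<theta> v"
    using extend_rest[OF X(1) _ _ R, of ?\<theta>] X(2) by blast
  moreover have "\<forall>v\<in>X - H. ?\<theta> v = \<phi> v" using disj by auto
  ultimately show ?thesis using X by (intro exI[of _ \<psi>]) auto
qed

text \<open>The forest itself gives 1/3 and 1/2; these are lowered to the constants of
  \<open>body_payoff\<close> so that parts of both kinds can be combined.\<close>

lemma serves_forest:
  assumes X: "finite X" "H \<subseteq> X" "F \<subseteq> H" and F: "forest F" "\<And>v. v \<in> F \<Longrightarrow> deg (X - H) v \<le> 1"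
    and R: "\<And>U. U \<subseteq> H - F \<Longrightarrow> U \<noteq> {} \<Longrightarrow> \<exists>v\<in>U. deg X v \<le> deg (H - F - U) v + 2"
  shows "serves (1/9210) (1/6140) X H F"
proof -
  \<comment> \<open>The outside neighbour of \<open>v\<close> blocks \<open>c\<close> by taking
    \<open>c\<close> itself. If there is none, the arbitrary value can only shrink
    \<open>open_cols\<close>.\<close>
  let ?z = "\<lambda>v (c::nat). SOME u. u \<in> nbs (X - H) v" and ?f = "\<lambda>(v::'a) (c::nat). c"
  have fF: "finite F" using X by (meson finite_subset)
  show ?thesis
    unfolding serves_def
  proof (intro exI[of _ ?z] exI[of _ ?f] allI impI)
    fix \<phi> and a b :: "'a \<Rightarrow> nat \<Rightarrow> real" assume \<phi>: "col (X - H) L \<phi>" and nn: "nonneg a" "nonneg b"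
    let ?M = "\<lambda>v. L v - \<phi> ` nbs (X - H) v"
    have "2 \<le> card (?M v) \<and> card (?M v) \<le> 3" if "v \<in> F" for v
      using card_diff_image_nbs[of "X - H" L v \<phi>] X(1) F(2)[OF that] card_L[of v]
        card_mono[OF finite_L[of v], of "?M v"] by auto
    from forest_payoff[where M = ?M, OF fF F(1) finC nn this] obtain \<theta> where \<theta>: "col F ?M \<theta>"
      "(\<Sum>v\<in>F. \<Sum>c\<in>?M v. a v c) / 3 + (\<Sum>v\<in>F. \<Sum>d\<in>C. b v d) / 2 \<le> (\<Sum>v\<in>F. payoff a b C v (\<theta> v))"
      by blast
    obtain \<psi> where \<psi>: "col X L \<psi>" "\<forall>v\<in>X - H. \<psi> v = \<phi> v" "\<forall>v\<in>F. \<psi> v = \<theta> v"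
      using extend_through[OF X R \<phi> \<theta>(1)] by blast
    have sub: "open_cols (X - H) ?z ?f \<phi> v \<subseteq> ?M v" if v: "v \<in> F" for v
    proof
      fix c assume c: "c \<in> open_cols (X - H) ?z ?f \<phi> v"
      have "c \<noteq> \<phi> u" if u: "u \<in> nbs (X - H) v" for u
      proof -
        have s: "?z v c \<in> nbs (X - H) v" using u by (rule someI)
        have "card (nbs (X - H) v) \<le> Suc 0" using F(2)[OF v] unfolding deg_def by simp
        then have "?z v c = u" using s u X(1) by (metis card_le_Suc0_iff_eq finite_Diff finite_nbs)
        moreover have "u \<in> X - H" using u unfolding nbs_def by blast
        ultimately show ?thesis using c unfolding open_cols_def by auto
      qed
      then show "c \<in> ?M v" using c unfolding open_cols_def by blast
    qed
    have "(\<Sum>v\<in>F. \<Sum>c\<in>open_cols (X - H) ?z ?f \<phi> v. a v c) \<le> (\<Sum>v\<in>F. \<Sum>c\<in>?M v. a v c)"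
      using sub nn(1) finite_L by (intro sum_mono sum_mono2) (auto simp: nonneg_def)
    moreover have "0 \<le> (\<Sum>v\<in>F. \<Sum>c\<in>?M v. a v c)" "0 \<le> (\<Sum>v\<in>F. \<Sum>d\<in>C. b v d)"
      using nn by (auto intro!: sum_nonneg simp: nonneg_def)
    moreover have "(\<Sum>v\<in>F. payoff a b C v (\<psi> v)) = (\<Sum>v\<in>F. payoff a b C v (\<theta> v))"
      using \<psi>(3) by (intro sum.cong) auto
    ultimately have "1/9210 * (\<Sum>v\<in>F. \<Sum>c\<in>open_cols (X - H) ?z ?f \<phi> v. a v c) + 1/6140 * (\<Sum>v\<in>F. \<Sum>d\<in>C. b v d)
         \<le> (\<Sum>v\<in>F. payoff a b C v (\<psi> v))" using \<theta>(2) by linarith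
    then show "\<exists>\<psi>. col X L \<psi> \<and> (\<forall>v\<in>X - H. \<psi> v = \<phi> v) \<and>
       1/9210 * (\<Sum>v\<in>F. \<Sum>c\<in>open_cols (X - H) ?z ?f \<phi> v. a v c) + 1/6140 * (\<Sum>v\<in>F. \<Sum>d\<in>C. b v d)
         \<le> (\<Sum>v\<in>F. payoff a b C v (\<psi> v))" using \<psi> by blast
  qed
qed

text \<open>All edges to the coloured outside start at \<open>y\<close>, so every request has the
  outside neighbour of \<open>y\<close> as its blocking vertex; the blocking colour comes from
  \<open>feas_threshold\<close>.\<close>

lemma serves_body:
  assumes X: "finite X" "H \<subseteq> X" "B \<subseteq> H" and B: "body adj B y w q L" and P: "P \<subseteq> B"
    and ext: "deg (X - H) y \<le> q" "\<And>v. v \<in> B \<Longrightarrow> v \<noteq> y \<Longrightarrow> nbs (X - H) v = {}"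
    and R: "\<And>U. U \<subseteq> H - B \<Longrightarrow> U \<noteq> {} \<Longrightarrow> \<exists>v\<in>U. deg X v \<le> deg (H - B - U) v + 2"
  shows "serves (1/9210) (1/6140) X H P"
proof -
  interpret b: body adj B y w q L by (rule B)
  obtain f where f: "\<And>v c \<Gamma>. v \<in> B \<Longrightarrow> c \<in> L v \<Longrightarrow> finite \<Gamma> \<Longrightarrow> card \<Gamma> \<le> q \<Longrightarrow> f v c \<notin> \<Gamma> \<Longrightarrow> c \<in> b.feas \<Gamma> v"
    using b.feas_threshold by metis
  let ?z = "\<lambda>(v::'a) (c::nat). SOME u. u \<in> nbs (X - H) y"
  show ?thesis
    unfolding serves_def
  proof (intro exI[of _ ?z] exI[of _ f] allI impI)
    fix \<phi> and a d :: "'a \<Rightarrow> nat \<Rightarrow> real" assume \<phi>: "col (X - H) L \<phi>" and nn: "nonneg a" "nonneg d"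
    let ?G = "\<phi> ` nbs (X - H) y"
    \<comment> \<open>Rewards outside \<open>P\<close> are switched off: around a hub,
      \<open>y\<close> lies in each of the sets \<open>B\<close> but is counted in the forest
      part.\<close>
    let ?a = "\<lambda>v c. if v \<in> P then a v c else 0" and ?d = "\<lambda>v c. if v \<in> P then d v c else 0"
    have nbfin: "finite (nbs (X - H) y)" using X(1) by (simp add: finite_nbs)
    have "card ?G \<le> deg (X - H) y" unfolding deg_def by (rule card_image_le[OF nbfin])
    then have G: "finite ?G" "card ?G \<le> q" using nbfin ext(1) by auto
    have nn': "nonneg ?a" "nonneg ?d" using nn unfolding nonneg_def by auto
    obtain \<theta> where \<theta>: "col B (b.LG ?G) \<theta>"
      "(\<Sum>v\<in>B. \<Sum>c\<in>b.feas ?G v. ?a v c) / 9210 + (\<Sum>v\<in>B. \<Sum>c\<in>C. ?d v c) / 6140 \<le> (\<Sum>v\<in>B. payoff ?a ?d C v (\<theta> v))"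
      using b.body_payoff[OF finC nn' G] by blast
    have "b.LG ?G v = L v - \<phi> ` nbs (X - H) v" if "v \<in> B" for v
      using ext(2)[OF that] unfolding b.LG_def by auto
    then have "col B (\<lambda>v. L v - \<phi> ` nbs (X - H) v) \<theta>" using \<theta>(1) unfolding col_def by blast
    then obtain \<psi> where \<psi>: "col X L \<psi>" "\<forall>v\<in>X - H. \<psi> v = \<phi> v" "\<forall>v\<in>B. \<psi> v = \<theta> v"
      using extend_through[OF X R \<phi>] by blast
    have sub: "open_cols (X - H) ?z f \<phi> v \<subseteq> b.feas ?G v" if v: "v \<in> B" for v
    proof
      fix c assume c: "c \<in> open_cols (X - H) ?z f \<phi> v"
      have "f v c \<noteq> \<phi> u" if u: "u \<in> nbs (X - H) y" for u
      proof -
        have s: "?z v c \<in> nbs (X - H) y" using u by (rule someI)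
        have "card (nbs (X - H) y) \<le> Suc 0" using ext(1) b.q unfolding deg_def by simp
        then have "?z v c = u" using s u nbfin by (metis card_le_Suc0_iff_eq)
        moreover have "u \<in> X - H" using u unfolding nbs_def by blast
        ultimately show ?thesis using c unfolding open_cols_def by auto
      qed
      then have "f v c \<notin> ?G" by blast
      then show "c \<in> b.feas ?G v" using f[OF v _ G] c unfolding open_cols_def by blast
    qed
    have restr: "(\<Sum>v\<in>B. h v) = (\<Sum>v\<in>P. h v)" if "\<And>v. v \<notin> P \<Longrightarrow> h v = 0" for h :: "'a \<Rightarrow> real"
      using that b.finB P by (intro sum.mono_neutral_right) auto
    have "(\<Sum>v\<in>P. \<Sum>c\<in>open_cols (X - H) ?z f \<phi> v. a v c) \<le> (\<Sum>v\<in>P. \<Sum>c\<in>b.feas ?G v. a v c)"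
      using sub nn(1) P b.card_feas(3)[OF G] by (intro sum_mono sum_mono2) (auto simp: nonneg_def)
    also have "\<dots> = (\<Sum>v\<in>P. \<Sum>c\<in>b.feas ?G v. ?a v c)" by (intro sum.cong) auto
    also have "\<dots> = (\<Sum>v\<in>B. \<Sum>c\<in>b.feas ?G v. ?a v c)" by (intro restr[symmetric]) simp
    finally have 1: "(\<Sum>v\<in>P. \<Sum>c\<in>open_cols (X - H) ?z f \<phi> v. a v c) \<le> (\<Sum>v\<in>B. \<Sum>c\<in>b.feas ?G v. ?a v c)" .
    have 2: "(\<Sum>v\<in>B. \<Sum>c\<in>C. ?d v c) = (\<Sum>v\<in>P. \<Sum>c\<in>C. d v c)"
      by (subst restr) (auto intro!: sum.cong)
    have 3: "(\<Sum>v\<in>B. payoff ?a ?d C v (\<theta> v)) = (\<Sum>v\<in>P. payoff a d C v (\<psi> v))"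
      using \<psi>(3) P by (subst restr) (auto intro!: sum.cong simp: payoff_def)
    show "\<exists>\<psi>. col X L \<psi> \<and> (\<forall>v\<in>X - H. \<psi> v = \<phi> v) \<and>
       1/9210 * (\<Sum>v\<in>P. \<Sum>c\<in>open_cols (X - H) ?z f \<phi> v. a v c) + 1/6140 * (\<Sum>v\<in>P. \<Sum>e\<in>C. d v e)
         \<le> (\<Sum>v\<in>P. payoff a d C v (\<psi> v))"
      using \<psi>(1,2) \<theta>(2) 1 2 3 by (intro exI[of _ \<psi>]) simp
  qed
qed

end

text \<open>The value \<open>k i\<close> is deposited at the pair of \<open>g i\<close> and
  \<open>h i\<close>; summed over a region of pairs, each \<open>i\<close> counts once. It serves
  for all deposits and for those actually gained.\<close>

lemma sum_fibres:
  fixes k :: "'i \<Rightarrow> real"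
  assumes "finite I" "finite Y" "\<And>z. z \<in> Y \<Longrightarrow> finite (D z)"
  shows "(\<Sum>z\<in>Y. \<Sum>d\<in>D z. \<Sum>i\<in>I. if g i = z \<and> h i = d then k i else 0)
    = (\<Sum>i\<in>I. if g i \<in> Y \<and> h i \<in> D (g i) then k i else 0)"
proof -
  have "(\<Sum>d\<in>D z. \<Sum>i\<in>I. if g i = z \<and> h i = d then k i else 0)
      = (\<Sum>i\<in>I. if z = g i then (if h i \<in> D z then k i else 0) else 0)" if z: "z \<in> Y" for z
  proof -
    have "(\<Sum>d\<in>D z. if g i = z \<and> h i = d then k i else 0)
        = (if z = g i then (if h i \<in> D z then k i else 0) else 0)" for i
      using assms(3)[OF z] by (cases "g i = z") auto
    then show ?thesis by (subst sum.swap) simp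
  qed
  then have "(\<Sum>z\<in>Y. \<Sum>d\<in>D z. \<Sum>i\<in>I. if g i = z \<and> h i = d then k i else 0)
      = (\<Sum>z\<in>Y. \<Sum>i\<in>I. if z = g i then (if h i \<in> D z then k i else 0) else 0)"
    by (rule sum.cong[OF refl])
  also have "\<dots> = (\<Sum>i\<in>I. \<Sum>z\<in>Y. if z = g i then (if h i \<in> D z then k i else 0) else 0)"
    by (rule sum.swap)
  also have "\<dots> = (\<Sum>i\<in>I. if g i \<in> Y \<and> h i \<in> D (g i) then k i else 0)"
    using assms(2) by (intro sum.cong refl) simp
  finally show ?thesis .
qed

section \<open>Combining parts, and induction over reducible sets\<close>

context list_graph begin

text \<open>Given the rewards, a part worth at least the average is served, which costs the factor
  3. The blocking pairs do not depend on this choice and are glued along the partition.\<close>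

lemma serves_union:
  assumes PP: "finite PP" "PP \<noteq> {}" "card PP \<le> 3" "\<Union>PP = H" "finite H"
    and disj: "\<And>P P'. P \<in> PP \<Longrightarrow> P' \<in> PP \<Longrightarrow> P \<noteq> P' \<Longrightarrow> P \<inter> P' = {}"
    and s: "\<And>P. P \<in> PP \<Longrightarrow> serves \<kappa> \<delta> X H P" and pos: "0 \<le> \<kappa>" "0 \<le> \<delta>"
  shows "serves (\<kappa> / 3) (\<delta> / 3) X H H"
proof -
  define Q where "Q P \<zeta> f \<longleftrightarrow> (\<forall>\<phi> a b. col (X - H) L \<phi> \<longrightarrow> nonneg a \<longrightarrow> nonneg b \<longrightarrow>
     (\<exists>\<psi>. col X L \<psi> \<and> (\<forall>v\<in>X - H. \<psi> v = \<phi> v) \<and>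
       \<kappa> * (\<Sum>v\<in>P. \<Sum>c\<in>open_cols (X - H) \<zeta> f \<phi> v. a v c) + \<delta> * (\<Sum>v\<in>P. \<Sum>d\<in>C. b v d)
         \<le> (\<Sum>v\<in>P. payoff a b C v (\<psi> v))))" for P \<zeta> f
  have "\<forall>P\<in>PP. \<exists>\<zeta> f. Q P \<zeta> f" using s unfolding serves_def Q_def by simp
  then obtain \<zeta> f where "\<forall>P\<in>PP. Q P (\<zeta> P) (f P)" by metis
  then have zf: "\<exists>\<psi>. col X L \<psi> \<and> (\<forall>v\<in>X - H. \<psi> v = \<phi> v) \<and>
       \<kappa> * (\<Sum>v\<in>P. \<Sum>c\<in>open_cols (X - H) (\<zeta> P) (f P) \<phi> v. a v c) + \<delta> * (\<Sum>v\<in>P. \<Sum>d\<in>C. b v d)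
         \<le> (\<Sum>v\<in>P. payoff a b C v (\<psi> v))"
    if "P \<in> PP" "col (X - H) L \<phi>" "nonneg a" "nonneg b" for P \<phi> and a b :: "'a \<Rightarrow> nat \<Rightarrow> real"
    using that unfolding Q_def by blast
  define part where "part v = (THE P. P \<in> PP \<and> v \<in> P)" for v
  have part: "part v = P" if "P \<in> PP" "v \<in> P" for v P
    unfolding part_def using that disj by (intro the_equality) blast+
  let ?z = "\<lambda>v. \<zeta> (part v) v" and ?f = "\<lambda>v. f (part v) v"
  show ?thesis
    unfolding serves_def
  proof (intro exI[of _ ?z] exI[of _ ?f] allI impI)
    fix \<phi> and a b :: "'a \<Rightarrow> nat \<Rightarrow> real" assume \<phi>: "col (X - H) L \<phi>" and nn: "nonneg a" "nonneg b"
    let ?t = "\<lambda>P. \<kappa> * (\<Sum>v\<in>P. \<Sum>c\<in>open_cols (X - H) ?z ?f \<phi> v. a v c) + \<delta> * (\<Sum>v\<in>P. \<Sum>d\<in>C. b v d)"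
    have fin: "finite P" if "P \<in> PP" for P using PP(4,5) that by (metis Union_upper finite_subset)
    have "(\<Sum>v\<in>H. h v) = (\<Sum>P\<in>PP. \<Sum>v\<in>P. h v)" for h :: "'a \<Rightarrow> real"
      unfolding PP(4)[symmetric] using fin disj by (subst sum.Union_disjoint) auto
    then have tot: "?t H = (\<Sum>P\<in>PP. ?t P)" by (simp only: sum.distrib sum_distrib_left)
    have "0 \<le> ?t H"
      using pos nn by (intro add_nonneg_nonneg mult_nonneg_nonneg sum_nonneg) (auto simp: nonneg_def)
    moreover have "real (card PP) \<le> 3" using PP(3) by simp
    ultimately have "real (card PP) * (?t H / 3) \<le> 3 * (?t H / 3)" by (intro mult_right_mono) auto
    then have "real (card PP) * (?t H / 3) \<le> (\<Sum>P\<in>PP. ?t P)" using tot by simp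
    then obtain P where P: "P \<in> PP" "?t H / 3 \<le> ?t P"
      using exists_ge_average[OF PP(1,2), of "?t H / 3" ?t] by blast
    obtain \<psi> where \<psi>: "col X L \<psi>" "\<forall>v\<in>X - H. \<psi> v = \<phi> v"
      "\<kappa> * (\<Sum>v\<in>P. \<Sum>c\<in>open_cols (X - H) (\<zeta> P) (f P) \<phi> v. a v c) + \<delta> * (\<Sum>v\<in>P. \<Sum>d\<in>C. b v d)
         \<le> (\<Sum>v\<in>P. payoff a b C v (\<psi> v))" using zf[OF P(1) \<phi> nn] by blast
    have "open_cols (X - H) ?z ?f \<phi> v = open_cols (X - H) (\<zeta> P) (f P) \<phi> v" if "v \<in> P" for v
      using part[OF P(1) that] unfolding open_cols_def by simp
    then have "?t P \<le> (\<Sum>v\<in>P. payoff a b C v (\<psi> v))" using \<psi>(3) by simp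
    also have "\<dots> \<le> (\<Sum>v\<in>H. payoff a b C v (\<psi> v))"
      using P(1) PP(4,5) payoff_nonneg[OF nn] by (intro sum_mono2) auto
    finally have "\<kappa> / 3 * (\<Sum>v\<in>H. \<Sum>c\<in>open_cols (X - H) ?z ?f \<phi> v. a v c) + \<delta> / 3 * (\<Sum>v\<in>H. \<Sum>d\<in>C. b v d)
         \<le> (\<Sum>v\<in>H. payoff a b C v (\<psi> v))" using P(2) by (simp add: add_divide_distrib)
    then show "\<exists>\<psi>. col X L \<psi> \<and> (\<forall>v\<in>X - H. \<psi> v = \<phi> v) \<and>
       \<kappa> / 3 * (\<Sum>v\<in>H. \<Sum>c\<in>open_cols (X - H) ?z ?f \<phi> v. a v c) + \<delta> / 3 * (\<Sum>v\<in>H. \<Sum>d\<in>C. b v d)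
         \<le> (\<Sum>v\<in>H. payoff a b C v (\<psi> v))" using \<psi>(1,2) by blast
  qed
qed

text \<open>A request that can be blocked is transferred to the blocking vertex as a reward for avoiding
  the blocking colour there.\<close>

lemma flexible_induct:
  assumes V: "finite V" and red: "\<And>X. X \<subseteq> V \<Longrightarrow> X \<noteq> {} \<Longrightarrow> \<exists>H\<subseteq>X. H \<noteq> {} \<and> serves \<kappa> \<delta> X H H"
    and k: "0 \<le> \<kappa>" "0 \<le> \<delta>" "\<delta> \<le> 1" and X: "X \<subseteq> V" and nn: "nonneg a" "nonneg b"
  shows "\<exists>\<phi>. col X L \<phi> \<and>
    \<kappa> * \<delta> * (\<Sum>v\<in>X. \<Sum>c\<in>L v. a v c) + \<delta> * (\<Sum>v\<in>X. \<Sum>d\<in>C. b v d) \<le> (\<Sum>v\<in>X. payoff a b C v (\<phi> v))"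
proof -
  have "finite X" using V X by (rule rev_finite_subset)
  then show ?thesis using X nn(2)
  proof (induction X arbitrary: b rule: finite_psubset_induct)
    case (psubset X)
    show ?case
    proof (cases "X = {}")
      case True
      then show ?thesis by (simp add: col_def)
    next
      case False
      obtain H where H: "H \<subseteq> X" "H \<noteq> {}" "serves \<kappa> \<delta> X H H"
        using red[OF psubset.prems(1) False] by blast
      let ?Y = "X - H"
      obtain \<zeta> f where s: "\<And>\<phi> a b. col ?Y L \<phi> \<Longrightarrow> nonneg a \<Longrightarrow> nonneg b \<Longrightarrow>
        (\<exists>\<psi>. col X L \<psi> \<and> (\<forall>v\<in>?Y. \<psi> v = \<phi> v) \<and>
          \<kappa> * (\<Sum>v\<in>H. \<Sum>c\<in>open_cols ?Y \<zeta> f \<phi> v. a v c) + \<delta> * (\<Sum>v\<in>H. \<Sum>d\<in>C. b v d)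
            \<le> (\<Sum>v\<in>H. payoff a b C v (\<psi> v)))"
        using H(3) unfolding serves_def by blast
      define I where "I = Sigma H L"
      define g where "g p = \<zeta> (fst p) (snd p)" for p
      define h where "h p = f (fst p) (snd p)" for p
      define k where "k p = \<kappa> * a (fst p) (snd p)" for p
      have fH: "finite H" using psubset.hyps H(1) finite_subset by blast
      have fI: "finite I" unfolding I_def using fH finite_L by blast
      have fY: "finite ?Y" using psubset.hyps by simp
      have kpos: "0 \<le> k p" for p unfolding k_def using assms(3) nn(1) by (simp add: nonneg_def)
      \<comment> \<open>Every request of \<open>H\<close> deposits its discounted value at its
        blocking pair; several requests may share a pair.\<close>
      define bb where "bb z d = (\<Sum>p\<in>I. if g p = z \<and> h p = d then k p else 0)" for z d
      define b' where "b' z d = b z d + bb z d" for z d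
      have nb': "nonneg b'"
        unfolding nonneg_def b'_def bb_def
        using psubset.prems(2) kpos by (auto intro!: add_nonneg_nonneg sum_nonneg simp: nonneg_def)
      obtain \<phi> where \<phi>: "col ?Y L \<phi>"
        "\<kappa> * \<delta> * (\<Sum>v\<in>?Y. \<Sum>c\<in>L v. a v c) + \<delta> * (\<Sum>v\<in>?Y. \<Sum>d\<in>C. b' v d) \<le> (\<Sum>v\<in>?Y. payoff a b' C v (\<phi> v))"
        using psubset.IH[of ?Y b'] psubset.prems(1) H nb' by blast
      obtain \<psi> where \<psi>: "col X L \<psi>" "\<forall>v\<in>?Y. \<psi> v = \<phi> v"
        "\<kappa> * (\<Sum>v\<in>H. \<Sum>c\<in>open_cols ?Y \<zeta> f \<phi> v. a v c) + \<delta> * (\<Sum>v\<in>H. \<Sum>d\<in>C. b v d)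
            \<le> (\<Sum>v\<in>H. payoff a b C v (\<psi> v))"
        using s[OF \<phi>(1) nn(1) psubset.prems(2)] by blast
      define total where "total = (\<Sum>p\<in>I. if g p \<in> ?Y \<and> h p \<in> C then k p else 0)"
      define gain where "gain = (\<Sum>p\<in>I. if g p \<in> ?Y \<and> h p \<in> C - {\<phi> (g p)} then k p else 0)"
      define opn where "opn = (\<Sum>p\<in>I. if g p \<in> ?Y \<longrightarrow> \<phi> (g p) \<noteq> h p then k p else 0)"
      have "(\<Sum>v\<in>?Y. \<Sum>d\<in>C. b' v d) = (\<Sum>v\<in>?Y. \<Sum>d\<in>C. b v d) + total"
        unfolding b'_def bb_def total_def sum.distrib sum_fibres[OF fI fY finC] ..
      moreover have "(\<Sum>v\<in>?Y. payoff a b' C v (\<phi> v)) = (\<Sum>v\<in>?Y. payoff a b C v (\<phi> v)) + gain"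
      proof -
        have "(\<Sum>v\<in>?Y. payoff a b' C v (\<phi> v)) = (\<Sum>v\<in>?Y. payoff a b C v (\<phi> v)) + (\<Sum>v\<in>?Y. \<Sum>d\<in>C - {\<phi> v}. bb v d)"
          unfolding payoff_def b'_def sum.distrib by simp
        also have "(\<Sum>v\<in>?Y. \<Sum>d\<in>C - {\<phi> v}. bb v d) = gain"
          unfolding bb_def gain_def using fI fY finC by (intro sum_fibres) auto
        finally show ?thesis .
      qed
      ultimately have ineq1: "\<kappa> * \<delta> * (\<Sum>v\<in>?Y. \<Sum>c\<in>L v. a v c) + \<delta> * (\<Sum>v\<in>?Y. \<Sum>d\<in>C. b v d) + \<delta> * total
          \<le> (\<Sum>v\<in>?Y. payoff a b C v (\<phi> v)) + gain"
        using \<phi>(2) by (simp add: distrib_left)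
      have opn: "\<kappa> * (\<Sum>v\<in>H. \<Sum>c\<in>open_cols ?Y \<zeta> f \<phi> v. a v c) = opn"
      proof -
        have "(\<Sum>c\<in>open_cols ?Y \<zeta> f \<phi> v. a v c) = (\<Sum>c\<in>L v. if \<zeta> v c \<in> ?Y \<longrightarrow> \<phi> (\<zeta> v c) \<noteq> f v c then a v c else 0)" for v
          unfolding open_cols_def using finite_L by (simp add: sum.inter_filter)
        then have "\<kappa> * (\<Sum>v\<in>H. \<Sum>c\<in>open_cols ?Y \<zeta> f \<phi> v. a v c)
            = (\<Sum>v\<in>H. \<Sum>c\<in>L v. if \<zeta> v c \<in> ?Y \<longrightarrow> \<phi> (\<zeta> v c) \<noteq> f v c then \<kappa> * a v c else 0)"
          by (simp add: sum_distrib_left if_distrib cong: if_cong)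
        also have "\<dots> = opn"
          unfolding opn_def I_def g_def h_def k_def
          by (subst sum.Sigma) (auto simp: fH finite_L intro!: sum.cong)
        finally show ?thesis .
      qed
      have all: "\<kappa> * (\<Sum>v\<in>H. \<Sum>c\<in>L v. a v c) = (\<Sum>p\<in>I. k p)"
        unfolding I_def k_def sum_distrib_left
        by (subst sum.Sigma) (auto simp: fH finite_L intro!: sum.cong)
      have "\<delta> * (\<Sum>p\<in>I. k p) \<le> \<delta> * total - gain + opn"
      proof -
        \<comment> \<open>A deposit is gained only when the blocking colour is avoided, and then the
          request is open, so \<open>opn\<close> makes up for the gain. If the blocking colour is
          taken, nothing is gained and the promised share \<open>\<delta> * k p\<close> is left
          over. In the remaining cases the request is open without any gain, and
          \<open>\<delta> \<le> 1\<close> suffices.\<close>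
        have "\<delta> * k p \<le> \<delta> * (if g p \<in> ?Y \<and> h p \<in> C then k p else 0)
            - (if g p \<in> ?Y \<and> h p \<in> C - {\<phi> (g p)} then k p else 0)
            + (if g p \<in> ?Y \<longrightarrow> \<phi> (g p) \<noteq> h p then k p else 0)" for p
        proof (cases "g p \<in> ?Y")
          case True
          then have "\<phi> (g p) \<in> C" using \<phi>(1) L_sub unfolding col_def by blast
          moreover have "\<delta> * k p \<le> k p" using mult_right_mono[OF assms(5) kpos[of p]] by simp
          ultimately show ?thesis using True by auto
        next
          case False
          then show ?thesis using mult_right_mono[OF assms(5) kpos[of p]] by auto
        qed
        then have "(\<Sum>p\<in>I. \<delta> * k p) \<le> (\<Sum>p\<in>I. \<delta> * (if g p \<in> ?Y \<and> h p \<in> C then k p else 0)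
            - (if g p \<in> ?Y \<and> h p \<in> C - {\<phi> (g p)} then k p else 0)
            + (if g p \<in> ?Y \<longrightarrow> \<phi> (g p) \<noteq> h p then k p else 0))" by (rule sum_mono)
        then show ?thesis
          unfolding total_def gain_def opn_def sum_distrib_left by (simp only: sum.distrib sum_subtractf)
      qed
      moreover have "(\<Sum>v\<in>?Y. payoff a b C v (\<phi> v)) = (\<Sum>v\<in>?Y. payoff a b C v (\<psi> v))"
        using \<psi>(2) by (intro sum.cong) auto
      moreover have split: "(\<Sum>v\<in>X. t v) = (\<Sum>v\<in>?Y. t v) + (\<Sum>v\<in>H. t v)" for t :: "'a \<Rightarrow> real"
        using psubset.hyps H(1) by (rule sum.subset_diff[rotated])
      ultimately have "\<kappa> * \<delta> * (\<Sum>v\<in>X. \<Sum>c\<in>L v. a v c) + \<delta> * (\<Sum>v\<in>X. \<Sum>d\<in>C. b v d)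
          \<le> (\<Sum>v\<in>X. payoff a b C v (\<psi> v))"
        using ineq1 \<psi>(3) unfolding opn all[symmetric] split by (simp add: algebra_simps)
      then show ?thesis using \<psi>(1) by blast
    qed
  qed
qed

end

context ugraph begin

section \<open>Components and shortest paths\<close>

definition component :: "'a set \<Rightarrow> 'a \<Rightarrow> 'a set" where
  "component R w = (\<Union>n. reach R w n)"

text \<open>Distance from \<open>w\<close> inside \<open>R\<close>; meaningful only on the component
  of \<open>w\<close>.\<close>

definition level :: "'a set \<Rightarrow> 'a \<Rightarrow> 'a \<Rightarrow> nat" where
  "level R w v = (LEAST n. v \<in> reach R w n)"

lemma component_root: "w \<in> component R w"
  unfolding component_def by (rule UN_I[of 0]) auto

lemma component_subset: "w \<in> R \<Longrightarrow> component R w \<subseteq> R"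
  unfolding component_def using reach_subset by blast

lemma component_closed:
  assumes "p \<in> component R w" "u \<in> R" "adj p u"
  shows "u \<in> component R w"
  using assms reach_step[of p R w _ u] unfolding component_def by blast

lemma component_meet:
  assumes "w \<in> R" "w' \<in> R" "x \<in> component R w" "x \<in> component R w'"
  shows "w' \<in> component R w"
proof -
  obtain m n where "x \<in> reach R w m" "x \<in> reach R w' n"
    using assms(3,4) unfolding component_def by blast
  then have "w' \<in> reach R w (m + n)" using reach_sym[OF assms(2)] reach_trans by blast
  then show ?thesis unfolding component_def by blast
qed

lemma component_conn:
  assumes "w \<in> R"
  shows "conn (component R w)"
  unfolding conn_def
proof (intro allI impI)
  fix P assume P: "P \<subseteq> component R w" "P \<noteq> {}" "P \<noteq> component R w"
  have grow: "component R w \<subseteq> Z" if Z: "w \<in> Z" "\<not> (\<exists>p\<in>Z. \<exists>q\<in>component R w - Z. adj p q)" for Z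
  proof -
    have "reach R w n \<subseteq> Z" for n
    proof (induction n)
      case (Suc n)
      show ?case
      proof
        fix u assume u: "u \<in> reach R w (Suc n)"
        show "u \<in> Z"
        proof (cases "u \<in> reach R w n")
          case True
          then show ?thesis using Suc.IH by blast
        next
          case False
          then obtain p where p: "p \<in> reach R w n" "adj p u" using u by auto
          have "u \<in> component R w" using u unfolding component_def by blast
          then show ?thesis using Z(2) p Suc.IH by blast
        qed
      qed
    qed (use Z(1) in simp)
    then show ?thesis unfolding component_def by blast
  qed
  show "\<exists>p\<in>P. \<exists>q\<in>component R w - P. adj p q"
  proof (rule ccontr)
    assume no: "\<not> ?thesis"
    show False
    proof (cases "w \<in> P")
      case True
      then show False using grow[OF True no] P by blast
    next
      case False
      have "\<not> (\<exists>p\<in>component R w - P. \<exists>q\<in>component R w - (component R w - P). adj p q)"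
        using no P(1) sym by blast
      then show False using grow[of "component R w - P"] component_root[of w R] False P(1,2) by blast
    qed
  qed
qed

lemma level_reach: "v \<in> component R w \<Longrightarrow> v \<in> reach R w (level R w v)"
  unfolding component_def level_def by (metis LeastI UN_E)

lemma level_le: "v \<in> reach R w n \<Longrightarrow> level R w v \<le> n"
  unfolding level_def by (rule Least_le)

lemma level_adj:
  assumes "w \<in> R" "u \<in> component R w" "v \<in> component R w" "adj u v"
  shows "level R w v \<le> Suc (level R w u)"
proof -
  have "v \<in> R" using assms(1,3) component_subset by blast
  from reach_step[OF level_reach[OF assms(2)] this assms(4)] show ?thesis by (rule level_le)
qed

lemma level_pred:
  assumes "w \<in> R" "v \<in> component R w" "level R w v = Suc n"
  obtains u where "u \<in> component R w" "adj u v" "level R w u = n"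
proof -
  have "v \<in> reach R w (Suc n)" using level_reach[OF assms(2)] assms(3) by simp
  moreover have "v \<notin> reach R w n" using level_le[of v R w n] assms(3) by auto
  ultimately obtain u where u: "u \<in> reach R w n" "adj u v" by auto
  have uc: "u \<in> component R w" using u(1) unfolding component_def by blast
  have "level R w u \<le> n" using level_le[OF u(1)] .
  moreover have "Suc n \<le> Suc (level R w u)" using level_adj[OF assms(1) uc assms(2) u(2)] assms(3) by simp
  ultimately show ?thesis using that uc u(2) by simp
qed

text \<open>A shortest path from \<open>x\<close> to \<open>w\<close>; it is induced because adjacent vertices have levels
  differing by at most one.\<close>

definition shortest_path :: "'a set \<Rightarrow> 'a \<Rightarrow> 'a \<Rightarrow> 'a set \<Rightarrow> bool" where
  "shortest_path R w x P \<longleftrightarrow> P \<subseteq> component R w \<and> x \<in> P \<and> w \<in> P \<and> inj_on (level R w) P \<and>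
     (\<forall>u\<in>P. level R w u \<le> level R w x) \<and>
     (\<forall>v\<in>P. v \<noteq> w \<longrightarrow> (\<exists>u\<in>P. adj v u \<and> level R w u < level R w v)) \<and>
     (\<forall>v\<in>P. v \<noteq> x \<longrightarrow> (\<exists>u\<in>P. adj v u \<and> level R w v < level R w u))"

lemma shortest_path_exists:
  assumes "w \<in> R" "x \<in> component R w"
  shows "\<exists>P. shortest_path R w x P"
  using assms(2)
proof (induction "level R w x" arbitrary: x)
  case 0
  then have "x = w" using level_reach[OF 0(2)] by simp
  then show ?case
    using component_root by (intro exI[of _ "{w}"]) (simp add: shortest_path_def)
next
  case (Suc n)
  obtain u where u: "u \<in> component R w" "adj u x" "level R w u = n"
    using level_pred[OF assms(1) Suc(3) Suc(2)[symmetric]] .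
  obtain P where P: "shortest_path R w u P" using Suc(1)[OF u(3)[symmetric] u(1)] by blast
  have lt: "level R w v < level R w x" if "v \<in> P" for v
    using P that u(3) Suc(2) unfolding shortest_path_def by fastforce
  show ?case
  proof (intro exI[of _ "insert x P"], unfold shortest_path_def, intro conjI ballI impI)
    show "insert x P \<subseteq> component R w" "x \<in> insert x P" "w \<in> insert x P"
      using P Suc(3) unfolding shortest_path_def by auto
    have "level R w v \<noteq> level R w x" if "v \<in> P" for v using lt[OF that] by simp
    then have "level R w x \<notin> level R w ` (P - {x})" by (metis DiffD1 imageE)
    then show "inj_on (level R w) (insert x P)"
      using P unfolding shortest_path_def by simp
    show "level R w v \<le> level R w x" if "v \<in> insert x P" for v
      using that lt[of v] by (cases "v = x") auto
    show "\<exists>t\<in>insert x P. adj v t \<and> level R w t < level R w v" if "v \<in> insert x P" "v \<noteq> w" for v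
    proof (cases "v = x")
      case True
      then show ?thesis using P u(2) sym lt unfolding shortest_path_def by blast
    next
      case False
      then show ?thesis using that P unfolding shortest_path_def by blast
    qed
    show "\<exists>t\<in>insert x P. adj v t \<and> level R w v < level R w t" if "v \<in> insert x P" "v \<noteq> x" for v
    proof (cases "v = u")
      case True
      then show ?thesis using that u(2) lt by blast
    next
      case False
      then show ?thesis using that P unfolding shortest_path_def by blast
    qed
  qed
qed

lemma shortest_path_finite:
  assumes "shortest_path R w x P" "finite R" "w \<in> R"
  shows "finite P"
  using assms component_subset[OF assms(3)] unfolding shortest_path_def by (meson finite_subset)

lemma shortest_path_up:
  assumes "w \<in> R" "shortest_path R w x P" "v \<in> P" "u \<in> P" "adj v u" "level R w v \<le> level R w u"
  shows "level R w u = Suc (level R w v)"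
proof -
  have "u \<noteq> v" using assms(5) irrefl by blast
  then have "level R w u \<noteq> level R w v"
    using assms(2-4) unfolding shortest_path_def inj_on_def by blast
  moreover have "level R w u \<le> Suc (level R w v)"
    using level_adj[OF assms(1) _ _ assms(5)] assms(2-4) unfolding shortest_path_def by blast
  ultimately show ?thesis using assms(6) by linarith
qed

text \<open>A lowest vertex of \<open>U\<close> has neighbours in \<open>U\<close> only one level
  higher, and the path has a single vertex on each level.\<close>

lemma shortest_path_forest:
  assumes "w \<in> R" "shortest_path R w x P" "finite P"
  shows "forest P"
  unfolding forest_def
proof (intro allI impI)
  fix U assume U: "U \<subseteq> P" "U \<noteq> {}"
  have fU: "finite U" by (rule finite_subset[OF U(1) assms(3)])
  obtain u0 where "u0 \<in> U" using U(2) by blast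
  then obtain v where v: "v \<in> U" "\<And>u. u \<in> U \<Longrightarrow> level R w v \<le> level R w u"
    using ex_has_least_nat[of "\<lambda>u. u \<in> U" u0 "level R w"] by blast
  have "card (nbs U v) \<le> Suc 0"
  proof (subst card_le_Suc0_iff_eq)
    show "finite (nbs U v)" by (rule finite_nbs[OF fU])
    show "\<forall>u\<in>nbs U v. \<forall>u'\<in>nbs U v. u = u'"
    proof (intro ballI)
      fix u u' assume "u \<in> nbs U v" "u' \<in> nbs U v"
      then have uu: "u \<in> U" "adj v u" "u' \<in> U" "adj v u'" by (simp_all add: mem_nbs)
      then have "level R w u = level R w u'"
        using shortest_path_up[OF assms(1,2)] v U(1) by (metis subsetD)
      then show "u = u'"
        using assms(2) uu(1,3) U(1) unfolding shortest_path_def inj_on_def by blast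
    qed
  qed
  then show "\<exists>v\<in>U. deg U v \<le> 1" using v(1) unfolding deg_def by auto
qed

lemma shortest_path_deg:
  assumes P: "shortest_path R w x P" "finite P" and v: "v \<in> P"
  shows "v \<noteq> w \<Longrightarrow> v \<noteq> x \<Longrightarrow> 2 \<le> deg P v" "v \<noteq> w \<or> v \<noteq> x \<Longrightarrow> 1 \<le> deg P v"
proof -
  have one: "1 \<le> deg P v" if "u \<in> P" "adj v u" for u
  proof -
    have "{u} \<subseteq> nbs P v" using that by (simp add: mem_nbs)
    then have "card {u} \<le> deg P v" unfolding deg_def by (intro card_mono finite_nbs[OF P(2)])
    then show ?thesis by simp
  qed
  then show "1 \<le> deg P v" if "v \<noteq> w \<or> v \<noteq> x"
    using that P(1) v unfolding shortest_path_def by blast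
  assume n: "v \<noteq> w" "v \<noteq> x"
  obtain t where t: "t \<in> P" "adj v t" "level R w t < level R w v"
    using P(1) v n(1) unfolding shortest_path_def by blast
  obtain u where u: "u \<in> P" "adj v u" "level R w v < level R w u"
    using P(1) v n(2) unfolding shortest_path_def by blast
  have "{t, u} \<subseteq> nbs P v" using t u by (simp add: mem_nbs)
  then have "card {t, u} \<le> deg P v" unfolding deg_def by (intro card_mono finite_nbs[OF P(2)])
  moreover have "t \<noteq> u" using t(3) u(3) by auto
  ultimately show "2 \<le> deg P v" by simp
qed

end

context list_graph begin

section \<open>Discharging\<close>

lemma serves_parts:
  assumes "finite PP" "PP \<noteq> {}" "card PP \<le> 3" "\<Union>PP = H" "finite H"
    and "\<And>P P'. P \<in> PP \<Longrightarrow> P' \<in> PP \<Longrightarrow> P \<noteq> P' \<Longrightarrow> P \<inter> P' = {}"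
    and "\<And>P. P \<in> PP \<Longrightarrow> serves (1/9210) (1/6140) X H P"
  shows "serves (1/27630) (1/18420) X H H"
  using serves_union[OF assms] by simp

lemma reducible_forest:
  assumes "finite X" "F \<subseteq> X" "forest F" "\<And>v. v \<in> F \<Longrightarrow> deg (X - F) v \<le> 1"
  shows "serves (1/27630) (1/18420) X F F"
proof (rule serves_parts[of "{F}"])
  show "finite F" using assms(1,2) by (rule rev_finite_subset)
  show "serves (1/9210) (1/6140) X F P" if "P \<in> {F}" for P
  proof -
    have "serves (1/9210) (1/6140) X F F"
      by (rule serves_forest) (use assms in auto)
    then show ?thesis using that by simp
  qed
qed auto

text \<open>A shortest path between the two vertices of low degree: inner vertices spend two of at
  most three edges on it, the ends one of at most two, so each has at most one neighbour
  outside.\<close>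

lemma reducible_path:
  assumes X: "finite X" and R: "R = {v \<in> X. deg X v \<le> 3}"
    and w: "w \<in> X" "deg X w \<le> 2" and x: "x \<in> component R w" "x \<noteq> w" "deg X x \<le> 2"
  shows "\<exists>H\<subseteq>X. H \<noteq> {} \<and> serves (1/27630) (1/18420) X H H"
proof -
  have wR: "w \<in> R" and RX: "R \<subseteq> X" using w R by auto
  have fR: "finite R" using RX X by (rule finite_subset)
  obtain P where P: "shortest_path R w x P" using shortest_path_exists[OF wR x(1)] by blast
  have fP: "finite P" by (rule shortest_path_finite[OF P fR wR])
  have PR: "P \<subseteq> R" using P component_subset[OF wR] unfolding shortest_path_def by blast
  have wP: "w \<in> P" using P unfolding shortest_path_def by blast
  have "deg (X - P) v \<le> 1" if v: "v \<in> P" for v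
  proof -
    have s: "deg X v = deg P v + deg (X - P) v" using deg_diff X PR RX by blast
    show ?thesis
    proof (cases "v = w \<or> v = x")
      case True
      then have "deg X v \<le> 2" using w x by blast
      moreover have "1 \<le> deg P v" using shortest_path_deg(2)[OF P fP v] True x(2) by blast
      ultimately show ?thesis using s by linarith
    next
      case False
      then have "2 \<le> deg P v" using shortest_path_deg(1)[OF P fP v] by blast
      moreover have "deg X v \<le> 3" using v PR R by blast
      ultimately show ?thesis using s by linarith
    qed
  qed
  from reducible_forest[OF X _ shortest_path_forest[OF wR P fP] this] PR RX wP
  show ?thesis by blast
qed

text \<open>The component is a \<open>body\<close> with \<open>q\<close> the number of edges leaving
  it at \<open>y\<close>. Irreducible graphs therefore have at least two edges leaving each
  component with such a \<open>w\<close>.\<close>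

lemma reducible_pendant:
  assumes X: "finite X" and R: "R = {v \<in> X. deg X v \<le> 3}" and w: "w \<in> X" "deg X w \<le> 2"
    and y: "y \<in> component R w" "deg (X - component R w) y \<le> 1"
      "\<And>v. v \<in> component R w \<Longrightarrow> v \<noteq> y \<Longrightarrow> nbs (X - component R w) v = {}"
  shows "serves (1/27630) (1/18420) X (component R w) (component R w)"
proof -
  let ?B = "component R w"
  have wR: "w \<in> R" and RX: "R \<subseteq> X" using w R by auto
  have BR: "?B \<subseteq> R" by (rule component_subset[OF wR])
  have fB: "finite ?B" using BR RX X by (meson finite_subset)
  have d: "deg ?B v + (if v = y then deg (X - ?B) y else 0) = deg X v" if "v \<in> ?B" for v
    using deg_diff[OF X, of ?B v] BR RX y(3)[OF that] by (auto simp: deg_def)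
  have "body adj ?B y w (deg (X - ?B) y) L"
  proof
    show "conn ?B" by (rule component_conn[OF wR])
    show "w \<in> ?B" by (rule component_root)
    show "deg ?B v + (if v = y then deg (X - ?B) y else 0) \<le> 3" if "v \<in> ?B" for v
      using d[OF that] that BR R by auto
    show "deg ?B w + (if w = y then deg (X - ?B) y else 0) \<le> 2"
      using d[OF component_root] w(2) by simp
  qed (use y fB card_L in auto)
  from serves_body[OF X _ _ this, of ?B ?B] y(3) BR RX
  have s: "serves (1/9210) (1/6140) X ?B ?B" by blast
  show ?thesis by (rule serves_parts[of "{?B}"]) (use s fB in auto)
qed

lemma conn_insert:
  assumes "conn P" "P \<noteq> {}" "p \<in> P" "adj y p"
  shows "conn (insert y P)"
  unfolding conn_def
proof (intro allI impI)
  fix U assume U: "U \<subseteq> insert y P" "U \<noteq> {}" "U \<noteq> insert y P"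
  show "\<exists>u\<in>U. \<exists>v\<in>insert y P - U. adj u v"
  proof (cases "U \<inter> P = {} \<or> P \<subseteq> U")
    case True
    then show ?thesis using U assms(2-4) sym by blast
  next
    case False
    then obtain u v where "u \<in> U \<inter> P" "v \<in> P - U \<inter> P" "adj u v"
      using assms(1) unfolding conn_def by (metis inf_le2 inf_commute le_iff_inf)
    then show ?thesis by blast
  qed
qed

text \<open>The vertex \<open>y\<close> together with shortest paths to the vertices of degree two in \<open>A\<close> and the whole
  components of those in \<open>D\<close>, which are attached to \<open>y\<close> only.\<close>

lemma reducible_hub:
  assumes X: "finite X" and R: "R = {v \<in> X. deg X v \<le> 3}" and y: "y \<in> X" "4 \<le> deg X y"
    and AD: "finite A" "finite D" "A \<inter> D = {}" "\<And>w. w \<in> A \<union> D \<Longrightarrow> w \<in> X \<and> deg X w = 2"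
    and disj: "\<And>w w'. w \<in> A \<union> D \<Longrightarrow> w' \<in> A \<union> D \<Longrightarrow> w \<noteq> w' \<Longrightarrow> component R w \<inter> component R w' = {}"
    and A: "\<And>w. w \<in> A \<Longrightarrow> nbs (component R w) y \<noteq> {}"
    and D: "\<And>w. w \<in> D \<Longrightarrow> 2 \<le> deg (component R w) y"
      "\<And>w v. w \<in> D \<Longrightarrow> v \<in> component R w \<Longrightarrow> nbs (X - R) v \<subseteq> {y}"
    and count: "2 * deg X y \<le> card A + 2 * card D + 5"
  shows "\<exists>H\<subseteq>X. H \<noteq> {} \<and> serves (1/27630) (1/18420) X H H"
proof -
  let ?I = "A \<union> D"
  have RX: "R \<subseteq> X" and yR: "y \<notin> R" using R y by auto
  have fR: "finite R" using RX X by (rule finite_subset)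
  have IR: "w \<in> R" if "w \<in> ?I" for w using AD(4)[OF that] R by auto
  have cR: "component R w \<subseteq> R" if "w \<in> ?I" for w using component_subset[OF IR[OF that]] .
  have d3: "deg X v \<le> 3" if "v \<in> R" for v using that R by blast
  \<comment> \<open>The path is aimed at a neighbour of \<open>y\<close> closest to
    \<open>w\<close>, so that \<open>y\<close> has no other neighbour on it.\<close>
  have "\<exists>x. x \<in> nbs (component R w) y \<and> (\<forall>u. u \<in> nbs (component R w) y \<longrightarrow> level R w x \<le> level R w u)"
    if w: "w \<in> A" for w
  proof -
    obtain x0 where "x0 \<in> nbs (component R w) y" using A[OF w] by blast
    then show ?thesis using ex_has_least_nat[of "\<lambda>u. u \<in> nbs (component R w) y" x0 "level R w"] by blast
  qed
  then obtain x where x: "\<And>w. w \<in> A \<Longrightarrow> x w \<in> nbs (component R w) y"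
    "\<And>w u. w \<in> A \<Longrightarrow> u \<in> nbs (component R w) y \<Longrightarrow> level R w (x w) \<le> level R w u" by metis
  have "\<exists>P. shortest_path R w (x w) P" if "w \<in> A" for w
    using shortest_path_exists[of w R "x w"] IR[of w] x(1)[OF that] that by (simp add: mem_nbs)
  then obtain P where P: "\<And>w. w \<in> A \<Longrightarrow> shortest_path R w (x w) (P w)" by metis
  define S where "S w = (if w \<in> A then P w else component R w)" for w
  have S: "S w \<subseteq> component R w" "w \<in> S w" if "w \<in> ?I" for w
    using P[of w] component_root[of w R] unfolding S_def shortest_path_def by auto
  have SR: "S w \<subseteq> R" if "w \<in> ?I" for w using S(1)[OF that] cR[OF that] by blast
  have fS: "finite (S w)" if "w \<in> ?I" for w using SR[OF that] fR by (rule finite_subset)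
  have same: "w = w'" if "w \<in> ?I" "w' \<in> ?I" "u \<in> component R w" "v \<in> component R w'" "u = v \<or> adj u v"
    for w w' u v
  proof -
    have "v \<in> R" using cR[OF that(2)] that(4) by blast
    then have "v \<in> component R w" using component_closed[OF that(3)] that(3,5) by blast
    then show ?thesis using disj[OF that(1,2)] that(4) by blast
  qed
  define F where "F = insert y (\<Union>w\<in>A. P w)"
  define H where "H = insert y (\<Union>w\<in>?I. S w)"
  have SP: "S w = P w" if "w \<in> A" for w using that unfolding S_def by simp
  have SC: "S w = component R w" if "w \<in> D" for w using that AD(3) unfolding S_def by auto
  have yS: "y \<notin> S w" if "w \<in> ?I" for w using SR[OF that] yR by blast
  have HX: "H \<subseteq> X" unfolding H_def using SR RX y(1) by blast
  have fH: "finite H" using HX X by (rule finite_subset)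
  have FH: "F \<subseteq> H" unfolding F_def H_def using SP by auto
  have HF: "H - F = (\<Union>w\<in>D. S w)"
  proof -
    have dis: "S w \<inter> P w' = {}" if "w \<in> D" "w' \<in> A" for w w'
    proof -
      have "w \<noteq> w'" using that AD(3) by blast
      then show ?thesis using same[of w w'] S(1)[of w] S(1)[of w'] SP[of w'] that by blast
    qed
    show ?thesis
    proof (intro equalityI subsetI)
      fix v assume v: "v \<in> H - F"
      then obtain w where w: "w \<in> ?I" "v \<in> S w" unfolding H_def F_def by blast
      then have "w \<notin> A" using v SP[of w] unfolding F_def by auto
      then show "v \<in> (\<Union>w\<in>D. S w)" using w by blast
    next
      fix v assume "v \<in> (\<Union>w\<in>D. S w)"
      then obtain w where w: "w \<in> D" "v \<in> S w" by blast
      have "v \<noteq> y" using yS[of w] w by blast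
      moreover have "v \<notin> P w'" if "w' \<in> A" for w' using dis[OF w(1) that] w(2) by blast
      ultimately show "v \<in> H - F" using w unfolding H_def F_def by blast
    qed
  qed
  have HB: "H - insert y (S w0) = (\<Union>w\<in>?I - {w0}. S w)" if w0: "w0 \<in> ?I" for w0
  proof -
    have "S w \<inter> S w0 = {}" if "w \<in> ?I" "w \<noteq> w0" for w
      using same[of w w0] S(1)[OF that(1)] S(1)[OF w0] that w0 by blast
    then have dis: "v \<notin> S w0" if "w \<in> ?I" "w \<noteq> w0" "v \<in> S w" for v w using that by blast
    show ?thesis
    proof (intro equalityI subsetI)
      fix v assume "v \<in> H - insert y (S w0)"
      then show "v \<in> (\<Union>w\<in>?I - {w0}. S w)" unfolding H_def by blast
    next
      fix v assume "v \<in> (\<Union>w\<in>?I - {w0}. S w)"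
      then obtain w where w: "w \<in> ?I" "w \<noteq> w0" "v \<in> S w" by blast
      then show "v \<in> H - insert y (S w0)" using dis[OF w] yS[OF w(1)] unfolding H_def by blast
    qed
  qed
  \<comment> \<open>Each \<open>S w\<close> can be coloured greedily towards \<open>w\<close>, which
    comes last and has degree two. This completes the parts that are not being served.\<close>
  have rooted: "\<exists>p\<in>U \<inter> S w. \<exists>r\<in>S w - U. adj p r" if w: "w \<in> ?I" and U: "U \<inter> S w \<noteq> {}" "w \<notin> U" for w U
  proof (cases "w \<in> A")
    case True
    obtain u0 where "u0 \<in> U \<inter> S w" using U(1) by blast
    then obtain p where p: "p \<in> U \<inter> S w" "\<And>u. u \<in> U \<inter> S w \<Longrightarrow> level R w p \<le> level R w u"
      using ex_has_least_nat[of "\<lambda>u. u \<in> U \<inter> S w" u0 "level R w"] by blast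
    have "p \<noteq> w" "p \<in> P w" using p(1) U(2) SP[OF True] by auto
    then obtain r where r: "r \<in> P w" "adj p r" "level R w r < level R w p"
      using P[OF True] unfolding shortest_path_def by blast
    have "r \<notin> U" using p(2)[of r] r SP[OF True] by auto
    then show ?thesis using p(1) r(1,2) SP[OF True] by blast
  next
    case False
    then have C: "S w = component R w" unfolding S_def by simp
    have "U \<inter> S w \<noteq> component R w" using U(2) S(2)[OF w] C by blast
    from connD[OF component_conn[OF IR[OF w]] _ U(1) this] C show ?thesis
      by (metis Diff_iff IntI inf_le2)
  qed
  have rest: "\<exists>v\<in>U. deg X v \<le> deg ((\<Union>w\<in>J. S w) - U) v + 2"
    if J: "J \<subseteq> ?I" and U: "U \<subseteq> (\<Union>w\<in>J. S w)" "U \<noteq> {}" for J U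
  proof -
    obtain w where w: "w \<in> J" "U \<inter> S w \<noteq> {}" using U by blast
    have wI: "w \<in> ?I" using w(1) J by blast
    show ?thesis
    proof (cases "w \<in> U")
      case True
      then show ?thesis using AD(4)[OF wI] by (intro bexI[of _ w]) auto
    next
      case False
      obtain p r where pr: "p \<in> U \<inter> S w" "r \<in> S w - U" "adj p r" using rooted[OF wI w(2) False] by blast
      have "(\<Union>w\<in>J. S w) \<subseteq> H" unfolding H_def using J by blast
      then have "finite (nbs ((\<Union>w\<in>J. S w) - U) p)" using fH by (meson finite_Diff finite_nbs finite_subset)
      moreover have "r \<in> nbs ((\<Union>w\<in>J. S w) - U) p" using pr w(1) by (auto simp: mem_nbs)
      ultimately have "0 < deg ((\<Union>w\<in>J. S w) - U) p" unfolding deg_def using card_gt_0_iff by blast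
      moreover have "deg X p \<le> 3" using pr(1) SR[OF wI] d3 by blast
      ultimately show ?thesis using pr(1) by (intro bexI[of _ p]) auto
    qed
  qed
  define e where "e = deg (X - H) y"
  have degH: "deg H y = (\<Sum>w\<in>?I. deg (S w) y)"
  proof -
    have "nbs H y = (\<Union>w\<in>?I. nbs (S w) y)" unfolding H_def using irrefl by (auto simp: mem_nbs)
    moreover have "card \<dots> = (\<Sum>w\<in>?I. card (nbs (S w) y))"
    proof (rule card_UN_disjoint)
      show "finite ?I" using AD by blast
      show "\<forall>w\<in>?I. finite (nbs (S w) y)" using fS finite_nbs by blast
      show "\<forall>w\<in>?I. \<forall>w'\<in>?I. w \<noteq> w' \<longrightarrow> nbs (S w) y \<inter> nbs (S w') y = {}"
        using S(1) disj unfolding nbs_def by blast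
    qed
    ultimately show ?thesis unfolding deg_def by simp
  qed
  have xP: "x w \<in> P w" "adj y (x w)" if "w \<in> A" for w
    using P[OF that] x(1)[OF that] unfolding shortest_path_def by (auto simp: mem_nbs)
  have "(\<Sum>w\<in>A. 1) \<le> (\<Sum>w\<in>A. deg (S w) y)"
  proof (rule sum_mono)
    fix w assume w: "w \<in> A"
    have "x w \<in> nbs (S w) y" using xP[OF w] SP[OF w] by (simp add: mem_nbs)
    moreover have "finite (nbs (S w) y)" using fS[of w] w finite_nbs by blast
    ultimately have "0 < deg (S w) y" unfolding deg_def using card_gt_0_iff by blast
    then show "1 \<le> deg (S w) y" by simp
  qed
  moreover have "(\<Sum>w\<in>?I. deg (S w) y) = (\<Sum>w\<in>A. deg (S w) y) + (\<Sum>w\<in>D. deg (S w) y)"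
    by (rule sum.union_disjoint[OF AD(1-3)])
  moreover have "deg X y = deg H y + e" unfolding e_def by (rule deg_diff[OF X HX])
  ultimately have total: "e + card A + (\<Sum>w\<in>D. deg (S w) y) \<le> deg X y" using degH by simp
  have D2: "2 \<le> deg (S w) y" if "w \<in> D" for w using D(1)[OF that] SC[OF that] by simp
  have "(\<Sum>w\<in>D. 2) \<le> (\<Sum>w\<in>D. deg (S w) y)" using D2 by (rule sum_mono)
  then have sum2: "2 * card D \<le> (\<Sum>w\<in>D. deg (S w) y)" by simp
  \<comment> \<open>Together \<open>total\<close>, \<open>sum2\<close> and \<open>count\<close> give
    \<open>deg X y + e \<le> 5\<close>, while the degree is at least four. In \<open>e3\<close> the
    edges beyond two from \<open>y\<close> to one \<open>S w\<close> are counted as well, giving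
    \<open>deg (S w) y + e \<le> 7 - deg X y\<close>.\<close>
  have e1: "e \<le> 1" using total sum2 count y(2) by linarith
  have cD: "card D \<le> 2" using total sum2 count by linarith
  have e3: "deg (S w) y + e \<le> 3" if w: "w \<in> D" for w
  proof -
    have "(\<Sum>w\<in>D - {w}. 2) \<le> (\<Sum>w\<in>D - {w}. deg (S w) y)" using D2 by (intro sum_mono) blast
    moreover have "(\<Sum>w\<in>D. deg (S w) y) = deg (S w) y + (\<Sum>w\<in>D - {w}. deg (S w) y)"
      by (rule sum.remove[OF AD(2) w])
    moreover have "card D = Suc (card (D - {w}))" using card.remove[OF AD(2) w] .
    ultimately have "deg (S w) y + 2 * card D \<le> (\<Sum>w\<in>D. deg (S w) y) + 2" by simp
    then show ?thesis using total count y(2) by linarith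
  qed
  have pathP: "shortest_path R w (x w) (S w)" if "w \<in> A" for w using P[OF that] SP[OF that] by simp
  have adjx: "v = x w" if w: "w \<in> A" "v \<in> S w" "adj v y" for w v
  proof -
    have vc: "v \<in> component R w" using S(1)[of w] w by blast
    have "level R w (x w) \<le> level R w v" using x(2)[OF w(1), of v] vc sym[OF w(3)] by (simp add: mem_nbs)
    moreover have "level R w v \<le> level R w (x w)" "inj_on (level R w) (S w)" "x w \<in> S w"
      using pathP[OF w(1)] w(2) unfolding shortest_path_def by blast+
    ultimately show ?thesis using w(2) by (meson inj_onD le_antisym)
  qed
  have forestF: "forest F"
    unfolding forest_def
  proof (intro allI impI)
    fix U assume U: "U \<subseteq> F" "U \<noteq> {}"
    have fU: "finite U" using U(1) FH fH by (meson finite_subset)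
    show "\<exists>v\<in>U. deg U v \<le> 1"
    proof (cases "\<exists>w\<in>A. U \<inter> S w \<noteq> {}")
      case False
      then have "U = {y}" using U SP unfolding F_def by blast
      then show ?thesis by (simp add: deg_singleton irrefl)
    next
      case True
      then obtain w u0 where w: "w \<in> A" "u0 \<in> U \<inter> S w" by blast
      then obtain v where v: "v \<in> U \<inter> S w" "\<And>u. u \<in> U \<inter> S w \<Longrightarrow> level R w v \<le> level R w u"
        using ex_has_least_nat[of "\<lambda>u. u \<in> U \<inter> S w" u0 "level R w"] by blast
      have wI: "w \<in> ?I" using w(1) by blast
      have wR: "w \<in> R" by (rule IR[OF wI])
      \<comment> \<open>\<open>v\<close> is a lowest vertex of \<open>U\<close> on its path: a
        neighbour in \<open>U\<close> is the path vertex one level up, or it is \<open>y\<close>,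
        which only the top vertex \<open>x w\<close> sees.\<close>
      have nb: "u = y \<and> v = x w \<or> u \<in> S w \<and> level R w u = Suc (level R w v)" if u: "u \<in> U" "adj v u" for u
      proof (cases "u = y")
        case True
        then show ?thesis using adjx[OF w(1)] v(1) u(2) by blast
      next
        case False
        then obtain w' where w': "w' \<in> A" "u \<in> S w'" using u(1) U(1) SP unfolding F_def by blast
        have "w = w'" using same[of w w' v u] S(1)[OF wI] S(1)[of w'] v(1) w' wI u(2) by blast
        then have "u \<in> U \<inter> S w" using w'(2) u(1) by blast
        then show ?thesis using shortest_path_up[OF wR pathP[OF w(1)], of v u] v u(2) by blast
      qed
      have top: "level R w u \<le> level R w (x w)" if "u \<in> S w" for u
        using pathP[OF w(1)] that unfolding shortest_path_def by blast
      have inj: "inj_on (level R w) (S w)" using pathP[OF w(1)] unfolding shortest_path_def by blast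
      have "card (nbs U v) \<le> Suc 0"
      proof (subst card_le_Suc0_iff_eq)
        show "finite (nbs U v)" by (rule finite_nbs[OF fU])
        show "\<forall>u\<in>nbs U v. \<forall>u'\<in>nbs U v. u = u'"
        proof (intro ballI)
          fix u u' assume "u \<in> nbs U v" "u' \<in> nbs U v"
          then have c: "u = y \<and> v = x w \<or> u \<in> S w \<and> level R w u = Suc (level R w v)"
            "u' = y \<and> v = x w \<or> u' \<in> S w \<and> level R w u' = Suc (level R w v)"
            using nb by (simp_all add: mem_nbs)
          show "u = u'"
          proof (cases "v = x w")
            case True
            then show ?thesis using c top[of u] top[of u'] by auto
          next
            case False
            then show ?thesis using c inj by (metis inj_onD)
          qed
        qed
      qed
      then show ?thesis using v(1) unfolding deg_def by auto
    qed
  qed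
  have extF: "deg (X - H) v \<le> 1" if v: "v \<in> F" for v
  proof (cases "v = y")
    case True
    then show ?thesis using e1 unfolding e_def by simp
  next
    case False
    then obtain w where w: "w \<in> A" "v \<in> S w" using v SP unfolding F_def by blast
    have wI: "w \<in> ?I" using w(1) by blast
    have SH: "insert y (S w) \<subseteq> H" unfolding H_def using wI by blast
    have dH: "deg X v = deg H v + deg (X - H) v" by (rule deg_diff[OF X HX])
    have "deg (insert y (S w)) v \<le> deg H v" by (rule deg_mono[OF fH SH])
    moreover have "deg (insert y (S w)) v = deg (S w) v + deg {y} v"
      using deg_Un[OF fS[OF wI], of "{y}" v] yS[OF wI] by simp
    ultimately have dS: "deg (S w) v + deg {y} v \<le> deg H v" by simp
    \<comment> \<open>At the top of the path the edge to \<open>y\<close> replaces the missing upper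
      neighbour.\<close>
    have vx: "deg {y} v = 1" if "v = x w" using sym[OF xP(2)[OF w(1)]] that by (simp add: deg_singleton)
    note sd = shortest_path_deg[OF pathP[OF w(1)] fS[OF wI] w(2)]
    show ?thesis
    proof (cases "v = w")
      case True
      then have "1 \<le> deg H v" using dS vx sd(2) by (cases "v = x w") auto
      then show ?thesis using dH AD(4)[OF wI] True by simp
    next
      case False
      then have "2 \<le> deg H v" using dS vx sd by (cases "v = x w") auto
      moreover have "deg X v \<le> 3" using d3 SR[OF wI] w(2) by blast
      ultimately show ?thesis using dH by linarith
    qed
  qed
  have sF: "serves (1/9210) (1/6140) X H F"
  proof (rule serves_forest[OF X HX FH forestF extF])
    fix U assume "U \<subseteq> H - F" "U \<noteq> {}"
    then show "\<exists>v\<in>U. deg X v \<le> deg (H - F - U) v + 2"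
      using rest[of D U] unfolding HF by blast
  qed
  \<comment> \<open>The other parts are coloured after \<open>insert y (S w)\<close>, so only the
    \<open>e\<close> edges from \<open>y\<close> out of \<open>H\<close> lead to coloured
    vertices.\<close>
  have sD: "serves (1/9210) (1/6140) X H (S w)" if w: "w \<in> D" for w
  proof (rule serves_body[where B = "insert y (S w)" and y = y and w = w and q = e])
    have wI: "w \<in> ?I" using w by blast
    have c: "S w = component R w" by (rule SC[OF w])
    let ?B = "insert y (S w)"
    show "finite X" "H \<subseteq> X" "?B \<subseteq> H" "S w \<subseteq> ?B" using X HX wI unfolding H_def by blast+
    then have BX: "?B \<subseteq> X" by blast
    obtain p where p: "p \<in> S w" "adj y p"
      using D2[OF w] unfolding deg_def nbs_def by (metis (mono_tags, lifting) card.empty ex_in_conv mem_Collect_eq not_numeral_le_zero)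
    have le: "deg ?B v \<le> deg X v" for v by (rule deg_mono[OF X BX])
    have By: "deg ?B y = deg (S w) y"
      using deg_Un[OF fS[OF wI], of "{y}" y] yS[OF wI] by (simp add: deg_singleton irrefl)
    show "body adj ?B y w e L"
    proof
      show "finite ?B" using fS[OF wI] by simp
      show "conn ?B"
        using conn_insert[of "S w" p y] component_conn[OF IR[OF wI]] p c by auto
      show "w \<in> ?B" using S(2)[OF wI] by blast
      show "deg ?B v + (if v = y then e else 0) \<le> 3" if "v \<in> ?B" for v
      proof (cases "v = y")
        case True
        then show ?thesis using By e3[OF w] by simp
      next
        case False
        then show ?thesis using that le[of v] d3[of v] SR[OF wI] by fastforce
      qed
      show "deg ?B w + (if w = y then e else 0) \<le> 2"
        using le[of w] AD(4)[OF wI] yS[OF wI] S(2)[OF wI] by auto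
    qed (use e1 card_L in auto)
    show "deg (X - H) y \<le> e" unfolding e_def by simp
    show "nbs (X - H) v = {}" if v: "v \<in> ?B" "v \<noteq> y" for v
    proof (rule ccontr)
      assume "nbs (X - H) v \<noteq> {}"
      then obtain u where "u \<in> nbs (X - H) v" by blast
      then have u: "u \<in> X - H" "adj v u" by (simp_all add: mem_nbs)
      have vc: "v \<in> component R w" using v c by blast
      have "u \<in> R \<Longrightarrow> u \<in> S w" using component_closed[OF vc _ u(2)] c by blast
      moreover have "u \<notin> R \<Longrightarrow> u = y" using D(2)[OF w vc] u by (auto simp: mem_nbs)
      ultimately have "u \<in> H" unfolding H_def using wI by blast
      then show False using u(1) by blast
    qed
    fix U assume "U \<subseteq> H - ?B" "U \<noteq> {}"
    then show "\<exists>v\<in>U. deg X v \<le> deg (H - ?B - U) v + 2"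
      using rest[of "?I - {w}" U] unfolding HB[OF wI] by blast
  qed
  have "serves (1/27630) (1/18420) X H H"
  proof (rule serves_parts[of "insert F (S ` D)"])
    show "finite (insert F (S ` D))" "insert F (S ` D) \<noteq> {}" using AD(2) by auto
    have "card (insert F (S ` D)) \<le> Suc (card (S ` D))" by (rule card_insert_le_m1) simp_all
    also have "card (S ` D) \<le> card D" by (rule card_image_le[OF AD(2)])
    finally show "card (insert F (S ` D)) \<le> 3" using cD by simp
    have "H = F \<union> (\<Union>w\<in>D. S w)" using HF FH by blast
    then show "\<Union>(insert F (S ` D)) = H" by simp
    show "finite H" by (rule fH)
    show "Q \<inter> Q' = {}" if Q: "Q \<in> insert F (S ` D)" "Q' \<in> insert F (S ` D)" "Q \<noteq> Q'" for Q Q'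
    proof -
      have FS: "F \<inter> S w = {}" if "w \<in> D" for w using HF that by blast
      have SS: "S w \<inter> S w' = {}" if "w \<in> D" "w' \<in> D" "S w \<noteq> S w'" for w w'
        using same[of w w'] S(1)[of w] S(1)[of w'] that by blast
      show ?thesis using Q FS SS by blast
    qed
    show "serves (1/9210) (1/6140) X H Q" if "Q \<in> insert F (S ` D)" for Q
      using that sF sD by blast
  qed
  moreover have "H \<noteq> {}" unfolding H_def by blast
  ultimately show ?thesis using HX by blast
qed

text \<open>In an irreducible \<open>X\<close> give each vertex the charge degree minus three; the
  total is negative. Degrees are at least two, and by \<open>reducible_path\<close> different
  vertices of \<open>T\<close> lie in different components of \<open>R\<close>. The unit owed to
  such a vertex is shared among the vertices \<open>N w\<close> of \<open>Q\<close> next to its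
  component. Some vertex of \<open>Q\<close> must be unable to pay, and it is a hub.\<close>

lemma reducible_exists:
  assumes X: "finite X" "X \<noteq> {}" and sparse: "(\<Sum>v\<in>X. deg X v) < 3 * card X"
  shows "\<exists>H\<subseteq>X. H \<noteq> {} \<and> serves (1/27630) (1/18420) X H H"
proof (rule ccontr)
  assume "\<not> ?thesis"
  then have irr: "\<not> serves (1/27630) (1/18420) X H H" if "H \<subseteq> X" "H \<noteq> {}" for H using that by blast
  define R where "R = {v \<in> X. deg X v \<le> 3}"
  define T where "T = {v \<in> X. deg X v = 2}"
  define Q where "Q = X - R"
  let ?C = "component R"
  have fin: "finite R" "finite T" "finite Q" using X unfolding R_def T_def Q_def by auto
  have TR: "T \<subseteq> R" and RX: "R \<subseteq> X" unfolding T_def R_def by auto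
  have low: "2 \<le> deg X v" if v: "v \<in> X" for v
  proof (rule ccontr)
    assume "\<not> 2 \<le> deg X v"
    then have d: "deg X v \<le> 1" by simp
    have "forest {v}" unfolding forest_def
    proof (intro allI impI)
      fix U assume "U \<subseteq> {v}" "U \<noteq> {}"
      then have "U = {v}" by blast
      then show "\<exists>u\<in>U. deg U u \<le> 1" by (simp add: deg_singleton irrefl)
    qed
    moreover have "deg (X - {v}) v \<le> 1"
      using deg_mono[OF X(1) Diff_subset, of "{v}" v] d by linarith
    ultimately show False using reducible_forest[OF X(1), of "{v}"] irr[of "{v}"] v by blast
  qed
  have T2: "w \<in> X" "deg X w = 2" if "w \<in> T" for w using that unfolding T_def by auto
  have alone: "w' = w" if "w \<in> T" "w' \<in> T" "w' \<in> ?C w" for w w'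
    using reducible_path[OF X(1) R_def, of w w'] T2[OF that(1)] T2[OF that(2)] that(3) irr by auto
  have disj: "?C w \<inter> ?C w' = {}" if "w \<in> T" "w' \<in> T" "w \<noteq> w'" for w w'
    using component_meet[of w R w'] alone[OF that(1,2)] TR that by blast
  have CR: "?C w \<subseteq> R" if "w \<in> T" for w using component_subset TR that by blast
  define N where "N w = {y \<in> Q. nbs (?C w) y \<noteq> {}}" for w
  have fN: "finite (N w)" for w unfolding N_def using fin by simp
  have out: "u \<in> N w" if "w \<in> T" "v \<in> ?C w" "u \<in> X - ?C w" "adj v u" for u v w
  proof -
    have "u \<notin> R" using component_closed[OF that(2) _ that(4)] that(3) by blast
    moreover have "v \<in> nbs (?C w) u" using that sym by (simp add: mem_nbs)
    ultimately show ?thesis using that(3) unfolding N_def Q_def by blast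
  qed
  have Cne: "?C w \<subseteq> X" "?C w \<noteq> {}" if "w \<in> T" for w
    using CR[OF that] RX component_root[of w R] by blast+
  \<comment> \<open>With fewer than two edges to \<open>Q\<close> the component would fall under
    \<open>reducible_pendant\<close>.\<close>
  have two: "2 \<le> (\<Sum>y\<in>N w. deg (?C w) y)" if w: "w \<in> T" for w
  proof (rule ccontr)
    assume c: "\<not> ?thesis"
    have pos: "1 \<le> deg (?C w) y" if "y \<in> N w" for y
    proof -
      have "finite (nbs (?C w) y)" using Cne(1)[OF w] X(1) by (meson finite_nbs finite_subset)
      then have "0 < deg (?C w) y" using that card_gt_0_iff unfolding N_def deg_def by blast
      then show ?thesis by simp
    qed
    have "(\<Sum>y\<in>N w. 1) \<le> (\<Sum>y\<in>N w. deg (?C w) y)" using pos by (rule sum_mono)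
    then have c1: "card (N w) \<le> Suc 0" using c by simp
    have wX: "w \<in> X" "deg X w \<le> 2" using T2[OF w] by auto
    have nbsN: "nbs (X - ?C w) v \<subseteq> N w" if "v \<in> ?C w" for v
      using out[OF w that] unfolding nbs_def by blast
    have "\<exists>y\<in>?C w. deg (X - ?C w) y \<le> 1 \<and> (\<forall>v\<in>?C w. v \<noteq> y \<longrightarrow> nbs (X - ?C w) v = {})"
    proof (cases "N w = {}")
      case True
      then show ?thesis using nbsN component_root[of w R] unfolding deg_def
        by (intro bexI[of _ w]) auto
    next
      case False
      then obtain z where z: "N w = {z}" using c1 fN[of w] by (metis card_le_Suc0_iff_eq is_singletonI' is_singleton_the_elem)
      have "deg (?C w) z \<le> 1" using c z by simp
      then obtain y where y: "y \<in> nbs (?C w) z" "\<And>v. v \<in> nbs (?C w) z \<Longrightarrow> v = y"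
      proof -
        have f: "finite (nbs (?C w) z)" using Cne(1)[OF w] X(1) by (meson finite_nbs finite_subset)
        obtain y where "y \<in> nbs (?C w) z" using z unfolding N_def by blast
        moreover have "card (nbs (?C w) z) \<le> Suc 0" using \<open>deg (?C w) z \<le> 1\<close> unfolding deg_def by simp
        ultimately show ?thesis using that f by (metis card_le_Suc0_iff_eq)
      qed
      have "v = y" if v: "v \<in> ?C w" "nbs (X - ?C w) v \<noteq> {}" for v
      proof -
        obtain u where u: "u \<in> nbs (X - ?C w) v" using v(2) by blast
        then have "u = z" using nbsN[OF v(1)] z by blast
        then show ?thesis using y(2)[of v] v(1) u sym by (simp add: mem_nbs)
      qed
      moreover have "deg (X - ?C w) y \<le> 1"
      proof -
        have yC: "y \<in> ?C w" using y(1) by (simp add: mem_nbs)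
        have "card (nbs (X - ?C w) y) \<le> card {z}"
          using nbsN[OF yC] z by (intro card_mono) auto
        then show ?thesis unfolding deg_def by simp
      qed
      ultimately show ?thesis using y(1) by (intro bexI[of _ y]) (auto simp: mem_nbs)
    qed
    then obtain y where "y \<in> ?C w" "deg (X - ?C w) y \<le> 1" "\<And>v. v \<in> ?C w \<Longrightarrow> v \<noteq> y \<Longrightarrow> nbs (X - ?C w) v = {}"
      by blast
    from reducible_pendant[OF X(1) R_def wX this] irr[OF Cne[OF w]] show False by blast
  qed
  \<comment> \<open>Payments in half units: a sole neighbour pays the whole unit, otherwise each
    neighbour pays half.\<close>
  define g :: "'a \<Rightarrow> 'a \<Rightarrow> nat" where "g w y = (if y \<in> N w then if N w = {y} then 2 else 1 else 0)" for w y
  have gsum: "2 \<le> (\<Sum>y\<in>Q. g w y)" if w: "w \<in> T" for w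
  proof -
    have NQ: "N w \<subseteq> Q" unfolding N_def by blast
    have "(\<Sum>y\<in>N w. g w y) \<le> (\<Sum>y\<in>Q. g w y)" using fin(3) NQ by (intro sum_mono2) auto
    moreover have "2 \<le> (\<Sum>y\<in>N w. g w y)"
    proof (cases "\<exists>y. N w = {y}")
      case True
      then show ?thesis unfolding g_def by auto
    next
      case False
      then have "(\<Sum>y\<in>N w. g w y) = card (N w)" unfolding g_def by simp
      moreover have "N w \<noteq> {}" using two[OF w] by auto
      then have "2 \<le> card (N w)" using False fN[of w]
        by (metis card_0_eq card_1_singletonE One_nat_def less_2_cases_iff not_less)
      ultimately show ?thesis by simp
    qed
    ultimately show ?thesis by linarith
  qed
  \<comment> \<open>The budget of \<open>y\<close> is \<open>2 * deg X y - 6\<close> half units; a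
    payment exceeding it by at least one gives the 5.\<close>
  have "\<exists>y\<in>Q. 2 * deg X y \<le> (\<Sum>w\<in>T. g w y) + 5"
  proof (rule ccontr)
    assume none: "\<not> ?thesis"
    have small: "int (\<Sum>w\<in>T. g w y) \<le> 2 * int (deg X y) - 6" if "y \<in> Q" for y
    proof -
      have "(\<Sum>w\<in>T. g w y) + 6 \<le> 2 * deg X y" using none that by auto
      then have "int ((\<Sum>w\<in>T. g w y) + 6) \<le> int (2 * deg X y)" by (simp only: of_nat_le_iff)
      then show ?thesis by simp
    qed
    have "2 * int (card T) = int (\<Sum>w\<in>T. 2)" by simp
    also have "\<dots> \<le> int (\<Sum>w\<in>T. \<Sum>y\<in>Q. g w y)" using gsum by (intro of_nat_mono sum_mono)
    also have "\<dots> = (\<Sum>y\<in>Q. int (\<Sum>w\<in>T. g w y))" by (subst sum.swap) simp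
    also have "\<dots> \<le> (\<Sum>y\<in>Q. 2 * int (deg X y) - 6)" by (intro sum_mono small)
    also have "\<dots> = 2 * (\<Sum>y\<in>Q. int (deg X y) - 3)" by (simp add: sum_distrib_left algebra_simps)
    finally have 1: "int (card T) \<le> (\<Sum>y\<in>Q. int (deg X y) - 3)" by simp
    have "(\<Sum>y\<in>R. int (deg X y) - 3) = (\<Sum>y\<in>R. if y \<in> T then -1 else 0)"
    proof (rule sum.cong[OF refl])
      fix v assume v: "v \<in> R"
      then have "v \<in> X" "deg X v \<le> 3" unfolding R_def by auto
      then show "int (deg X v) - 3 = (if v \<in> T then -1 else 0)" using low[of v] unfolding T_def by auto
    qed
    also have "\<dots> = - int (card T)"
      using fin(1) TR by (simp add: sum.If_cases Int_absorb1)
    finally have 2: "(\<Sum>y\<in>R. int (deg X y) - 3) = - int (card T)" .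
    have "(\<Sum>y\<in>X. int (deg X y) - 3) = (\<Sum>y\<in>Q. int (deg X y) - 3) + (\<Sum>y\<in>R. int (deg X y) - 3)"
      unfolding Q_def by (rule sum.subset_diff[OF RX X(1)])
    moreover have "(\<Sum>y\<in>X. int (deg X y) - 3) = int (\<Sum>v\<in>X. deg X v) - 3 * int (card X)"
      by (simp add: sum_subtractf)
    moreover have "int (\<Sum>v\<in>X. deg X v) < 3 * int (card X)" using sparse by linarith
    ultimately show False using 1 2 by linarith
  qed
  then obtain y where y: "y \<in> Q" "2 * deg X y \<le> (\<Sum>w\<in>T. g w y) + 5" by blast
  define A where "A = {w \<in> T. y \<in> N w \<and> N w \<noteq> {y}}"
  define D where "D = {w \<in> T. N w = {y}}"
  have sub: "A \<subseteq> T" "D \<subseteq> T" and AD: "A \<inter> D = {}" unfolding A_def D_def by auto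
  have fAD: "finite A" "finite D" using sub fin(2) finite_subset by auto
  have "(\<Sum>w\<in>T. g w y) = (\<Sum>w\<in>A \<union> D. g w y)"
    using fin(2) sub unfolding g_def A_def D_def by (intro sum.mono_neutral_right) auto
  also have "\<dots> = (\<Sum>w\<in>A. g w y) + (\<Sum>w\<in>D. g w y)" by (rule sum.union_disjoint[OF fAD AD])
  also have "(\<Sum>w\<in>A. g w y) = card A" unfolding g_def A_def by simp
  also have "(\<Sum>w\<in>D. g w y) = 2 * card D" unfolding g_def D_def by simp
  finally have count: "2 * deg X y \<le> card A + 2 * card D + 5" using y(2) by simp
  have yX: "y \<in> X" "4 \<le> deg X y" using y(1) unfolding Q_def R_def by auto
  have "\<exists>H\<subseteq>X. H \<noteq> {} \<and> serves (1/27630) (1/18420) X H H"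
  proof (rule reducible_hub[OF X(1) R_def yX fAD AD _ _ _ _ _ count])
    show "w \<in> X \<and> deg X w = 2" if "w \<in> A \<union> D" for w using that sub T2 by blast
    show "?C w \<inter> ?C w' = {}" if "w \<in> A \<union> D" "w' \<in> A \<union> D" "w \<noteq> w'" for w w'
      using disj that sub by blast
    show "nbs (?C w) y \<noteq> {}" if "w \<in> A" for w using that unfolding A_def N_def by blast
    show "2 \<le> deg (?C w) y" if "w \<in> D" for w using two[of w] that unfolding D_def by simp
    show "nbs (X - R) v \<subseteq> {y}" if "w \<in> D" "v \<in> ?C w" for w v
    proof
      fix u assume "u \<in> nbs (X - R) v"
      then have u: "u \<in> X - R" "adj v u" by (simp_all add: mem_nbs)
      have "w \<in> T" using that(1) sub by blast
      then have "u \<in> N w" using out[of w v u] that(2) u CR[of w] by blast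
      then show "u \<in> {y}" using that(1) unfolding D_def by blast
    qed
  qed
  then show False using irr by blast
qed

end

section \<open>From maximum average degree to degree sums\<close>

lemma handshake:
  assumes "finite W" "\<And>e. e \<in> F \<Longrightarrow> e \<subseteq> W \<and> card e = 2"
  shows "(\<Sum>v\<in>W. card {u \<in> W. {v, u} \<in> F}) = 2 * card F"
proof -
  have fF: "finite F" using assms by (intro finite_subset[of F "Pow W"]) auto
  have "card {u \<in> W. {v, u} \<in> F} = card {e \<in> F. v \<in> e}" if v: "v \<in> W" for v
  proof (rule bij_betw_same_card[of "\<lambda>u. {v, u}"])
    show "bij_betw (\<lambda>u. {v, u}) {u \<in> W. {v, u} \<in> F} {e \<in> F. v \<in> e}"
      unfolding bij_betw_def
    proof
      show "inj_on (\<lambda>u. {v, u}) {u \<in> W. {v, u} \<in> F}" by (auto simp: inj_on_def doubleton_eq_iff)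
      show "(\<lambda>u. {v, u}) ` {u \<in> W. {v, u} \<in> F} = {e \<in> F. v \<in> e}"
      proof (intro equalityI subsetI)
        fix e assume e: "e \<in> {e \<in> F. v \<in> e}"
        then have eF: "e \<in> F" "v \<in> e" "e \<subseteq> W" "card e = 2" using assms(2) by blast+
        obtain s t where "e = {s, t}" using eF(4) by (meson card_2_iff)
        then obtain u where u: "e = {v, u}" using eF(2) by blast
        then have "u \<in> {u \<in> W. {v, u} \<in> F}" using eF by simp
        then show "e \<in> (\<lambda>u. {v, u}) ` {u \<in> W. {v, u} \<in> F}" using u by (rule rev_image_eqI)
      qed auto
    qed
  qed
  then have "(\<Sum>v\<in>W. card {u \<in> W. {v, u} \<in> F}) = (\<Sum>v\<in>W. \<Sum>e\<in>F. if v \<in> e then 1 else 0)"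
    using fF by (simp add: sum.If_cases Int_def)
  also have "\<dots> = (\<Sum>e\<in>F. \<Sum>v\<in>W. if v \<in> e then 1 else 0)" by (rule sum.swap)
  also have "\<dots> = (\<Sum>e\<in>F. 2)"
  proof (rule sum.cong[OF refl])
    fix e assume "e \<in> F"
    then have "e \<subseteq> W" "card e = 2" using assms(2) by auto
    then show "(\<Sum>v\<in>W. if v \<in> e then 1 else 0) = (2::nat)"
      using assms(1) by (simp add: sum.If_cases Int_absorb1)
  qed
  finally show ?thesis by simp
qed

lemma mad_bound:
  assumes "finite_simple_graph V E" "W \<subseteq> V" "W \<noteq> {}" "F \<subseteq> E" "\<And>e. e \<in> F \<Longrightarrow> e \<subseteq> W"
  shows "2 * real (card F) / real (card W) \<le> mad V E"
proof -
  have V: "finite V" "\<And>e. e \<in> E \<Longrightarrow> e \<subseteq> V \<and> card e = 2"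
    using assms(1) unfolding finite_simple_graph_def by auto
  have fE: "finite E" using V by (intro finite_subset[of E "Pow V"]) auto
  let ?M = "{2 * real (card F) / real (card W) | W F. subgraph W F V E \<and> W \<noteq> {}}"
  have "?M \<subseteq> (\<lambda>(W, F). 2 * real (card F) / real (card W)) ` (Pow V \<times> Pow E)"
    unfolding subgraph_def by auto
  then have "finite ?M" using V(1) fE by (meson finite_Pow_iff finite_SigmaI finite_imageI finite_subset)
  moreover have "subgraph W F V E"
    using assms V finite_subset[OF assms(2) V(1)] unfolding subgraph_def finite_simple_graph_def by blast
  then have "2 * real (card F) / real (card W) \<in> ?M" using assms(3) by blast
  ultimately have "2 * real (card F) / real (card W) \<le> Max ?M" by (rule Max_ge)
  moreover have "V \<noteq> {}" using assms(2,3) by blast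
  ultimately show ?thesis unfolding mad_def by simp
qed

theorem theorem1p6:
  fixes V :: "'a set" and E :: "'a set set"
  assumes "finite_simple_graph V E"
    and "mad V E < 3"
  shows "weighted_flexibly_choosable (1 / 2 ^ 30) 3 V E"
  unfolding weighted_flexibly_choosable_def
proof (intro allI impI)
  fix L w assume L: "k_assignment 3 V L" and w: "weighted_request V L w"
  have V: "finite V" "\<And>e. e \<in> E \<Longrightarrow> e \<subseteq> V \<and> card e = 2"
    using assms(1) unfolding finite_simple_graph_def by auto
  let ?adj = "\<lambda>u v. {u, v} \<in> E"
  \<comment> \<open>The locale asks for lists of size three at every element of the type, so
    vertices outside \<open>V\<close> get a default list, which is added to the palette.\<close>
  let ?L = "\<lambda>v. if v \<in> V then L v else {1, 2, 3}"
  let ?C = "(\<Union>v\<in>V. L v) \<union> {1, 2, 3}"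
  let ?a = "\<lambda>v c. if v \<in> V \<and> c \<in> L v then w v c else 0"
  have Lv: "finite (L v)" "card (L v) = 3" if "v \<in> V" for v
    using L that unfolding k_assignment_def by auto
  interpret list_graph ?adj ?L ?C
  proof
    show "{v, u} \<in> E" if "{u, v} \<in> E" for u v using that by (simp add: insert_commute)
    show "{v, v} \<notin> E" for v using V(2)[of "{v, v}"] by auto
    show "card (?L v) = 3" for v using Lv by auto
    show "finite ?C" using V(1) Lv(1) by auto
    show "?L v \<subseteq> ?C" for v by auto
  qed
  have sparse: "(\<Sum>v\<in>W. deg W v) < 3 * card W" if W: "W \<subseteq> V" "W \<noteq> {}" for W
  proof -
    have fW: "finite W" using W(1) V(1) by (rule finite_subset)
    let ?F = "{e \<in> E. e \<subseteq> W}"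
    have "deg W v = card {u \<in> W. {v, u} \<in> ?F}" if "v \<in> W" for v
      unfolding deg_def nbs_def using that by (intro arg_cong[of _ _ card]) auto
    then have "(\<Sum>v\<in>W. deg W v) = (\<Sum>v\<in>W. card {u \<in> W. {v, u} \<in> ?F})" by (rule sum.cong[OF refl])
    also have "\<dots> = 2 * card ?F" using V(2) by (intro handshake[OF fW]) auto
    finally have d: "(\<Sum>v\<in>W. deg W v) = 2 * card ?F" .
    have "2 * real (card ?F) / real (card W) \<le> mad V E"
      by (rule mad_bound[OF assms(1) W]) blast+
    then have "2 * real (card ?F) / real (card W) < 3" using assms(2) by (rule le_less_trans)
    moreover have "0 < card W" using fW W(2) by (simp add: card_gt_0_iff)
    ultimately have "2 * real (card ?F) < 3 * real (card W)" by (simp add: divide_less_eq)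
    then show ?thesis unfolding d by linarith
  qed
  have a: "nonneg ?a" using w unfolding nonneg_def weighted_request_def by auto
  \<comment> \<open>Initially nothing is to be avoided; avoidance rewards arise only in the
    induction.\<close>
  have z: "nonneg (\<lambda>_ _. 0 :: real)" unfolding nonneg_def by simp
  have red: "\<exists>H\<subseteq>X. H \<noteq> {} \<and> serves (1/27630) (1/18420) X H H" if "X \<subseteq> V" "X \<noteq> {}" for X
    using reducible_exists[OF finite_subset[OF that(1) V(1)] that(2) sparse[OF that]] .
  obtain \<phi> where \<phi>: "col V ?L \<phi>"
    "1/27630 * (1/18420) * (\<Sum>v\<in>V. \<Sum>c\<in>?L v. ?a v c) \<le> (\<Sum>v\<in>V. ?a v (\<phi> v))"
    using flexible_induct[OF V(1) red _ _ _ subset_refl a z] by (auto simp: payoff_def)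
  have c: "\<phi> v \<in> L v" if "v \<in> V" for v using \<phi>(1) that unfolding col_def by auto
  have "L_coloring V E L \<phi>"
    using \<phi>(1) c unfolding L_coloring_def proper_coloring_def col_def by blast
  moreover have "1 / 2 ^ 30 * (\<Sum>v\<in>V. \<Sum>c\<in>L v. w v c) \<le> (\<Sum>v\<in>V. w v (\<phi> v))"
  proof -
    have "0 \<le> (\<Sum>v\<in>V. \<Sum>c\<in>L v. w v c)"
      using w unfolding weighted_request_def by (intro sum_nonneg) auto
    \<comment> \<open>27630 * 18420 = 508944600, which is less than 2 ^ 30 = 1073741824.\<close>
    then have "1 / 2 ^ 30 * (\<Sum>v\<in>V. \<Sum>c\<in>L v. w v c) \<le> 1/27630 * (1/18420) * (\<Sum>v\<in>V. \<Sum>c\<in>L v. w v c)"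
      by (intro mult_right_mono) auto
    also have "\<dots> = 1/27630 * (1/18420) * (\<Sum>v\<in>V. \<Sum>c\<in>?L v. ?a v c)"
      by (intro arg_cong2[of _ _ _ _ "(*)"] sum.cong refl) auto
    also have "\<dots> \<le> (\<Sum>v\<in>V. ?a v (\<phi> v))" by (rule \<phi>(2))
    also have "\<dots> = (\<Sum>v\<in>V. w v (\<phi> v))" using c by (intro sum.cong) auto
    finally show ?thesis .
  qed
  ultimately show "\<exists>\<phi>. L_coloring V E L \<phi> \<and> 1 / 2 ^ 30 * (\<Sum>v\<in>V. \<Sum>c\<in>L v. w v c) \<le> (\<Sum>v\<in>V. w v (\<phi> v))"
    by blast
qed

end
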